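(* Suppose that $\Gamma$ is a connected (finite) graph with Euler characteristic $\chi(\Gamma) \ge 0$, and $(\mathcal{G},\Gamma)$ is a finite graph of groups with finitely generated abelian vertex groups and with cyclic edge groups. Then the fundamental group $G$ of this graph of groups has property (VRC) if and only if $G$ is balanced.
   Context: A subgroup $H$ of a group $G$ is a virtual retract of $G$ if there is a finite index subgroup $K$ of $G$ such that $H \subseteq K$ and there is a homomorphism $\rho: K \to H$ whose restriction to $H$ is the identity map. A group has property (VRC) if every cyclic subgroup is a virtual retract. A group $G$ is balanced if for every infinite order element $g \in G$ and all $k,l \in \mathbb{Z}\setminus\{0\}$, if $g^k$ is conjugate to $g^l$ in $G$ then $l = \pm k$. Graphs are in the sense of Serre: a graph $\Gamma$ has a vertex set $V\Gamma$, an edge set $E\Gamma$, an inversion map $e \mapsto \overline{e}$ on $E\Gamma$ with $\overline{e} \ne e$ and $\overline{\overline{e}} = e$, and incidence maps $\alpha,\omega: E\Gamma \to V\Gamma$ with $\omega(\overline{e}) = \alpha(e)$. The Euler characteristic of a finite graph is $\chi(\Gamma) = |V\Gamma| - \frac12 |E\Gamma|$. An orientation is a decomposition $E\Gamma = E\Gamma^+ \sqcup E\Gamma^-$ with $E\Gamma^- = \{\overline{e} \mid e \in E\Gamma^+\}$. A finite graph of groups $(\mathcal{G},\Gamma)$ consists of a non-empty finite connected graph $\Gamma$, vertex groups $G_v$ ($v \in V\Gamma$), edge groups $G_e$ ($e \in E\Gamma$) with $G_e = G_{\overline{e}}$, and monomorphisms $\alpha_e: G_e \to G_{\alpha(e)}$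 ($e \in E\Gamma$); put $\omega_e := \alpha_{\overline{e}}: G_e \to G_{\omega(e)}$. Given a maximal tree $T$ in $\Gamma$ and an orientation, its fundamental group is the group generated by all $G_v$, $v \in V\Gamma$, and free letters $t_e$, $e \in E\Gamma^+$, subject to the relations of the vertex groups, $t_e\, \omega_e(a)\, t_e^{-1} = \alpha_e(a)$ for all $e \in E\Gamma^+$, $a \in G_e$, and $t_f = 1$ for all $f \in ET \cap E\Gamma^+$; up to isomorphism it does not depend on the choices. *)

theory Defs
  imports
    "HOL-Algebra.Elementary_Groups"
    "HOL-Algebra.Multiplicative_Group"
    "Graph_Theory.Bidirected_Digraph"
    "Graph_Theory.Digraph_Component"
begin

section \<open>Group-theoretic notions\<close>

definition finitely_generated :: "('a, 'm) monoid_scheme \<Rightarrow> bool" where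
  "finitely_generated G \<longleftrightarrow> (\<exists>S. finite S \<and> S \<subseteq> carrier G \<and> generate G S = carrier G)"

definition virtual_retract :: "'a set \<Rightarrow> ('a, 'm) monoid_scheme \<Rightarrow> bool" where
  "virtual_retract H G \<longleftrightarrow> subgroup H G \<and>
     (\<exists>K. subgroup K G \<and> finite (rcosets\<^bsub>G\<^esub> K) \<and> H \<subseteq> K \<and>
        (\<exists>\<rho> \<in> hom (G\<lparr>carrier := K\<rparr>) (G\<lparr>carrier := H\<rparr>). \<forall>h\<in>H. \<rho> h = h))"

definition VRC :: "('a, 'm) monoid_scheme \<Rightarrow> bool" where
  "VRC G \<longleftrightarrow> (\<forall>H. subgroup H G \<and> cyclic_group (G\<lparr>carrier := H\<rparr>) \<longrightarrow> virtual_retract H G)"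

text \<open>\<^const>\<open>group.ord\<close> takes the value 0 exactly on the elements of infinite order.\<close>

definition balanced :: "('a, 'm) monoid_scheme \<Rightarrow> bool" where
  "balanced G \<longleftrightarrow>
     (\<forall>g \<in> carrier G. group.ord G g = 0 \<longrightarrow>
        (\<forall>k l :: int. k \<noteq> 0 \<and> l \<noteq> 0 \<and>
           (\<exists>x \<in> carrier G. x \<otimes>\<^bsub>G\<^esub> (g [^]\<^bsub>G\<^esub> k) \<otimes>\<^bsub>G\<^esub> inv\<^bsub>G\<^esub> x = g [^]\<^bsub>G\<^esub> l)
           \<longrightarrow> l = k \<or> l = - k))"


section \<open>Groups given by generators and relations\<close>

text \<open>
  A word is a list of signed generators; the letter \<open>(True, x)\<close> stands for the generator \<open>x\<close> and
  \<open>(False, x)\<close> for its formal inverse.  A relation \<open>u = v\<close> is the pair of words \<open>(u, v)\<close>.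
\<close>

type_synonym 'x word = "(bool \<times> 'x) list"

abbreviation words :: "'x set \<Rightarrow> 'x word set" where
  "words X \<equiv> lists (UNIV \<times> X)"

text \<open>The least congruence on words that makes \<open>(False, x)\<close> inverse to \<open>(True, x)\<close> and
  identifies the two sides of every relation.\<close>

inductive_set pres_cong :: "'x set \<Rightarrow> ('x word \<times> 'x word) set \<Rightarrow> ('x word \<times> 'x word) set"
  for X :: "'x set" and R :: "('x word \<times> 'x word) set"
where
  refl: "w \<in> words X \<Longrightarrow> (w, w) \<in> pres_cong X R"
| sym: "(u, v) \<in> pres_cong X R \<Longrightarrow> (v, u) \<in> pres_cong X R"
| trans: "(u, v) \<in> pres_cong X R \<Longrightarrow> (v, w) \<in> pres_cong X R \<Longrightarrow> (u, w) \<in> pres_cong X R"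
| append: "(u, u') \<in> pres_cong X R \<Longrightarrow> (v, v') \<in> pres_cong X R \<Longrightarrow> (u @ v, u' @ v') \<in> pres_cong X R"
| cancel: "x \<in> X \<Longrightarrow> ([(b, x), (\<not> b, x)], []) \<in> pres_cong X R"
| rel: "(u, v) \<in> R \<Longrightarrow> u \<in> words X \<Longrightarrow> v \<in> words X \<Longrightarrow> (u, v) \<in> pres_cong X R"

definition presented_group :: "'x set \<Rightarrow> ('x word \<times> 'x word) set \<Rightarrow> 'x word set monoid" where
  "presented_group X R =
     \<lparr>carrier = words X // pres_cong X R,
      monoid.mult = (\<lambda>A B. \<Union>u\<in>A. \<Union>v\<in>B. pres_cong X R `` {u @ v}),
      one = pres_cong X R `` {[]}\<rparr>"

lemma pres_cong_words: "(u, v) \<in> pres_cong X R \<Longrightarrow> u \<in> words X \<and> v \<in> words X"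
  by (induction rule: pres_cong.induct) auto

lemma equiv_pres_cong: "equiv (words X) (pres_cong X R)"
proof (rule equivI)
  show "pres_cong X R \<subseteq> words X \<times> words X" by (auto dest: pres_cong_words simp del: in_lists_conv_set)
  show "refl_on (words X) (pres_cong X R)" by (rule refl_onI) (rule pres_cong.refl)
  show "Relation.sym (pres_cong X R)" by (rule symI) (rule pres_cong.sym)
  show "Relation.trans (pres_cong X R)" by (rule transI) (rule pres_cong.trans)
qed

lemma presented_group_mult:
  assumes "u \<in> words X" "v \<in> words X"
  shows "(pres_cong X R `` {u}) \<otimes>\<^bsub>presented_group X R\<^esub> (pres_cong X R `` {v})
           = pres_cong X R `` {u @ v}"
proof -
  have "pres_cong X R `` {u' @ v'} = pres_cong X R `` {u @ v}"
    if "(u, u') \<in> pres_cong X R" "(v, v') \<in> pres_cong X R" for u' v'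
    using equiv_class_eq[OF equiv_pres_cong pres_cong.append[OF that]] by simp
  moreover have "(u, u) \<in> pres_cong X R" "(v, v) \<in> pres_cong X R"
    using assms pres_cong.refl by blast+
  ultimately have "(\<Union>u'\<in>pres_cong X R `` {u}. \<Union>v'\<in>pres_cong X R `` {v}. pres_cong X R `` {u' @ v'})
      = pres_cong X R `` {u @ v}" by blast
  then show ?thesis by (simp add: presented_group_def)
qed

lemma pres_cong_inverse:
  assumes "w \<in> words X"
  shows "\<exists>w' \<in> words X. (w' @ w, []) \<in> pres_cong X R"
  using assms
proof (induction w)
  case Nil
  have "([] @ [], []) \<in> pres_cong X R" by (simp add: pres_cong.refl)
  then show ?case by (rule bexI) simp
next
  case (Cons l w)
  obtain b x where l: "l = (b, x)" by force
  have x: "x \<in> X" and w: "w \<in> words X" using Cons.hyps l by auto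
  obtain w' where w': "w' \<in> words X" "(w' @ w, []) \<in> pres_cong X R" using Cons.IH by blast
  have "([(\<not> b, x), (b, x)], []) \<in> pres_cong X R"
    using pres_cong.cancel[OF x, of "\<not> b"] by simp
  from pres_cong.append[OF pres_cong.refl[OF w'(1)]
      pres_cong.append[OF this pres_cong.refl[OF w]]]
  have "((w' @ [(\<not> b, x)]) @ l # w, w' @ w) \<in> pres_cong X R" using l by simp
  from pres_cong.trans[OF this w'(2)]
  have "((w' @ [(\<not> b, x)]) @ l # w, []) \<in> pres_cong X R" .
  moreover have "w' @ [(\<not> b, x)] \<in> words X" using w'(1) x by auto
  ultimately show ?case by blast
qed

lemma group_presented_group: "group (presented_group X R)"
proof -
  let ?G = "presented_group X R" and ?c = "\<lambda>w. pres_cong X R `` {w}"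
  have carrI: "?c w \<in> carrier ?G" if "w \<in> words X" for w
    using quotientI[OF that] by (simp add: presented_group_def)
  have carrE: "\<exists>w \<in> words X. A = ?c w" if "A \<in> carrier ?G" for A
    using that by (simp add: presented_group_def) (metis quotientE)
  have one: "\<one>\<^bsub>?G\<^esub> = ?c []" by (simp add: presented_group_def)
  note mult = presented_group_mult[where X = X and R = R]
  have nil: "[] \<in> words X" by simp
  have app: "u @ v \<in> words X" if "u \<in> words X" "v \<in> words X" for u v
    using that by (simp only: append_in_lists_conv simp_thms)
  show ?thesis
  proof (rule groupI)
    show "\<one>\<^bsub>?G\<^esub> \<in> carrier ?G" unfolding one by (rule carrI[OF nil])
  next
    fix A B assume "A \<in> carrier ?G" "B \<in> carrier ?G"
    then obtain u v where u: "u \<in> words X" "A = ?c u" and v: "v \<in> words X" "B = ?c v"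
      using carrE by meson
    show "A \<otimes>\<^bsub>?G\<^esub> B \<in> carrier ?G"
      unfolding u(2) v(2) mult[OF u(1) v(1)] by (rule carrI[OF app[OF u(1) v(1)]])
  next
    fix A B C assume "A \<in> carrier ?G" "B \<in> carrier ?G" "C \<in> carrier ?G"
    then obtain u v w where u: "u \<in> words X" "A = ?c u" and v: "v \<in> words X" "B = ?c v"
      and w: "w \<in> words X" "C = ?c w" using carrE by meson
    show "A \<otimes>\<^bsub>?G\<^esub> B \<otimes>\<^bsub>?G\<^esub> C = A \<otimes>\<^bsub>?G\<^esub> (B \<otimes>\<^bsub>?G\<^esub> C)"
      unfolding u(2) v(2) w(2) mult[OF u(1) v(1)] mult[OF v(1) w(1)]
        mult[OF app[OF u(1) v(1)] w(1)] mult[OF u(1) app[OF v(1) w(1)]]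
      by (simp only: append_assoc)
  next
    fix A assume "A \<in> carrier ?G"
    then obtain u where u: "u \<in> words X" "A = ?c u" using carrE by meson
    show "\<one>\<^bsub>?G\<^esub> \<otimes>\<^bsub>?G\<^esub> A = A"
      unfolding one u(2) mult[OF nil u(1)] by (simp only: append_Nil)
    obtain u' where u': "u' \<in> words X" "(u' @ u, []) \<in> pres_cong X R"
      using pres_cong_inverse[OF u(1)] by blast
    have "?c u' \<otimes>\<^bsub>?G\<^esub> A = \<one>\<^bsub>?G\<^esub>"
      unfolding one u(2) mult[OF u'(1) u(1)] by (rule equiv_class_eq[OF equiv_pres_cong u'(2)])
    then show "\<exists>B \<in> carrier ?G. B \<otimes>\<^bsub>?G\<^esub> A = \<one>\<^bsub>?G\<^esub>" by (rule bexI) (rule carrI[OF u'(1)])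
  qed
qed


section \<open>Graphs in the sense of Serre\<close>

text \<open>
  A graph in the sense of Serre is a \<^locale>\<open>bidirected_digraph\<close>: \<open>arev\<close> is the inversion of
  edges, a fixed-point-free involution on \<open>arcs\<close> (by convention of that locale it is the identity
  outside \<open>arcs\<close>), and \<open>tail\<close>, \<open>head\<close> are the incidence maps \<open>\<alpha>\<close>, \<open>\<omega>\<close>.
\<close>

definition euler_characteristic :: "('v, 'e) pre_digraph \<Rightarrow> real" where
  "euler_characteristic \<Gamma> = real (card (verts \<Gamma>)) - real (card (arcs \<Gamma>)) / 2"

text \<open>
  A directed cycle \<open>[e, arev e]\<close> only backtracks along an edge; all other directed cycles (loops
  and pairs of parallel edges included) are circuits.  A tree is a connected graph without circuits;
  \<^const>\<open>forest\<close> is of no use here as it forbids \<open>[e, arev e]\<close> too.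
\<close>

definition circuit :: "('e \<Rightarrow> 'e) \<Rightarrow> ('v, 'e) pre_digraph \<Rightarrow> 'e list \<Rightarrow> bool" where
  "circuit arev \<Gamma> p \<longleftrightarrow> pre_digraph.cycle \<Gamma> p \<and> (\<nexists>e. p = [e, arev e])"

definition serre_tree :: "('e \<Rightarrow> 'e) \<Rightarrow> ('v, 'e) pre_digraph \<Rightarrow> bool" where
  "serre_tree arev T \<longleftrightarrow>
     arev ` arcs T \<subseteq> arcs T \<and> Digraph_Component.connected T \<and> (\<nexists>p. circuit arev T p)"

definition maximal_tree ::
  "('e \<Rightarrow> 'e) \<Rightarrow> ('v, 'e) pre_digraph \<Rightarrow> ('v, 'e) pre_digraph \<Rightarrow> bool" where
  "maximal_tree arev \<Gamma> T \<longleftrightarrow> pre_digraph.max_subgraph \<Gamma> (serre_tree arev) T"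

definition orientation :: "('e \<Rightarrow> 'e) \<Rightarrow> ('v, 'e) pre_digraph \<Rightarrow> 'e set \<Rightarrow> bool" where
  "orientation arev \<Gamma> Ep \<longleftrightarrow> arcs \<Gamma> = Ep \<union> arev ` Ep \<and> Ep \<inter> arev ` Ep = {}"


section \<open>Graphs of groups\<close>

text \<open>\<open>Gv v\<close> and \<open>Ge e\<close> are the vertex and edge groups, \<open>\<alpha> e\<close> is the monomorphism
  \<open>\<alpha>\<^sub>e\<close>, and \<open>\<omega>\<^sub>e\<close> is \<open>\<alpha> (arev e)\<close>.  \<^const>\<open>Digraph_Component.connected\<close> requires the graph to have a vertex.\<close>

locale finite_graph_of_groups =
  bidirected_digraph \<Gamma> arev + fin_digraph \<Gamma>
  for \<Gamma> :: "('v, 'e) pre_digraph" and arev :: "'e \<Rightarrow> 'e" +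
  fixes Gv :: "'v \<Rightarrow> 'a monoid"
    and Ge :: "'e \<Rightarrow> 'b monoid"
    and \<alpha> :: "'e \<Rightarrow> 'b \<Rightarrow> 'a"
  assumes connected: "Digraph_Component.connected \<Gamma>"
    and group_Gv: "v \<in> verts \<Gamma> \<Longrightarrow> group (Gv v)"
    and group_Ge: "e \<in> arcs \<Gamma> \<Longrightarrow> group (Ge e)"
    and Ge_arev: "e \<in> arcs \<Gamma> \<Longrightarrow> Ge (arev e) = Ge e"
    and mon_\<alpha>: "e \<in> arcs \<Gamma> \<Longrightarrow> \<alpha> e \<in> mon (Ge e) (Gv (tail \<Gamma> e))"

datatype ('v, 'e, 'a) fg_gen = Elt 'v 'a | Stable 'e

abbreviation elt :: "'v \<Rightarrow> 'a \<Rightarrow> ('v, 'e, 'a) fg_gen word" where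
  "elt v a \<equiv> [(True, Elt v a)]"

abbreviation stable :: "'e \<Rightarrow> ('v, 'e, 'a) fg_gen word" where
  "stable e \<equiv> [(True, Stable e)]"

abbreviation stable_inv :: "'e \<Rightarrow> ('v, 'e, 'a) fg_gen word" where
  "stable_inv e \<equiv> [(False, Stable e)]"

definition fg_gens ::
  "('v, 'e) pre_digraph \<Rightarrow> ('v \<Rightarrow> 'a monoid) \<Rightarrow> 'e set \<Rightarrow> ('v, 'e, 'a) fg_gen set" where
  "fg_gens \<Gamma> Gv Ep = {Elt v a | v a. v \<in> verts \<Gamma> \<and> a \<in> carrier (Gv v)} \<union> Stable ` Ep"

definition fg_rels ::
  "('v, 'e) pre_digraph \<Rightarrow> ('e \<Rightarrow> 'e) \<Rightarrow> ('v \<Rightarrow> 'a monoid) \<Rightarrow> ('e \<Rightarrow> 'b monoid) \<Rightarrow>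
     ('e \<Rightarrow> 'b \<Rightarrow> 'a) \<Rightarrow> ('v, 'e) pre_digraph \<Rightarrow> 'e set \<Rightarrow>
     (('v, 'e, 'a) fg_gen word \<times> ('v, 'e, 'a) fg_gen word) set" where
  "fg_rels \<Gamma> arev Gv Ge \<alpha> T Ep =
     {(elt v a @ elt v b, elt v (a \<otimes>\<^bsub>Gv v\<^esub> b)) | v a b.
        v \<in> verts \<Gamma> \<and> a \<in> carrier (Gv v) \<and> b \<in> carrier (Gv v)} \<union>
     {(stable e @ elt (head \<Gamma> e) (\<alpha> (arev e) a) @ stable_inv e, elt (tail \<Gamma> e) (\<alpha> e a)) | e a.
        e \<in> Ep \<and> a \<in> carrier (Ge e)} \<union>
     {(stable f, []) | f. f \<in> arcs T \<inter> Ep}"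

definition fundamental_group ::
  "('v, 'e) pre_digraph \<Rightarrow> ('e \<Rightarrow> 'e) \<Rightarrow> ('v \<Rightarrow> 'a monoid) \<Rightarrow> ('e \<Rightarrow> 'b monoid) \<Rightarrow>
     ('e \<Rightarrow> 'b \<Rightarrow> 'a) \<Rightarrow> ('v, 'e) pre_digraph \<Rightarrow> 'e set \<Rightarrow>
     ('v, 'e, 'a) fg_gen word set monoid" where
  "fundamental_group \<Gamma> arev Gv Ge \<alpha> T Ep =
     presented_group (fg_gens \<Gamma> Gv Ep) (fg_rels \<Gamma> arev Gv Ge \<alpha> T Ep)"

end

theory Submission
  imports Defs "HOL-Combinatorics.Permutations" "HOL-Algebra.Product_Groups"
begin

text \<open>
  That (VRC) implies balancedness is a computation in a finite index subgroup: a retraction onto \<open>\<langle>g\<rangle>\<close> turns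
  \<open>x\<^sup>m g\<^bsup>k^m\<^esup> x\<^sup>-\<^sup>m = g\<^bsup>l^m\<^esup>\<close> into \<open>k^m = l^m\<close>.

  For the converse, let \<open>P\<close> be the abelian pushout of the vertex groups along the maximal tree. The vertex
  groups embed in \<open>P\<close>, and elements of two vertex groups are equal in \<open>P\<close> only if they are already equal
  in \<open>G\<close>. As the Euler characteristic is nonnegative, at most one edge \<open>t\<close> lies outside the tree; it
  conjugates some \<open>a \<in> P\<close> to some \<open>b \<in> P\<close>, and balancedness says that \<open>a^k = b^l\<close> forces \<open>\<bar>k\<bar> = \<bar>l\<bar>\<close>. Hence
  \<open>a\<close> and \<open>b\<close> have equal orders in sufficiently many finite quotients \<open>Q\<close> of \<open>P\<close>, and every element of infinite
  order of \<open>P\<close> survives under some \<open>f : P \<rightarrow> \<int>\<close> with \<open>f a = \<plusminus>f b\<close>. This settles the elements that are conjugate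
  into a vertex group. Any other element is conjugate to a cyclically reduced path word, and it is
  detected by letting \<open>G\<close> act on \<open>Q \<times> {..<n} \<times> \<int>\<close>, a finite union of copies of \<open>\<int>\<close>: \<open>P\<close> acts through \<open>Q\<close>, the
  edges act by completions of a partial matching of orbits along the path, and the path acts on one of
  the copies as a nontrivial translation. No normal form theorem for \<open>G\<close> is needed, as homomorphisms
  out of \<open>G\<close> come from its presentation.
\<close>

section \<open>Finite index and virtual retracts\<close>

text \<open>A finite quotient of the group cannot exhibit a virtual retract onto an infinite cyclic
  subgroup: one needs a finite index subgroup with a map to \<int> that does not vanish on the given
  element. Permutations of finitely many copies of \<int> supply both at once, the stabiliser of a
  copy being the subgroup and its translation length the map. The orders of a and b in Q matter
  because a bijection that intertwines their actions exists only if their orbits have equal length;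
  what then remains free is which orbit goes to which, and this is where the path is encoded. The
  obstacle is that all edges of the path, those of the maximal tree included, must realise
  prescribed permutations, whereas the presentation makes tree letters trivial. The way out is a
  potential \<gamma> on the vertices: the vertex group at v acts through the conjugate by
  \<open>\<gamma> v\<close> of the action of P. Tree letters then act trivially, and the action of a
  closed path changes by a conjugation only.\<close>

lemma (in group) rcos_eq_iff:
  assumes "subgroup K G" "x \<in> carrier G" "y \<in> carrier G"
  shows "K #> x = K #> y \<longleftrightarrow> x \<otimes> inv y \<in> K"
proof
  assume "K #> x = K #> y"
  then have "x \<in> K #> y" using rcos_self[OF assms(2,1)] by simp
  then obtain k where "k \<in> K" "x = k \<otimes> y" by (auto simp: r_coset_def)
  then show "x \<otimes> inv y \<in> K" using assms by (simp add: m_assoc subgroup.mem_carrier)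
next
  assume k: "x \<otimes> inv y \<in> K"
  have "x = (x \<otimes> inv y) \<otimes> y" using assms by (simp add: m_assoc)
  then have "x \<in> K #> y" using k by (auto simp: r_coset_def)
  then show "K #> x = K #> y" using repr_independence[OF _ assms(3,1)] by simp
qed

text \<open>The values of \<open>h\<close> label the cosets: a coset is recovered from the value of
  \<open>h\<close> at any of its elements, so finitely many values leave finitely many
  cosets.\<close>

lemma (in group) finite_indexI:
  assumes K: "subgroup K G" and fin: "finite (h ` carrier G)"
    and h: "\<And>x y. \<lbrakk>x \<in> carrier G; y \<in> carrier G; h x = h y\<rbrakk> \<Longrightarrow> x \<otimes> inv y \<in> K"
  shows "finite (rcosets K)"
proof -
  define s where "s z = (SOME x. x \<in> carrier G \<and> h x = z)" for z
  have s: "s (h x) \<in> carrier G \<and> h (s (h x)) = h x" if "x \<in> carrier G" for x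
    unfolding s_def by (rule someI[of _ x]) (use that in simp)
  have "rcosets K \<subseteq> (\<lambda>z. K #> s z) ` (h ` carrier G)"
  proof
    fix C assume "C \<in> rcosets K"
    then obtain x where x: "x \<in> carrier G" "C = K #> x" by (auto simp: RCOSETS_def)
    then have "C = K #> s (h x)"
      using rcos_eq_iff[OF K] h s[OF x(1)] by simp
    then show "C \<in> (\<lambda>z. K #> s z) ` (h ` carrier G)" using x by blast
  qed
  then show ?thesis using fin finite_surj by blast
qed

text \<open>Pigeonhole on the cosets of the powers of \<open>x\<close>.\<close>

lemma (in group) finite_index_power_mem:
  assumes K: "subgroup K G" and fin: "finite (rcosets K)" and x: "x \<in> carrier G"
  obtains m :: nat where "m > 0" "x [^] m \<in> K"
proof -
  have "finite (range (\<lambda>i::nat. K #> x [^] i))"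
    by (rule finite_subset[OF _ fin]) (use x in \<open>auto simp: RCOSETS_def\<close>)
  then have "\<not> inj (\<lambda>i::nat. K #> x [^] i)"
    using finite_imageD by blast
  then obtain i j :: nat where "i < j" "K #> x [^] j = K #> x [^] i"
    unfolding inj_def by (metis linorder_neqE_nat)
  then have "x [^] j \<otimes> inv (x [^] i) \<in> K" using rcos_eq_iff[OF K] x by simp
  moreover have "x [^] j = x [^] (j - i) \<otimes> x [^] i"
    using x \<open>i < j\<close> by (simp add: nat_pow_mult)
  ultimately have "x [^] (j - i) \<in> K" using x by (simp add: m_assoc)
  then show ?thesis using that[of "j - i"] \<open>i < j\<close> by simp
qed

lemma (in group) infinite_ord_iff:
  assumes "g \<in> carrier G"
  shows "ord g = 0 \<longleftrightarrow> (\<forall>k::int. g [^] k = \<one> \<longrightarrow> k = 0)"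
proof
  assume "ord g = 0" then show "\<forall>k::int. g [^] k = \<one> \<longrightarrow> k = 0"
    using int_pow_eq_id[OF assms] by simp
next
  assume *: "\<forall>k::int. g [^] k = \<one> \<longrightarrow> k = 0"
  have "g [^] int (ord g) = \<one>" using int_pow_eq_id[OF assms] by simp
  then show "ord g = 0" using * by fastforce
qed

lemma (in group) conj_int_pow:
  assumes "x \<in> carrier G" "g \<in> carrier G"
  shows "(x \<otimes> g \<otimes> inv x) [^] (k::int) = x \<otimes> g [^] k \<otimes> inv x"
proof -
  have "(\<lambda>g. x \<otimes> g \<otimes> inv x) \<in> hom G G"
    using assms by (auto intro!: homI simp: m_assoc inv_solve_left)
  then show ?thesis
    using hom_int_pow[OF _ assms(2) is_group is_group] by fastforce
qed

text \<open>The relation controls only powers of g^k, so iterating it needs divisibility of the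
  exponent: starting from k^m, each conjugation by x trades one factor k for a factor l.\<close>

lemma (in group) conj_power_iterate:
  fixes k l :: int and m :: nat
  assumes x: "x \<in> carrier G" and g: "g \<in> carrier G" and eq: "x \<otimes> g [^] k \<otimes> inv x = g [^] l"
  shows "x [^] m \<otimes> g [^] (k ^ m) \<otimes> inv (x [^] m) = g [^] (l ^ m)"
proof (induction m)
  case 0
  then show ?case using g by simp
next
  case (Suc m)
  have "x [^] Suc m \<otimes> g [^] (k ^ Suc m) \<otimes> inv (x [^] Suc m)
      = x [^] m \<otimes> (x \<otimes> (g [^] k) [^] (k ^ m) \<otimes> inv x) \<otimes> inv (x [^] m)"
    using x g by (simp add: m_assoc inv_mult_group int_pow_pow)
  also have "\<dots> = x [^] m \<otimes> (g [^] l) [^] (k ^ m) \<otimes> inv (x [^] m)"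
    using conj_int_pow[of x "g [^] k" "k ^ m"] x g eq by simp
  also have "\<dots> = x [^] m \<otimes> (g [^] (k ^ m)) [^] l \<otimes> inv (x [^] m)"
    using g by (simp add: int_pow_pow mult.commute)
  also have "\<dots> = (g [^] (l ^ m)) [^] l"
    using conj_int_pow[of "x [^] m" "g [^] (k ^ m)" l] x g Suc by simp
  finally show ?case using g by (simp add: int_pow_pow mult.commute)
qed

lemma (in group) cyclic_subgroup_generate:
  assumes "g \<in> carrier G"
  shows "subgroup (generate G {g}) G" "cyclic_group (G\<lparr>carrier := generate G {g}\<rparr>)"
proof -
  show sg: "subgroup (generate G {g}) G" using generate_is_subgroup assms by simp
  interpret H: group "G\<lparr>carrier := generate G {g}\<rparr>" using subgroup.subgroup_is_group[OF sg is_group] .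
  show "cyclic_group (G\<lparr>carrier := generate G {g}\<rparr>)"
    unfolding H.cyclic_group
  proof
    show gc: "g \<in> carrier (G\<lparr>carrier := generate G {g}\<rparr>)" by (simp add: generate.incl)
    have "g [^]\<^bsub>G\<lparr>carrier := generate G {g}\<rparr>\<^esub> n = g [^] n" for n :: int
      by (rule int_pow_consistent[OF sg, symmetric]) (use gc in simp)
    then show "carrier (G\<lparr>carrier := generate G {g}\<rparr>) = range (\<lambda>n::int. g [^]\<^bsub>G\<lparr>carrier := generate G {g}\<rparr>\<^esub> n)"
      unfolding partial_object.simps partial_object.update_convs using generate_pow[OF assms] by (simp add: full_SetCompr_eq)
  qed
qed

lemma (in group) cyclic_subgroup_eq_generate:
  assumes H: "subgroup H G" and cyc: "cyclic_group (G\<lparr>carrier := H\<rparr>)"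
  obtains g where "g \<in> H" "H = generate G {g}"
proof -
  interpret H: group "G\<lparr>carrier := H\<rparr>" using subgroup.subgroup_is_group[OF H is_group] .
  obtain g where g: "g \<in> H" "H = range (\<lambda>n::int. g [^]\<^bsub>G\<lparr>carrier := H\<rparr>\<^esub> n)"
    using cyc unfolding H.cyclic_group by auto
  have "H = generate G {g}"
    using g(2) generate_pow[of g] int_pow_consistent[OF H g(1)] g(1) subgroup.mem_carrier[OF H] by auto
  then show ?thesis using that g(1) by blast
qed

proposition (in group) VRC_imp_balanced:
  assumes "VRC G" shows "balanced G"
  unfolding balanced_def
proof (intro ballI impI allI)
  fix g and k l :: int
  assume g: "g \<in> carrier G" and ord: "ord g = 0"
    and "k \<noteq> 0 \<and> l \<noteq> 0 \<and> (\<exists>x\<in>carrier G. x \<otimes> g [^] k \<otimes> inv x = g [^] l)"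
  then obtain x where x: "x \<in> carrier G" and eq: "x \<otimes> g [^] k \<otimes> inv x = g [^] l" by blast
  let ?H = "generate G {g}"
  have sH: "subgroup ?H G" and gH: "g \<in> ?H" using cyclic_subgroup_generate(1)[OF g] by (auto intro: generate.incl)
  then have "virtual_retract ?H G"
    using assms cyclic_subgroup_generate[OF g] unfolding VRC_def by blast
  then obtain K \<rho> where K: "subgroup K G" "finite (rcosets K)" "?H \<subseteq> K"
    and \<rho>: "\<rho> \<in> hom (G\<lparr>carrier := K\<rparr>) (G\<lparr>carrier := ?H\<rparr>)" "\<forall>h\<in>?H. \<rho> h = h"
    unfolding virtual_retract_def by blast
  \<comment> \<open>The conjugator may lie outside the domain of the retraction, but some positive
    power of it lies inside.\<close>
  obtain m :: nat where m: "m > 0" "x [^] m \<in> K"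
    using finite_index_power_mem[OF K(1,2) x] .
  let ?y = "x [^] m"
  have pH: "g [^] i \<in> ?H" for i :: int using generate_pow[OF g] by blast
  have y: "?y \<otimes> g [^] (k ^ m) \<otimes> inv ?y = g [^] (l ^ m)"
    by (rule conj_power_iterate[OF x g eq])
  then have "?y \<otimes> g [^] (k ^ m) = g [^] (l ^ m) \<otimes> ?y"
    using x g by (simp add: inv_solve_right')
  moreover have "\<rho> (a \<otimes> b) = \<rho> a \<otimes> \<rho> b" if "a \<in> K" "b \<in> K" for a b
    using \<rho>(1) that by (auto simp: hom_def)
  moreover have "g [^] i \<in> K" for i :: int using pH K(3) by blast
  \<comment> \<open>Under \<rho> the conjugator becomes a power of g and commutes with g, so the
    exponents k^m and l^m must agree.\<close>
  ultimately have "\<rho> ?y \<otimes> g [^] (k ^ m) = g [^] (l ^ m) \<otimes> \<rho> ?y"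
    using m \<rho>(2) pH by metis
  moreover obtain j :: int where "\<rho> ?y = g [^] j"
    using \<rho>(1) m(2) unfolding generate_pow[OF g] by (auto simp: hom_def Pi_iff)
  ultimately have "g [^] (j + k ^ m) = g [^] (l ^ m + j)" using g by (simp add: int_pow_mult)
  then have "k ^ m = l ^ m" using int_pow_eq[OF g] ord by simp
  then have "\<bar>k\<bar> = \<bar>l\<bar>" using m(1)
    by (metis abs_ge_zero power_abs power_eq_imp_eq_base)
  then show "l = k \<or> l = - k" by linarith
qed

text \<open>The retraction is the composition of \<open>f\<close> with the inverse of its restriction to \<open>\<langle>g\<rangle>\<close>, defined on
  the preimage of \<open>\<langle>f g\<rangle>\<close>.\<close>

lemma (in group) virtual_retract_cyclicI:
  assumes K: "subgroup K G" "finite (rcosets K)" and gK: "g \<in> K"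
    and A: "group A" and f: "f \<in> hom (G\<lparr>carrier := K\<rparr>) A"
    and inj: "\<And>k::int. f g [^]\<^bsub>A\<^esub> k = \<one>\<^bsub>A\<^esub> \<Longrightarrow> g [^] k = \<one>"
    and fin: "finite (rcosets\<^bsub>A\<^esub> (generate A {f g}))"
  shows "virtual_retract (generate G {g}) G"
proof -
  interpret A: group A by fact
  have Kc: "x \<in> carrier G" if "x \<in> K" for x using K(1) that by (rule subgroup.mem_carrier)
  have g: "g \<in> carrier G" using Kc gK .
  interpret KG: group "G\<lparr>carrier := K\<rparr>" using subgroup.subgroup_is_group[OF K(1) is_group] .
  interpret f: group_hom "G\<lparr>carrier := K\<rparr>" A f
    using f by unfold_locales
  have fK: "f x \<in> carrier A" if "x \<in> K" for x using f.hom_closed that by simp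
  have fm: "f (x \<otimes> y) = f x \<otimes>\<^bsub>A\<^esub> f y" if "x \<in> K" "y \<in> K" for x y using f.hom_mult that by simp
  have finv: "f (inv x) = inv\<^bsub>A\<^esub> f x" if "x \<in> K" for x
    using f.hom_inv[of x] that m_inv_consistent[OF K(1) that] by simp
  have fpow: "f (g [^] k) = f g [^]\<^bsub>A\<^esub> k" for k :: int
    using f.hom_int_pow[of g k] gK int_pow_consistent[OF K(1) gK] by simp
  let ?H = "generate G {g}"
  let ?B = "generate A {f g}"
  have B: "subgroup ?B A" using A.generate_is_subgroup fK[OF gK] by simp
  have Bpow: "\<exists>k::int. b = f g [^]\<^bsub>A\<^esub> k" if "b \<in> ?B" for b
    using that A.generate_pow[OF fK[OF gK]] by auto
  define K' where "K' = {x \<in> K. f x \<in> ?B}"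
  have K': "subgroup K' G"
    by (rule subgroupI)
      (use K(1) B gK Kc in \<open>auto simp: K'_def finv fm subgroup.m_closed subgroup.m_inv_closed generate.incl\<close>)
  have HK': "?H \<subseteq> K'"
  proof -
    have "g \<in> K'" using gK by (simp add: K'_def generate.incl)
    then show ?thesis using generate_subgroup_incl[OF _ K'] by blast
  qed
  \<comment> \<open>\<open>r\<close> depends only on the coset, so x = (x r(x)^-1) r(x) splits off a
    part in \<open>K\<close>. Comparing the images of these parts in A modulo \<open>?B\<close>
    bounds the index of \<open>K'\<close> by the product of the two given indices.\<close>
  define r where "r x = (SOME y. y \<in> carrier G \<and> K #> y = K #> x)" for x
  have r: "r x \<in> carrier G \<and> K #> r x = K #> x" if "x \<in> carrier G" for x
    unfolding r_def by (rule someI[of _ x]) (use that in simp)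
  have req: "r x = r y" if "K #> x = K #> y" for x y unfolding r_def that ..
  have xr: "x \<otimes> inv (r x) \<in> K" if "x \<in> carrier G" for x
    using rcos_eq_iff[OF K(1) that, of "r x"] r[OF that] by simp
  have "finite (rcosets K')"
  proof (rule finite_indexI[OF K', where h = "\<lambda>x. (K #> x, ?B #>\<^bsub>A\<^esub> f (x \<otimes> inv (r x)))"])
    have "(\<lambda>x. (K #> x, ?B #>\<^bsub>A\<^esub> f (x \<otimes> inv (r x)))) ` carrier G \<subseteq> (rcosets K) \<times> (rcosets\<^bsub>A\<^esub> ?B)"
      using fK[OF xr] by (auto simp: RCOSETS_def)
    then show "finite ((\<lambda>x. (K #> x, ?B #>\<^bsub>A\<^esub> f (x \<otimes> inv (r x)))) ` carrier G)"
      using K(2) fin finite_subset by blast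
  next
    fix x y assume x: "x \<in> carrier G" and y: "y \<in> carrier G"
      and e: "(K #> x, ?B #>\<^bsub>A\<^esub> f (x \<otimes> inv (r x))) = (K #> y, ?B #>\<^bsub>A\<^esub> f (y \<otimes> inv (r y)))"
    have rr: "r x = r y" using e req by blast
    have xy: "x \<otimes> inv y \<in> K" using e rcos_eq_iff[OF K(1) x y] by simp
    have "f (x \<otimes> inv (r x)) \<otimes>\<^bsub>A\<^esub> inv\<^bsub>A\<^esub> f (y \<otimes> inv (r y)) \<in> ?B"
      using e A.rcos_eq_iff[OF B] fK[OF xr] x y by simp
    moreover have "f (x \<otimes> inv (r x)) \<otimes>\<^bsub>A\<^esub> inv\<^bsub>A\<^esub> f (y \<otimes> inv (r y))
        = f ((x \<otimes> inv (r x)) \<otimes> inv (y \<otimes> inv (r y)))"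
      using xr[OF x] xr[OF y] K(1) by (simp add: fm finv subgroup.m_inv_closed)
    moreover have "(x \<otimes> inv (r x)) \<otimes> inv (y \<otimes> inv (r y)) = x \<otimes> inv y"
    proof -
      have "inv (r y) \<otimes> (r y \<otimes> inv y) = inv y" using y r[OF y] by (simp flip: m_assoc)
      then show ?thesis using x y r[OF y] rr by (simp add: inv_mult_group m_assoc)
    qed
    ultimately show "x \<otimes> inv y \<in> K'" using xy by (simp add: K'_def)
  qed
  \<comment> \<open>The exponent is unique only up to the order of g; as f is injective on
    \<open>?H\<close>, the resulting power of g does not depend on the choice.\<close>
  define \<rho> where "\<rho> x = g [^] (SOME k::int. f x = f g [^]\<^bsub>A\<^esub> k)" for x
  have key: "\<rho> x = g [^] k" if "f x = f g [^]\<^bsub>A\<^esub> k" for x and k :: int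
  proof -
    define j :: int where "j = (SOME k. f x = f g [^]\<^bsub>A\<^esub> k)"
    have "f x = f g [^]\<^bsub>A\<^esub> j" unfolding j_def by (rule someI[of _ k]) fact
    then have "f g [^]\<^bsub>A\<^esub> (j - k) = \<one>\<^bsub>A\<^esub>" using that fK[OF gK] by (simp add: A.int_pow_diff)
    then have "g [^] (j - k) = \<one>" by (rule inj)
    then have "g [^] j = g [^] k" using g by (simp add: int_pow_diff inv_solve_right')
    then show ?thesis by (simp add: \<rho>_def j_def)
  qed
  have "\<rho> \<in> hom (G\<lparr>carrier := K'\<rparr>) (G\<lparr>carrier := ?H\<rparr>)"
  proof (rule homI)
    fix x assume "x \<in> carrier (G\<lparr>carrier := K'\<rparr>)"
    then show "\<rho> x \<in> carrier (G\<lparr>carrier := ?H\<rparr>)"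
      using generate_pow[OF g] by (auto simp: \<rho>_def)
  next
    fix x y assume "x \<in> carrier (G\<lparr>carrier := K'\<rparr>)" "y \<in> carrier (G\<lparr>carrier := K'\<rparr>)"
    then have xy: "x \<in> K" "y \<in> K" "f x \<in> ?B" "f y \<in> ?B" by (auto simp: K'_def)
    then obtain i j :: int where ij: "f x = f g [^]\<^bsub>A\<^esub> i" "f y = f g [^]\<^bsub>A\<^esub> j" using Bpow by meson
    then have "f (x \<otimes> y) = f g [^]\<^bsub>A\<^esub> (i + j)" using xy fK[OF gK] by (simp add: fm A.int_pow_mult)
    then show "\<rho> (x \<otimes>\<^bsub>G\<lparr>carrier := K'\<rparr>\<^esub> y) = \<rho> x \<otimes>\<^bsub>G\<lparr>carrier := ?H\<rparr>\<^esub> \<rho> y"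
      using key ij g by (simp add: int_pow_mult)
  qed
  moreover have "\<forall>h\<in>?H. \<rho> h = h"
    using generate_pow[OF g] key fpow by force
  ultimately show ?thesis
    unfolding virtual_retract_def
    using cyclic_subgroup_generate(1)[OF g] K' HK' \<open>finite (rcosets K')\<close> by blast
qed

text \<open>Lets an element be replaced by a better conjugate. Conjugation by inv x followed by the
  given retraction maps x K x^-1 onto \<open>?H\<close>, and the criterion above applies with
  \<open>?H\<close> as target.\<close>

lemma (in group) virtual_retract_conj:
  assumes vr: "virtual_retract (generate G {g}) G" and g: "g \<in> carrier G" and x: "x \<in> carrier G"
  shows "virtual_retract (generate G {x \<otimes> g \<otimes> inv x}) G"
proof -
  let ?H = "generate G {g}"
  let ?A = "G\<lparr>carrier := ?H\<rparr>"
  obtain K \<rho> where K: "subgroup K G" "finite (rcosets K)" "?H \<subseteq> K"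
    and \<rho>: "\<rho> \<in> hom (G\<lparr>carrier := K\<rparr>) ?A" "\<forall>h\<in>?H. \<rho> h = h"
    using vr unfolding virtual_retract_def by blast
  have sH: "subgroup ?H G" by (rule cyclic_subgroup_generate(1)[OF g])
  have gH: "g \<in> ?H" by (simp add: generate.incl)
  interpret A: group ?A by (rule subgroup.subgroup_is_group[OF sH is_group])
  define c where "c y = inv x \<otimes> y \<otimes> x" for y
  have c: "c y \<in> carrier G" if "y \<in> carrier G" for y using that x by (simp add: c_def)
  have cancel: "x \<otimes> (inv x \<otimes> z) = z" "inv x \<otimes> (x \<otimes> z) = z" if "z \<in> carrier G" for z
    using that x by (simp_all flip: m_assoc)
  have cm: "c (y \<otimes> z) = c y \<otimes> c z" if "y \<in> carrier G" "z \<in> carrier G" for y z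
    using that x by (simp add: c_def m_assoc cancel)
  have ci: "c (inv y) = inv (c y)" if "y \<in> carrier G" for y
    using that x by (simp add: c_def inv_mult_group m_assoc)
  define K' where "K' = {y \<in> carrier G. c y \<in> K}"
  have K': "subgroup K' G"
  proof (rule subgroupI)
    show "K' \<noteq> {}" using subgroup.one_closed[OF K(1)] x by (auto simp: K'_def c_def intro!: exI[of _ \<one>])
  qed (use K(1) in \<open>auto simp: K'_def cm ci subgroup.m_closed subgroup.m_inv_closed\<close>)
  have cg: "c (x \<otimes> g \<otimes> inv x) = g" using x g by (simp add: c_def m_assoc cancel)
  show ?thesis
  proof (rule virtual_retract_cyclicI[OF K', where A = ?A and f = "\<lambda>y. \<rho> (c y)"])
    show "finite (rcosets K')"
    \<comment> \<open>Left multiplication by inv x carries right cosets of x K x^-1 to right cosets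
      of K.\<close>
    proof (rule finite_indexI[OF K', where h = "\<lambda>y. K #> (inv x \<otimes> y)"])
      show "finite ((\<lambda>y. K #> (inv x \<otimes> y)) ` carrier G)"
        by (rule finite_subset[OF _ K(2)]) (use x in \<open>auto simp: RCOSETS_def intro!: bexI[of _ "inv x \<otimes> _"]\<close>)
    next
      fix y z assume y: "y \<in> carrier G" and z: "z \<in> carrier G"
        and "K #> (inv x \<otimes> y) = K #> (inv x \<otimes> z)"
      then have "(inv x \<otimes> y) \<otimes> inv (inv x \<otimes> z) \<in> K"
        using rcos_eq_iff[OF K(1)] x by simp
      then show "y \<otimes> inv z \<in> K'"
        using x y z by (simp add: K'_def c_def inv_mult_group m_assoc)
    qed
  next
    show "x \<otimes> g \<otimes> inv x \<in> K'" using cg gH K(3) x g by (auto simp: K'_def)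
  next
    show "group ?A" by (rule A.is_group)
  next
    show "(\<lambda>y. \<rho> (c y)) \<in> hom (G\<lparr>carrier := K'\<rparr>) ?A"
      using \<rho>(1) by (auto simp: hom_def K'_def cm Pi_iff)
  next
    fix k :: int assume "\<rho> (c (x \<otimes> g \<otimes> inv x)) [^]\<^bsub>?A\<^esub> k = \<one>\<^bsub>?A\<^esub>"
    then have "g [^] k = \<one>" using \<rho>(2) gH cg int_pow_consistent[OF sH gH, of k] by simp
    then show "(x \<otimes> g \<otimes> inv x) [^] k = \<one>" using x g by (simp add: conj_int_pow)
  next
    \<comment> \<open>The image of the generator generates all of \<open>?A\<close>, so the index to
      be bounded is one.\<close>
    have "generate ?A {g} = ?H" using generate_consistent[OF _ sH, of "{g}"] gH by simp
    then have "\<rho> (c (x \<otimes> g \<otimes> inv x)) = g" "subgroup (generate ?A {g}) ?A" "generate ?A {g} = carrier ?A"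
      using \<rho>(2) gH cg A.generate_is_subgroup[of "{g}"] by auto
    then show "finite (rcosets\<^bsub>?A\<^esub> (generate ?A {\<rho> (c (x \<otimes> g \<otimes> inv x))}))"
      using A.finite_indexI[of "carrier ?A" "\<lambda>_. ()"] A.subgroup_self
      by (metis (no_types, lifting) A.inv_closed A.m_closed finite.emptyI finite.insertI finite_imageI finite_subset image_subsetI insertI1)
  qed
qed

section \<open>Finitely generated abelian groups\<close>

text \<open>In an abelian group, the subgroup generated by a subgroup M and an element x.\<close>

definition adjoin :: "('a, 'm) monoid_scheme \<Rightarrow> 'a set \<Rightarrow> 'a \<Rightarrow> 'a set" where
  "adjoin G M x = {m \<otimes>\<^bsub>G\<^esub> x [^]\<^bsub>G\<^esub> k | m k::int. m \<in> M}"

lemma (in comm_group) subgroup_adjoin: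
  assumes M: "subgroup M G" and x: "x \<in> carrier G"
  shows "subgroup (adjoin G M x) G" "M \<subseteq> adjoin G M x" "x \<in> adjoin G M x"
proof -
  have Mc: "m \<in> carrier G" if "m \<in> M" for m using M that by (rule subgroup.mem_carrier)
  have mem: "m \<otimes> x [^] (k::int) \<in> adjoin G M x" if "m \<in> M" for m k
    using that by (auto simp: adjoin_def)
  show sub: "M \<subseteq> adjoin G M x"
    using mem[of _ 0] Mc by fastforce
  show "x \<in> adjoin G M x" using mem[of \<one> 1] subgroup.one_closed[OF M] x by simp
  show "subgroup (adjoin G M x) G"
  proof (rule subgroupI)
    show "adjoin G M x \<subseteq> carrier G" using Mc x by (auto simp: adjoin_def)
    show "adjoin G M x \<noteq> {}" using sub subgroup.one_closed[OF M] by blast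
  next
    fix y assume "y \<in> adjoin G M x"
    then obtain m and k :: int where m: "m \<in> M" "y = m \<otimes> x [^] k" by (auto simp: adjoin_def)
    then have "inv y = inv m \<otimes> x [^] (- k)"
      using x Mc by (simp add: inv_mult int_pow_neg)
    then show "inv y \<in> adjoin G M x" using mem m(1) subgroup.m_inv_closed[OF M] by simp
  next
    fix y z assume "y \<in> adjoin G M x" "z \<in> adjoin G M x"
    then obtain m n and k l :: int where m: "m \<in> M" "y = m \<otimes> x [^] k" "n \<in> M" "z = n \<otimes> x [^] l"
      unfolding adjoin_def by blast
    then have "y \<otimes> z = (m \<otimes> n) \<otimes> x [^] (k + l)"
      using x Mc by (simp add: int_pow_mult m_ac)
    then show "y \<otimes> z \<in> adjoin G M x" using mem m subgroup.m_closed[OF M] by simp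
  qed
qed

text \<open>Zorn's lemma takes the place of the structure theorem for finitely generated abelian
  groups. By maximality, adjoining any new element hits B; the choices B = {s} and B = powers of g
  with nonzero exponent yield separability and integer characters.\<close>

lemma (in comm_group) maximal_subgroup_avoiding:
  assumes H: "subgroup H G" and HB: "H \<inter> B = {}"
  obtains M where "subgroup M G" "H \<subseteq> M" "M \<inter> B = {}"
    "\<And>x. \<lbrakk>x \<in> carrier G; x \<notin> M\<rbrakk> \<Longrightarrow> \<exists>m\<in>M. \<exists>k::int. m \<otimes> x [^] k \<in> B"
proof -
  let ?A = "{M. subgroup M G \<and> H \<subseteq> M \<and> M \<inter> B = {}}"
  have "\<exists>M\<in>?A. \<forall>X\<in>?A. M \<subseteq> X \<longrightarrow> X = M"
  proof (rule subset_Zorn_nonempty)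
    show "?A \<noteq> {}" using H HB by blast
  next
    fix \<C> assume ne: "\<C> \<noteq> {}" and ch: "subset.chain ?A \<C>"
    then have sub: "subgroup M G" "H \<subseteq> M" "M \<inter> B = {}" if "M \<in> \<C>" for M
      using that by (auto simp: subset.chain_def)
    have "subgroup (\<Union>\<C>) G"
    proof (rule subgroupI)
      show "\<Union>\<C> \<subseteq> carrier G" using sub(1) subgroup.subset by blast
      show "\<Union>\<C> \<noteq> {}" using ne sub(1) subgroup.one_closed by blast
    next
      fix a assume "a \<in> \<Union>\<C>"
      then obtain M where "M \<in> \<C>" "a \<in> M" by blast
      then show "inv a \<in> \<Union>\<C>" using subgroup.m_inv_closed[OF sub(1)] by blast
    next
      fix a b assume "a \<in> \<Union>\<C>" "b \<in> \<Union>\<C>"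
      then obtain M M' where "M \<in> \<C>" "a \<in> M" "M' \<in> \<C>" "b \<in> M'" by blast
      moreover from this have "M \<subseteq> M' \<or> M' \<subseteq> M" using ch by (simp add: subset_chain_def)
      ultimately obtain M where "M \<in> \<C>" "a \<in> M" "b \<in> M" by blast
      then show "a \<otimes> b \<in> \<Union>\<C>" using subgroup.m_closed[OF sub(1)] by blast
    qed
    then show "\<Union>\<C> \<in> ?A" using sub ne by blast
  qed
  then obtain M where "M \<in> ?A" and "\<forall>X\<in>?A. M \<subseteq> X \<longrightarrow> X = M" by (elim bexE)
  then have M: "subgroup M G" "H \<subseteq> M" "M \<inter> B = {}"
    and max: "\<And>X. \<lbrakk>subgroup X G; H \<subseteq> X; X \<inter> B = {}; M \<subseteq> X\<rbrakk> \<Longrightarrow> X = M" by simp_all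
  have "\<exists>m\<in>M. \<exists>k::int. m \<otimes> x [^] k \<in> B" if x: "x \<in> carrier G" "x \<notin> M" for x
  proof (rule ccontr)
    assume "\<not> ?thesis"
    then have "adjoin G M x \<inter> B = {}" by (auto simp: adjoin_def)
    then show False using max subgroup_adjoin[OF M(1) x(1)] M(2) x(2) by blast
  qed
  then show ?thesis using that M by blast
qed

lemma (in group) int_pow_abs_mem:
  assumes "subgroup L G" "x \<in> carrier G" "x [^] (k::int) \<in> L"
  shows "x [^] nat \<bar>k\<bar> \<in> L"
proof (cases "k \<ge> 0")
  case True
  then have "x [^] nat \<bar>k\<bar> = x [^] k" using assms by (simp flip: int_pow_int)
  then show ?thesis using assms by simp
next
  case False
  then have "x [^] nat \<bar>k\<bar> = inv (x [^] k)" using assms by (simp add: int_pow_neg flip: int_pow_int)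
  then show ?thesis using assms subgroup.m_inv_closed by metis
qed

text \<open>Elements whose N-th power lies in L form a subgroup, so N may be any common multiple of
  suitable exponents of finitely many generators.\<close>

lemma (in comm_group) uniform_power_mem:
  assumes fg: "finitely_generated G" and L: "subgroup L G"
    and pow: "\<And>x. x \<in> carrier G \<Longrightarrow> \<exists>n::nat. n > 0 \<and> x [^] n \<in> L"
  obtains N :: nat where "N > 0" "\<And>x. x \<in> carrier G \<Longrightarrow> x [^] N \<in> L"
proof -
  obtain S where S: "finite S" "S \<subseteq> carrier G" "generate G S = carrier G"
    using fg unfolding finitely_generated_def by blast
  define n :: "'a \<Rightarrow> nat" where "n x = (SOME n. n > 0 \<and> x [^] n \<in> L)" for x
  have n: "n x > 0 \<and> x [^] n x \<in> L" if "x \<in> carrier G" for x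
    unfolding n_def using pow[OF that] by (rule someI_ex)
  define N where "N = prod n S"
  have N: "N > 0" unfolding N_def using n S(2) by (auto intro!: prod_pos)
  let ?T = "{x \<in> carrier G. x [^] N \<in> L}"
  have "subgroup ?T G"
  proof (rule subgroupI)
    show "?T \<noteq> {}" using subgroup.one_closed[OF L] by (auto intro!: exI[of _ \<one>])
  qed (use L in \<open>auto simp: subgroup.m_inv_closed subgroup.m_closed pow_mult_distrib m_comm nat_pow_inv\<close>)
  moreover have "S \<subseteq> ?T"
  proof
    fix s assume s: "s \<in> S"
    then have "N = n s * prod n (S - {s})" unfolding N_def using S(1) by (simp add: prod.remove)
    then have "s [^] N = (s [^] n s) [^] prod n (S - {s})" using s S(2) by (simp add: nat_pow_pow subset_iff)
    moreover have "(s [^] n s) [^] int (prod n (S - {s})) \<in> L"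
      using n s S(2) by (intro subgroup_int_pow_closed[OF L]) blast
    ultimately show "s \<in> ?T" using s S(2) int_pow_int[of G "s [^] n s" "prod n (S - {s})"]
      by (simp add: subset_iff del: int_prod of_nat_prod)
  qed
  ultimately have "carrier G \<subseteq> ?T" using generate_subgroup_incl S(3) by blast
  then show ?thesis using that N by blast
qed

text \<open>Modulo M every element is a product of powers of the generators with exponents in
  {0..<N}; the finite set F of such products is built one generator at a time.\<close>

lemma (in comm_group) finite_index_of_uniform_power:
  assumes fg: "finitely_generated G" and M: "subgroup M G"
    and N: "N > 0" "\<And>x. x \<in> carrier G \<Longrightarrow> x [^] (N::nat) \<in> M"
  shows "finite (rcosets M)"
proof -
  obtain S where S: "finite S" "S \<subseteq> carrier G" "generate G S = carrier G"
    using fg unfolding finitely_generated_def by blast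
  have "\<exists>F. finite F \<and> F \<subseteq> carrier G \<and> (\<forall>x\<in>generate G S. \<exists>f\<in>F. x \<otimes> inv f \<in> M)"
    using S(1,2)
  proof (induction S)
    case empty
    show ?case using subgroup.one_closed[OF M] by (intro exI[of _ "{\<one>}"]) (simp add: generate_empty)
  next
    case (insert s S)
    then obtain F where F: "finite F" "F \<subseteq> carrier G" "\<forall>x\<in>generate G S. \<exists>f\<in>F. x \<otimes> inv f \<in> M"
      by auto
    have s: "s \<in> carrier G" and gS: "subgroup (generate G S) G"
      using insert.prems generate_is_subgroup by auto
    have "insert s S \<subseteq> adjoin G (generate G S) s"
      using subgroup_adjoin(2,3)[OF gS s] by (auto intro: generate.incl)
    then have gen: "generate G (insert s S) \<subseteq> adjoin G (generate G S) s"
      using generate_subgroup_incl subgroup_adjoin(1)[OF gS s] by blast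
    let ?F = "(\<lambda>(f, k). f \<otimes> s [^] k) ` (F \<times> {0..<int N})"
    have "\<exists>f\<in>?F. x \<otimes> inv f \<in> M" if xg: "x \<in> generate G (insert s S)" for x
    proof -
      obtain y and k :: int where y: "y \<in> generate G S" "x = y \<otimes> s [^] k"
        using subsetD[OF gen xg] by (auto simp: adjoin_def)
      obtain f where f: "f \<in> F" "y \<otimes> inv f \<in> M" using F(3) y(1) by blast
      have c: "y \<in> carrier G" "f \<in> carrier G" using y(1) f(1) F(2) gS subgroup.mem_carrier by auto
      have "s [^] (k - k mod int N) = (s [^] N) [^] (k div int N)"
        using s by (simp add: minus_mod_eq_mult_div int_pow_pow flip: int_pow_int)
      then have "s [^] (k - k mod int N) \<in> M"
        using N(2)[OF s] subgroup_int_pow_closed[OF M] by simp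
      moreover have "x \<otimes> inv (f \<otimes> s [^] (k mod int N)) = (y \<otimes> inv f) \<otimes> s [^] (k - k mod int N)"
        using c s y(2) by (simp add: inv_mult int_pow_diff m_ac)
      ultimately have "x \<otimes> inv (f \<otimes> s [^] (k mod int N)) \<in> M"
        using f(2) subgroup.m_closed[OF M] by simp
      then show ?thesis using f(1) N(1) by (auto intro!: bexI[of _ f] bexI[of _ "k mod int N"])
    qed
    moreover have "finite ?F" "?F \<subseteq> carrier G" using F s by auto
    ultimately show ?case by blast
  qed
  then obtain F where F: "finite F" "F \<subseteq> carrier G" "\<forall>x\<in>carrier G. \<exists>f\<in>F. x \<otimes> inv f \<in> M"
    unfolding S(3) by auto
  define h where "h x = (SOME f. f \<in> F \<and> x \<otimes> inv f \<in> M)" for x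
  have h: "h x \<in> F \<and> x \<otimes> inv (h x) \<in> M" if "x \<in> carrier G" for x
    unfolding h_def using F(3) that by (metis (mono_tags, lifting) someI_ex)
  show ?thesis
  proof (rule finite_indexI[OF M, where h = h])
    show "finite (h ` carrier G)" by (rule finite_subset[OF _ F(1)]) (use h in blast)
  next
    fix x y assume xy: "x \<in> carrier G" "y \<in> carrier G" "h x = h y"
    then have "x \<otimes> inv (h x) \<in> M" "y \<otimes> inv (h x) \<in> M" "h x \<in> carrier G" using h[OF xy(1)] h[OF xy(2)] xy(3) F(2) by auto
    then show "x \<otimes> inv y \<in> M" using rcos_eq_iff[OF M, of x "h x"] rcos_eq_iff[OF M, of y "h x"]
      rcos_eq_iff[OF M, of x y] xy by simp
  qed
qed

text \<open>A subgroup M maximal among those containing H and missing s has finite index as soon as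
  every x has a positive power in it. Otherwise s lies both in <M, x> and in <M, x^n>, and since no
  nontrivial power of x is in M, the two exponents of x agree.\<close>

lemma (in comm_group) subgroup_separable:
  assumes fg: "finitely_generated G" and H: "subgroup H G" and s: "s \<in> carrier G" "s \<notin> H"
  obtains M where "subgroup M G" "finite (rcosets M)" "H \<subseteq> M" "s \<notin> M"
proof -
  have "H \<inter> {s} = {}" using s by blast
  then obtain M where M: "subgroup M G" "H \<subseteq> M" "M \<inter> {s} = {}"
    and max: "\<And>x. \<lbrakk>x \<in> carrier G; x \<notin> M\<rbrakk> \<Longrightarrow> \<exists>m\<in>M. \<exists>k::int. m \<otimes> x [^] k \<in> {s}"
    using maximal_subgroup_avoiding[OF H] by metis
  have Mc: "m \<in> carrier G" if "m \<in> M" for m using M(1) that by (rule subgroup.mem_carrier)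
  have sM: "s \<notin> M" using M(3) by blast
  have "\<exists>n::nat. n > 0 \<and> x [^] n \<in> M" if x: "x \<in> carrier G" for x
  proof (rule ccontr)
    assume no: "\<not> ?thesis"
    then have "x \<notin> M" using x by (metis less_numeral_extra(1) nat_pow_eone)
    then obtain m k where m: "m \<in> M" "m \<otimes> x [^] (k::int) = s" using max x by blast
    have k: "k \<noteq> 0" using m sM Mc by auto
    \<comment> \<open>With this n the comparison of exponents k = n * l has no solution, as k is
      nonzero.\<close>
    define n where "n = 2 * nat \<bar>k\<bar>"
    have "n > 0" using k by (simp add: n_def)
    then have "x [^] n \<notin> M" using no by blast
    then obtain m' l where m': "m' \<in> M" "m' \<otimes> (x [^] n) [^] (l::int) = s" using max x by blast
    have e: "k - int n * l \<noteq> 0"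
    proof
      assume "k - int n * l = 0"
      then have "\<bar>k\<bar> = \<bar>(2 * \<bar>k\<bar>) * l\<bar>" by (simp add: n_def)
      also have "\<dots> = \<bar>k\<bar> * (2 * \<bar>l\<bar>)" by (simp add: abs_mult)
      finally have "2 * \<bar>l\<bar> = 1" using k by simp
      then show False by presburger
    qed
    have "(x [^] n) [^] l = x [^] (int n * l)" using x by (simp add: int_pow_pow flip: int_pow_int)
    then have eq: "m \<otimes> x [^] k = m' \<otimes> x [^] (int n * l)" using m m' by simp
    have "x [^] (k - int n * l) = inv m \<otimes> (m \<otimes> x [^] k) \<otimes> inv (x [^] (int n * l))"
      using x Mc[OF m(1)] by (simp add: int_pow_diff flip: m_assoc)
    also have "\<dots> = inv m \<otimes> m'"
      unfolding eq using x Mc[OF m(1)] Mc[OF m'(1)] by (simp add: m_assoc)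
    finally have "x [^] (k - int n * l) \<in> M"
      using m m' M(1) by (simp add: subgroup.m_closed subgroup.m_inv_closed)
    then have "x [^] nat \<bar>k - int n * l\<bar> \<in> M" by (rule int_pow_abs_mem[OF M(1) x])
    moreover have "nat \<bar>k - int n * l\<bar> > 0" using e by simp
    ultimately show False using no by blast
  qed
  then obtain N :: nat where "N > 0" "\<And>x. x \<in> carrier G \<Longrightarrow> x [^] N \<in> M"
    using uniform_power_mem[OF fg M(1)] by metis
  then show ?thesis using that M sM finite_index_of_uniform_power[OF fg M(1)] by metis
qed

text \<open>M is maximal among the subgroups that contain H but no power of g with nonzero exponent.
  Then <M, g> is the direct product of M and an infinite cyclic group, and every element has a
  positive power in it. A uniform exponent N moves all of G into this product, where f reads off the
  exponent of g; hence f g = N.\<close>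

lemma (in comm_group) integer_character:
  assumes fg: "finitely_generated G" and H: "subgroup H G" and g: "g \<in> carrier G"
    and inf: "\<And>k::int. g [^] k \<in> H \<Longrightarrow> k = 0"
  obtains f where "f \<in> hom G integer_group" "f g \<noteq> 0" "\<And>h. h \<in> H \<Longrightarrow> f h = 0"
proof -
  define B where "B = {g [^] k | k::int. k \<noteq> 0}"
  have B: "g [^] k \<in> B" if "k \<noteq> 0" for k :: int using that by (auto simp: B_def)
  have "H \<inter> B = {}" using inf by (auto simp: B_def)
  then obtain M where M: "subgroup M G" "H \<subseteq> M" "M \<inter> B = {}"
    and max: "\<And>x. \<lbrakk>x \<in> carrier G; x \<notin> M\<rbrakk> \<Longrightarrow> \<exists>m\<in>M. \<exists>k::int. m \<otimes> x [^] k \<in> B"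
    using maximal_subgroup_avoiding[OF H] by metis
  have Mc: "m \<in> carrier G" if "m \<in> M" for m using M(1) that by (rule subgroup.mem_carrier)
  have infM: "k = 0" if "g [^] k \<in> M" for k :: int using B M(3) that by blast
  note L = subgroup_adjoin[OF M(1) g]
  have "\<exists>n::nat. n > 0 \<and> x [^] n \<in> adjoin G M g" if x: "x \<in> carrier G" for x
  proof (cases "x \<in> M")
    case True
    then have "x [^] (1::nat) \<in> adjoin G M g" using L(2) x by auto
    then show ?thesis by blast
  next
    case False
    then obtain m and k j :: int where m: "m \<in> M" "m \<otimes> x [^] k = g [^] j" "j \<noteq> 0" using max x unfolding B_def by blast
    have "k \<noteq> 0" using m infM[of j] Mc by auto
    have "x [^] k = inv m \<otimes> g [^] j" using m(2)[symmetric] x Mc[OF m(1)] by (simp flip: m_assoc)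
    then have "x [^] k \<in> adjoin G M g"
      using subgroup.m_inv_closed[OF M(1) m(1)] by (auto simp: adjoin_def)
    then show ?thesis using int_pow_abs_mem[OF L(1) x] \<open>k \<noteq> 0\<close> by (intro exI[of _ "nat \<bar>k\<bar>"]) simp
  qed
  then obtain N :: nat where N: "N > 0" "\<And>x. x \<in> carrier G \<Longrightarrow> x [^] N \<in> adjoin G M g"
    using uniform_power_mem[OF fg L(1)] by metis
  define f where "f x = (THE k::int. x [^] N \<otimes> g [^] (- k) \<in> M)" for x
  have f: "f x = k" if x: "x \<in> carrier G" and m: "m \<in> M" and eq: "x [^] N = m \<otimes> g [^] k" for x m and k :: int
    unfolding f_def
  proof (rule the_equality)
    have "x [^] N \<otimes> g [^] (- k) = m \<otimes> g [^] (k - k)" unfolding eq using Mc[OF m] g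
      by (simp add: m_assoc flip: int_pow_mult)
    then show "x [^] N \<otimes> g [^] (- k) \<in> M" using Mc[OF m] m by simp
  next
    fix j :: int assume "x [^] N \<otimes> g [^] (- j) \<in> M"
    then have "inv m \<otimes> (m \<otimes> g [^] k \<otimes> g [^] (- j)) \<in> M"
      unfolding eq using m M(1) by (simp add: subgroup.m_closed subgroup.m_inv_closed)
    then have "g [^] (k - j) \<in> M" using Mc[OF m] g
      by (simp add: int_pow_diff int_pow_neg flip: m_assoc)
    then show "j = k" using infM by fastforce
  qed
  have "f \<in> hom G integer_group"
  proof (rule homI)
    fix x y assume x: "x \<in> carrier G" and y: "y \<in> carrier G"
    obtain m m' and k l :: int where m: "m \<in> M" "x [^] N = m \<otimes> g [^] k" "m' \<in> M" "y [^] N = m' \<otimes> g [^] l"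
      using N(2)[OF x] N(2)[OF y] unfolding adjoin_def by blast
    have "(x \<otimes> y) [^] N = (m \<otimes> m') \<otimes> g [^] (k + l)"
      using x y g m Mc by (simp add: pow_mult_distrib m_comm int_pow_mult m_ac)
    then have "f (x \<otimes> y) = k + l" using f[of "x \<otimes> y" "m \<otimes> m'"] x y m subgroup.m_closed[OF M(1)] by simp
    then show "f (x \<otimes> y) = f x \<otimes>\<^bsub>integer_group\<^esub> f y" using f x y m by simp
  qed simp
  moreover have "f g = int N"
    by (rule f[OF g subgroup.one_closed[OF M(1)]]) (use g in \<open>simp add: int_pow_int\<close>)
  moreover have "f h = 0" if "h \<in> H" for h
  proof -
    have hM: "h \<in> M" using that M(2) by blast
    then have "h [^] N \<in> M" using subgroup_int_pow_closed[OF M(1), of h "int N"] by (simp add: int_pow_int)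
    then show ?thesis using f[of h "h [^] N" 0] Mc[OF hM] by simp
  qed
  ultimately show ?thesis using that[of f] N(1) by simp
qed

section \<open>Finite quotients and integer characters adapted to a pair of elements\<close>

lemma (in group) finite_index_Int:
  assumes "subgroup K G" "finite (rcosets K)" "subgroup L G" "finite (rcosets L)"
  shows "finite (rcosets (K \<inter> L))"
proof (rule finite_indexI[OF subgroups_Inter_pair[OF assms(1,3)], where h = "\<lambda>x. (K #> x, L #> x)"])
  have "(\<lambda>x. (K #> x, L #> x)) ` carrier G \<subseteq> (rcosets K) \<times> (rcosets L)"
    by (auto simp: RCOSETS_def)
  then show "finite ((\<lambda>x. (K #> x, L #> x)) ` carrier G)" using assms finite_subset by blast
qed (use assms rcos_eq_iff in auto)

text \<open>Conditions that survive shrinking M are met simultaneously by an intersection.\<close>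

lemma (in group) finite_index_common:
  assumes "finite F" and R: "R \<subseteq> carrier G"
    and ex: "\<And>p. p \<in> F \<Longrightarrow> \<exists>M. subgroup M G \<and> finite (rcosets M) \<and> R \<subseteq> M \<and> Q p M"
    and anti: "\<And>p M M'. \<lbrakk>Q p M; M' \<subseteq> M\<rbrakk> \<Longrightarrow> Q p M'"
  shows "\<exists>M. subgroup M G \<and> finite (rcosets M) \<and> R \<subseteq> M \<and> (\<forall>p\<in>F. Q p M)"
  using assms(1) ex
proof (induction F)
  case empty
  have "finite (rcosets (carrier G))"
    by (rule finite_indexI[OF subgroup_self, where h = "\<lambda>_. ()"]) auto
  then show ?case using R subgroup_self by blast
next
  case (insert p F)
  obtain M where M: "subgroup M G" "finite (rcosets M)" "R \<subseteq> M" "\<forall>p\<in>F. Q p M"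
    using insert by auto
  obtain M' where M': "subgroup M' G" "finite (rcosets M')" "R \<subseteq> M'" "Q p M'"
    using insert.prems[of p] by auto
  have "subgroup (M \<inter> M') G" "finite (rcosets (M \<inter> M'))" "R \<subseteq> M \<inter> M'" "\<forall>q\<in>insert p F. Q q (M \<inter> M')"
    using M M' subgroups_Inter_pair finite_index_Int anti[of _ M "M \<inter> M'"] anti[of _ M' "M \<inter> M'"] by auto
  then show ?case by blast
qed

text \<open>This condition makes the orders of \<open>a\<close> and \<open>b\<close> agree in arbitrarily large finite quotients of a finitely
  generated abelian group. For infinite order it is what balancedness provides at an edge outside the
  maximal tree.\<close>

definition order_compatible :: "('a, 'm) monoid_scheme \<Rightarrow> 'a \<Rightarrow> 'a \<Rightarrow> bool" where
  "order_compatible G a b \<longleftrightarrow> group.ord G a = group.ord G b \<and>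
     (group.ord G a = 0 \<longrightarrow> (\<forall>(k::int) (l::int). a [^]\<^bsub>G\<^esub> k = b [^]\<^bsub>G\<^esub> l \<longrightarrow> \<bar>k\<bar> = \<bar>l\<bar>))"

text \<open>M0 separates each s from its H. It contains R = <a^N, b^N> for a suitable N, and
  compatibility ensures that a^k or b^k lies in R only if N divides k. A finite index subgroup M1
  that contains R but no a^i or b^i with 0 < i < N then gives both elements order exactly N modulo
  M0 \<inter> M1.\<close>

lemma (in comm_group) finite_quotient_order_compatible:
  assumes fg: "finitely_generated G" and a: "a \<in> carrier G" and b: "b \<in> carrier G"
    and ab: "order_compatible G a b"
    and F: "finite F" "\<And>s H. (s, H) \<in> F \<Longrightarrow> s \<in> carrier G \<and> subgroup H G \<and> s \<notin> H"
  obtains M where "subgroup M G" "finite (rcosets M)"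
    "\<And>s H h. \<lbrakk>(s, H) \<in> F; h \<in> H\<rbrakk> \<Longrightarrow> s \<otimes> inv h \<notin> M"
    "\<And>k::int. a [^] k \<in> M \<longleftrightarrow> b [^] k \<in> M"
proof -
  have "\<exists>M. subgroup M G \<and> finite (rcosets M) \<and> {} \<subseteq> M \<and> (\<forall>p\<in>F. \<forall>h\<in>snd p. fst p \<otimes> inv h \<notin> M)"
  proof (rule finite_index_common[OF F(1)])
    fix p assume "p \<in> F"
    then obtain s H where p: "p = (s, H)" "s \<in> carrier G" "subgroup H G" "s \<notin> H"
      using F(2) by (metis surj_pair)
    obtain M where M: "subgroup M G" "finite (rcosets M)" "H \<subseteq> M" "s \<notin> M"
      using subgroup_separable[OF fg p(3,2,4)] .
    have "s \<otimes> inv h \<notin> M" if "h \<in> H" for h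
    proof
      assume "s \<otimes> inv h \<in> M"
      then have "s \<otimes> inv h \<otimes> h \<in> M" using that M(3) subgroup.m_closed[OF M(1)] by blast
      then show False using M(4) p(2,3) that by (simp add: m_assoc subgroup.mem_carrier)
    qed
    then show "\<exists>M. subgroup M G \<and> finite (rcosets M) \<and> {} \<subseteq> M \<and> (\<forall>h\<in>snd p. fst p \<otimes> inv h \<notin> M)"
      using M p(1) by auto
  qed auto
  then obtain M0 where M0: "subgroup M0 G" "finite (rcosets M0)" "\<forall>p\<in>F. \<forall>h\<in>snd p. fst p \<otimes> inv h \<notin> M0" by auto
  \<comment> \<open>The last clause says that a^k or b^k in <a^N, b^N> forces N to divide k.\<close>
  have "\<exists>N::nat. N > 0 \<and> a [^] N \<in> M0 \<and> b [^] N \<in> M0 \<and>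
    (\<forall>k x y::int. a [^] k = a [^] (int N * x) \<otimes> b [^] (int N * y) \<or> b [^] k = a [^] (int N * x) \<otimes> b [^] (int N * y) \<longrightarrow> int N dvd k)"
  proof (cases "ord a = 0")
    \<comment> \<open>For finite orders N = ord a works, as <a^N, b^N> is then trivial.\<close>
    case False
    have "a [^] ord a = \<one>" "b [^] ord a = \<one>" using a b ab pow_ord_eq_1 by (metis order_compatible_def)+
    then have one: "a [^] (int (ord a) * x) = \<one>" "b [^] (int (ord a) * x) = \<one>" for x
      using a b by (simp_all add: int_pow_int flip: int_pow_pow)
    have "\<forall>k::int. a [^] k = \<one> \<or> b [^] k = \<one> \<longrightarrow> int (ord a) dvd k"
      using a b ab by (auto simp: int_pow_eq_id order_compatible_def)
    then show ?thesis
      using False one \<open>a [^] ord a = \<one>\<close> \<open>b [^] ord a = \<one>\<close> subgroup.one_closed[OF M0(1)] a b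
      by (intro exI[of _ "ord a"]) simp
  next
    case True
    obtain m n :: nat where m: "m > 0" "a [^] m \<in> M0" "n > 0" "b [^] n \<in> M0"
      using finite_index_power_mem[OF M0(1,2)] a b by metis
    have "a [^] (m * n) \<in> M0" "b [^] (m * n) \<in> M0"
      using subgroup_int_pow_closed[OF M0(1) m(2), of "int n"] subgroup_int_pow_closed[OF M0(1) m(4), of "int m"] a b
      by (simp_all add: int_pow_int nat_pow_pow mult.commute)
    moreover have "int (m * n) dvd k"
      if "a [^] k = a [^] (int (m * n) * x) \<otimes> b [^] (int (m * n) * y) \<or> b [^] k = a [^] (int (m * n) * x) \<otimes> b [^] (int (m * n) * y)" for k x y
    proof -
      let ?N = "int (m * n)"
      \<comment> \<open>Collecting the powers of each element on one side turns membership in <a^N,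
        b^N> into a^(k - N*x) = b^(N*y) or its mirror image; compatibility equates the absolute
        values of the exponents.\<close>
      have dvd: "?N dvd k" if "\<bar>k - ?N * x\<bar> = \<bar>?N * y\<bar>" for x y
      proof -
        have "?N dvd k - ?N * x" using that by (metis dvd_abs_iff dvd_triv_left)
        then show ?thesis by (metis dvd_diff_right_iff dvd_triv_left dvd_minus_iff minus_diff_eq)
      qed
      have compat: "\<bar>i\<bar> = \<bar>j\<bar>" if "a [^] i = b [^] j" for i j :: int
        using ab True that by (simp add: order_compatible_def)
      from that show ?thesis
      proof
        assume "a [^] k = a [^] (?N * x) \<otimes> b [^] (?N * y)"
        then have "a [^] k = b [^] (?N * y) \<otimes> a [^] (?N * x)" using a b by (simp add: m_comm)
        then have "a [^] (k - ?N * x) = b [^] (?N * y)"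
          using a b by (simp add: int_pow_diff m_assoc del: of_nat_mult)
        then show ?thesis using dvd compat by blast
      next
        assume "b [^] k = a [^] (?N * x) \<otimes> b [^] (?N * y)"
        then have "a [^] (?N * x) = b [^] (k - ?N * y)"
          using a b by (simp add: int_pow_diff inv_solve_right del: of_nat_mult)
        then show ?thesis using dvd compat by metis
      qed
    qed
    ultimately show ?thesis using m by (intro exI[of _ "m * n"]) simp
  qed
  then obtain N :: nat where N: "N > 0" "a [^] N \<in> M0" "b [^] N \<in> M0"
    and dvd: "\<And>k x y::int. a [^] k = a [^] (int N * x) \<otimes> b [^] (int N * y) \<or> b [^] k = a [^] (int N * x) \<otimes> b [^] (int N * y) \<Longrightarrow> int N dvd k"
    by metis
  define R where "R = adjoin G (generate G {a [^] N}) (b [^] N)"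
  have gN: "subgroup (generate G {a [^] N}) G" using generate_is_subgroup a by simp
  have bN: "b [^] N \<in> carrier G" using b by simp
  have R: "subgroup R G" "a [^] N \<in> R" "b [^] N \<in> R"
    using subgroup_adjoin[OF gN bN] by (auto simp: R_def intro: generate.incl)
  have Rmem: "int N dvd k" if "a [^] k \<in> R \<or> b [^] k \<in> R" for k :: int
  proof -
    have "\<exists>(x::int) (y::int). r = a [^] (int N * x) \<otimes> b [^] (int N * y)" if "r \<in> R" for r
      using that generate_pow[of "a [^] N"] a b unfolding R_def adjoin_def
      by (fastforce simp: int_pow_int simp flip: int_pow_pow)
    then show ?thesis using that dvd by metis
  qed
  let ?F = "(\<lambda>i. a [^] i) ` {0<..<int N} \<union> (\<lambda>i. b [^] i) ` {0<..<int N}"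
  have "\<exists>M. subgroup M G \<and> finite (rcosets M) \<and> R \<subseteq> M \<and> (\<forall>p\<in>?F. p \<notin> M)"
  proof (rule finite_index_common)
    fix p assume p: "p \<in> ?F"
    then have "p \<in> carrier G" using a b by auto
    moreover have "p \<notin> R" using p Rmem zdvd_not_zless by fastforce
    ultimately show "\<exists>M. subgroup M G \<and> finite (rcosets M) \<and> R \<subseteq> M \<and> p \<notin> M"
      using subgroup_separable[OF fg R(1)] by metis
  qed (use R(1) subgroup.subset in auto)
  then obtain M1 where M1: "subgroup M1 G" "finite (rcosets M1)" "R \<subseteq> M1" "\<forall>p\<in>?F. p \<notin> M1" by blast
  have iff: "c [^] k \<in> M0 \<inter> M1 \<longleftrightarrow> int N dvd k"
    if c: "c \<in> carrier G" "c [^] N \<in> M0" "c [^] N \<in> M1" "\<And>i. 0 < i \<Longrightarrow> i < int N \<Longrightarrow> c [^] i \<notin> M1" for c and k :: int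
  proof
    assume "int N dvd k"
    then obtain j where "k = int N * j" by blast
    then have "c [^] k = (c [^] N) [^] j" using c(1) by (simp add: int_pow_int flip: int_pow_pow)
    then show "c [^] k \<in> M0 \<inter> M1" using c subgroup_int_pow_closed M0(1) M1(1) by simp
  next
    assume "c [^] k \<in> M0 \<inter> M1"
    moreover have "(c [^] N) [^] (- (k div int N)) \<in> M1" using c(3) subgroup_int_pow_closed[OF M1(1)] by blast
    ultimately have "c [^] k \<otimes> (c [^] N) [^] (- (k div int N)) \<in> M1" using subgroup.m_closed[OF M1(1)] by blast
    moreover have "c [^] k \<otimes> (c [^] N) [^] (- (k div int N)) = c [^] (k mod int N)"
    proof -
      have "(c [^] N) [^] (- (k div int N)) = c [^] (- (int N * (k div int N)))"
        using c(1) int_pow_pow[OF c(1), of "int N" "- (k div int N)"] by (simp add: int_pow_int)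
      then show ?thesis using c(1) by (simp add: minus_mult_div_eq_mod flip: int_pow_mult)
    qed
    ultimately have "c [^] (k mod int N) \<in> M1" by simp
    then have "k mod int N = 0" using c(4)[of "k mod int N"] N(1)
      by (metis of_nat_0_less_iff order_le_less pos_mod_bound pos_mod_sign)
    then show "int N dvd k" by auto
  qed
  have "a [^] k \<in> M0 \<inter> M1 \<longleftrightarrow> b [^] k \<in> M0 \<inter> M1" for k :: int
    using iff[of a k] iff[of b k] a b N R M1 by auto
  then show ?thesis
    using that[of "M0 \<inter> M1"] M0 M1 subgroups_Inter_pair finite_index_Int by fastforce
qed

text \<open>For c = 1 or c = -1, f a = c * f b means that f kills a b^-c, and such an f with f p
  nonzero exists unless some p^m with m nonzero lies in <a b^-c>. If both choices fail, say p^m = (a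
  b^-1)^i and p^n = (a b)^j, then p^(m*n) yields a^(i*n - j*m) = b^(i*n + j*m). For a and b of
  infinite order compatibility forces i*n = 0 or j*m = 0, against the infinite order of p.\<close>

lemma (in comm_group) integer_character_order_compatible:
  assumes fg: "finitely_generated G" and a: "a \<in> carrier G" and b: "b \<in> carrier G"
    and ab: "order_compatible G a b" and p: "p \<in> carrier G" "ord p = 0"
  obtains f where "f \<in> hom G integer_group" "f p \<noteq> 0" "f a = f b \<or> f a = - f b"
proof -
  note result = that
  have inf: "k = 0" if "p [^] k = \<one>" for k :: int using infinite_ord_iff[OF p(1)] p(2) that by blast
  have fab: "f a = c * f b" if f: "f \<in> hom G integer_group" and h: "f (a \<otimes> b [^] (- c)) = 0" for f and c :: int
  proof -
    interpret f: group_hom G integer_group f using f by (simp add: group_hom_def group_hom_axioms_def is_group)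
    show ?thesis using h a b f.hom_int_pow[of b "- c"] by (simp add: f.hom_mult)
  qed
  have main: thesis if inf_c: "\<And>k::int. p [^] k \<in> generate G {a \<otimes> b [^] (- c)} \<Longrightarrow> k = 0"
    and c: "c = 1 \<or> c = - 1" for c :: int
  proof -
    have sub: "subgroup (generate G {a \<otimes> b [^] (- c)}) G" using generate_is_subgroup a b by simp
    obtain f where "f \<in> hom G integer_group" "f p \<noteq> 0" "f (a \<otimes> b [^] (- c)) = 0"
      using integer_character[OF fg sub p(1) inf_c] by (metis generate.incl insertI1)
    then show thesis using fab[of f c] c result[of f] by auto
  qed
  show thesis
  proof (rule ccontr)
    assume no: "\<not> thesis"
    have ex: "\<exists>(m::int) (i::int). m \<noteq> 0 \<and> p [^] m = (a \<otimes> b [^] (- c)) [^] i" if "c = 1 \<or> c = - 1" for c :: int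
    proof (rule ccontr)
      assume neg: "\<not> ?thesis"
      have "k = 0" if pk: "p [^] k \<in> generate G {a \<otimes> b [^] (- c)}" for k :: int
      proof -
        obtain i :: int where "p [^] k = (a \<otimes> b [^] (- c)) [^] i"
          using pk generate_pow[of "a \<otimes> b [^] (- c)"] a b by auto
        then show ?thesis using neg by blast
      qed
      then show False using main[of c] no \<open>c = 1 \<or> c = - 1\<close> by blast
    qed
    obtain m i :: int where m: "m \<noteq> 0" "p [^] m = (a \<otimes> inv b) [^] i"
      using ex[of 1] b by (auto simp: int_pow_neg)
    obtain n j :: int where n: "n \<noteq> 0" "p [^] n = (a \<otimes> b) [^] j"
      using ex[of "- 1"] b by auto
    show False
    proof (cases "ord a = 0")
      case True
      have "(p [^] m) [^] n = (p [^] n) [^] m" using p by (simp add: int_pow_pow mult.commute)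
      then have "a [^] (i * n) \<otimes> inv (b [^] (i * n)) = a [^] (j * m) \<otimes> b [^] (j * m)"
        using a b m n by (simp add: int_pow_pow int_pow_distrib int_pow_inv)
      then have "a [^] (i * n) = b [^] (i * n + j * m) \<otimes> a [^] (j * m)"
        using a b by (simp add: int_pow_mult inv_solve_right' m_ac)
      then have "a [^] (i * n - j * m) = b [^] (i * n + j * m)"
        using a b by (simp add: int_pow_diff m_assoc)
      then have "\<bar>i * n - j * m\<bar> = \<bar>i * n + j * m\<bar>"
        using ab True unfolding order_compatible_def by blast
      then have "i * n = 0 \<or> j * m = 0" by (auto simp: abs_if split: if_splits)
      then have "i = 0 \<or> j = 0" using m n by simp
      then show False using m n inf by auto
    next
      \<comment> \<open>If a and b are torsion, so is a b^-1, and with it p^m.\<close>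
      case False
      have "a [^] int (ord a) = \<one>" "b [^] int (ord a) = \<one>"
        using a b ab by (simp_all add: int_pow_eq_id order_compatible_def)
      then have "(a \<otimes> inv b) [^] int (ord a) = \<one>" using a b by (simp add: int_pow_distrib int_pow_inv)
      moreover have "(p [^] m) [^] int (ord a) = ((a \<otimes> inv b) [^] int (ord a)) [^] i"
        using m a b by (simp add: int_pow_pow mult.commute)
      ultimately have "p [^] (m * int (ord a)) = \<one>" using p a b by (simp add: int_pow_pow)
      then show False using inf m False by fastforce
    qed
  qed
qed

section \<open>Permutation representations\<close>

definition perm_group :: "'x set \<Rightarrow> ('x \<Rightarrow> 'x) monoid" where
  "perm_group X = \<lparr>carrier = {f. f permutes X}, monoid.mult = (\<circ>), one = id\<rparr>"

definition shift :: "int \<Rightarrow> 'x \<times> int \<Rightarrow> 'x \<times> int" where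
  "shift k = (\<lambda>(x, z). (x, z + k))"

text \<open>The permutational wreath product of \<int> with the symmetric group of X: its elements
  carry the fibres {x} x \<int> onto each other by translations.\<close>

definition shift_group :: "'x set \<Rightarrow> ('x \<times> int \<Rightarrow> 'x \<times> int) monoid" where
  "shift_group X = \<lparr>carrier = {f. f permutes (X \<times> UNIV) \<and> (\<forall>k. f \<circ> shift k = shift k \<circ> f)},
     monoid.mult = (\<circ>), one = id\<rparr>"

lemma group_perm_group: "group (perm_group X)"
proof (rule groupI)
  fix f assume "f \<in> carrier (perm_group X)"
  then show "\<exists>g\<in>carrier (perm_group X). g \<otimes>\<^bsub>perm_group X\<^esub> f = \<one>\<^bsub>perm_group X\<^esub>"
    by (intro bexI[of _ "inv_into UNIV f"]) (auto simp: perm_group_def permutes_inv permutes_inv_o)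
qed (auto simp: perm_group_def permutes_compose permutes_id comp_assoc)

lemma group_shift_group: "group (shift_group X)"
proof (rule groupI)
  fix f assume f: "f \<in> carrier (shift_group X)"
  then have p: "f permutes X \<times> UNIV" by (simp add: shift_group_def)
  have "inv_into UNIV f \<circ> shift k = shift k \<circ> inv_into UNIV f" for k
  proof -
    have "inv_into UNIV f \<circ> shift k \<circ> (f \<circ> inv_into UNIV f) = inv_into UNIV f \<circ> (f \<circ> shift k) \<circ> inv_into UNIV f"
      using f by (simp add: shift_group_def comp_assoc)
    also have "\<dots> = (inv_into UNIV f \<circ> f) \<circ> shift k \<circ> inv_into UNIV f" by (simp add: comp_assoc)
    finally show ?thesis using permutes_inv_o[OF p] by simp
  qed
  then show "\<exists>g\<in>carrier (shift_group X). g \<otimes>\<^bsub>shift_group X\<^esub> f = \<one>\<^bsub>shift_group X\<^esub>"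
    using p by (intro bexI[of _ "inv_into UNIV f"]) (auto simp: shift_group_def permutes_inv permutes_inv_o)
next
  fix f g assume "f \<in> carrier (shift_group X)" "g \<in> carrier (shift_group X)"
  then have f: "f permutes X \<times> UNIV" "\<And>k. f \<circ> shift k = shift k \<circ> f"
    and g: "g permutes X \<times> UNIV" "\<And>k. g \<circ> shift k = shift k \<circ> g" by (simp_all add: shift_group_def)
  have "(f \<circ> g) \<circ> shift k = shift k \<circ> (f \<circ> g)" for k
    using f(2)[of k] g(2)[of k] by (metis comp_assoc)
  then show "f \<otimes>\<^bsub>shift_group X\<^esub> g \<in> carrier (shift_group X)"
    using f(1) g(1) by (simp add: shift_group_def permutes_compose)
qed (auto simp: shift_group_def permutes_id comp_assoc)

lemma finite_index_generate_integer_group: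
  assumes "d \<noteq> 0"
  shows "finite (rcosets\<^bsub>integer_group\<^esub> (generate integer_group {d}))"
proof -
  interpret Z: group integer_group by simp
  have gen: "generate integer_group {d} = {k * d | k. True}"
    using Z.generate_pow[of d] by simp
  show ?thesis
  proof (rule Z.finite_indexI[where h = "\<lambda>x. x mod d"])
    show "subgroup (generate integer_group {d}) integer_group" by (rule Z.generate_is_subgroup) simp
    \<comment> \<open>\<open>mod\<close> takes the sign of its divisor, hence the two
      ranges.\<close>
    have "(\<lambda>x. x mod d) ` UNIV \<subseteq> {0..<d} \<union> {d<..0}"
      using assms by (cases "d > 0") auto
    then show "finite ((\<lambda>x. x mod d) ` carrier integer_group)" using finite_subset by auto
  next
    fix x y assume "x mod d = y mod d"
    then have "d dvd x - y" by (simp add: mod_eq_dvd_iff)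
    then show "x \<otimes>\<^bsub>integer_group\<^esub> inv\<^bsub>integer_group\<^esub> y \<in> generate integer_group {d}"
      by (auto simp: gen dvd_def mult.commute)
  qed
qed

text \<open>Serves elements of finite order: a finite quotient that is injective on the cyclic
  subgroup suffices for them.\<close>

lemma (in group) virtual_retract_finite_image:
  assumes W: "group W" "finite (carrier W)" and \<Phi>: "\<Phi> \<in> hom G W" and g: "g \<in> carrier G"
    and inj: "\<And>k::int. \<Phi> g [^]\<^bsub>W\<^esub> k = \<one>\<^bsub>W\<^esub> \<Longrightarrow> g [^] k = \<one>"
  shows "virtual_retract (generate G {g}) G"
proof (rule virtual_retract_cyclicI[OF subgroup_self])
  show "finite (rcosets (carrier G))"
    by (rule finite_indexI[OF subgroup_self, where h = "\<lambda>_. ()"]) auto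
  interpret W: group W by fact
  have "subgroup (generate W {\<Phi> g}) W"
    using W.generate_is_subgroup[of "{\<Phi> g}"] hom_in_carrier[OF \<Phi> g] by simp
  then show "finite (rcosets\<^bsub>W\<^esub> (generate W {\<Phi> g}))"
    using W.rcosets_subset_PowG W(2) by (meson finite_Pow_iff finite_subset)
qed (use W \<Phi> g inj in auto)

text \<open>The fibres of the projection to \<open>X\<close> are copies of \<open>\<int>\<close>, and the stabiliser of a fibre acts on it by
  translations.\<close>

lemma (in group) virtual_retract_translation:
  assumes X: "finite X" and \<Phi>: "\<Phi> \<in> hom G (shift_group X)" and g: "g \<in> carrier G"
    and x: "x \<in> X" and gx: "\<Phi> g (x, 0) = (x, d)" and d: "d \<noteq> 0"
  shows "virtual_retract (generate G {g}) G"
proof -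
  interpret \<Phi>: group_hom G "shift_group X" \<Phi>
    using \<Phi> group_shift_group by (simp add: group_hom_def group_hom_axioms_def is_group)
  have mult: "\<Phi> (a \<otimes> b) p = \<Phi> a (\<Phi> b p)" if "a \<in> carrier G" "b \<in> carrier G" for a b p
    using \<Phi>.hom_mult[OF that] by (simp add: shift_group_def)
  have one: "\<Phi> \<one> p = p" for p using \<Phi>.hom_one by (simp add: shift_group_def)
  have inv_cancel: "\<Phi> (inv a) (\<Phi> a p) = p" if "a \<in> carrier G" for a p
    using mult[of "inv a" a p] that one by simp
  have shift: "\<Phi> a (y, z + k) = shift k (\<Phi> a (y, z))" if "a \<in> carrier G" for a y z k
  proof -
    have "\<Phi> a \<circ> shift k = shift k \<circ> \<Phi> a" using \<Phi>.hom_closed[OF that] by (simp add: shift_group_def)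
    then have "(\<Phi> a \<circ> shift k) (y, z) = (shift k \<circ> \<Phi> a) (y, z)" by simp
    then show ?thesis by (simp add: shift_def)
  qed
  have shift0: "\<Phi> a (y, k) = shift k (\<Phi> a (y, 0))" if "a \<in> carrier G" for a y k
    using shift[OF that, of y 0 k] by simp
  have inX: "fst (\<Phi> a (x, 0)) \<in> X" if "a \<in> carrier G" for a
  proof -
    have "\<Phi> a permutes X \<times> UNIV" using \<Phi>.hom_closed[OF that] by (simp add: shift_group_def)
    then have "\<Phi> a (x, 0) \<in> X \<times> UNIV" using permutes_in_image[of "\<Phi> a" "X \<times> UNIV" "(x, 0)"] x by blast
    then show ?thesis by auto
  qed
  define K where "K = {a \<in> carrier G. fst (\<Phi> a (x, 0)) = x}"
  have Kx: "\<Phi> a (x, 0) = (x, snd (\<Phi> a (x, 0)))" if "a \<in> K" for a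
    using that by (metis (mono_tags, lifting) K_def mem_Collect_eq prod.collapse)
  have Kc: "a \<in> carrier G" if "a \<in> K" for a using that by (simp add: K_def)
  have Kz: "\<Phi> a (x, k) = (x, snd (\<Phi> a (x, 0)) + k)" if "a \<in> K" for a k
    using shift0[OF Kc[OF that], of x k] Kx[OF that] by (metis case_prod_conv shift_def)
  have KI: "a \<in> K" if "a \<in> carrier G" "\<Phi> a (x, k) = (x, l)" for a k l
    using shift0[OF that(1), of x k] that by (auto simp: K_def shift_def split: prod.splits)
  have K: "subgroup K G"
  proof (rule subgroupI)
    show "K \<noteq> {}" using one by (auto simp: K_def)
  next
    fix a assume a: "a \<in> K"
    show "inv a \<in> K"
      using KI[of "inv a"] inv_cancel[OF Kc[OF a], of "(x, 0)"] Kx[OF a] Kc[OF a] by (metis inv_closed)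
  next
    fix a b assume a: "a \<in> K" and b: "b \<in> K"
    show "a \<otimes> b \<in> K"
    proof (rule KI)
      show "\<Phi> (a \<otimes> b) (x, 0) = (x, snd (\<Phi> a (x, 0)) + snd (\<Phi> b (x, 0)))"
        using mult[OF Kc[OF a] Kc[OF b]] Kx[OF b] Kz[OF a] by metis
    qed (use Kc a b in blast)
  qed (use Kc in blast)
  show ?thesis
  proof (rule virtual_retract_cyclicI[OF K, where f = "\<lambda>a. snd (\<Phi> a (x, 0))" and A = integer_group])
    show "finite (rcosets K)"
    \<comment> \<open>Two elements lie in the same right coset of the stabiliser \<open>K\<close>
      iff their inverses move (x, 0) into the same fibre.\<close>
    proof (rule finite_indexI[OF K, where h = "\<lambda>a. fst (\<Phi> (inv a) (x, 0))"])
      show "finite ((\<lambda>a. fst (\<Phi> (inv a) (x, 0))) ` carrier G)"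
        by (rule finite_subset[OF _ X]) (use inX[OF inv_closed] in blast)
    next
      fix a b assume a: "a \<in> carrier G" and b: "b \<in> carrier G"
        and eq: "fst (\<Phi> (inv a) (x, 0)) = fst (\<Phi> (inv b) (x, 0))"
      then obtain y k l where y: "\<Phi> (inv a) (x, 0) = (y, k)" "\<Phi> (inv b) (x, 0) = (y, l)"
        by (metis prod.collapse)
      have "\<Phi> a (y, k) = (x, 0)" using inv_cancel[of "inv a" "(x, 0)"] a y by simp
      then have "\<Phi> a (y, l) = (x, l - k)" using shift[OF a, of y k "l - k"] by (simp add: shift_def)
      then have "\<Phi> (a \<otimes> inv b) (x, 0) = (x, l - k)" using mult[OF a inv_closed[OF b]] y(2) by metis
      then show "a \<otimes> inv b \<in> K" using KI a b by simp
    qed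
    show "g \<in> K" using KI[OF g gx] .
    show "(\<lambda>a. snd (\<Phi> a (x, 0))) \<in> hom (G\<lparr>carrier := K\<rparr>) integer_group"
    proof (rule homI)
      fix a b assume "a \<in> carrier (G\<lparr>carrier := K\<rparr>)" "b \<in> carrier (G\<lparr>carrier := K\<rparr>)"
      then have "a \<in> K" "b \<in> K" by auto
      then have "\<Phi> (a \<otimes> b) (x, 0) = (x, snd (\<Phi> a (x, 0)) + snd (\<Phi> b (x, 0)))"
        using mult[OF Kc Kc] Kx[of b] Kz[of a] by metis
      then show "snd (\<Phi> (a \<otimes>\<^bsub>G\<lparr>carrier := K\<rparr>\<^esub> b) (x, 0))
          = snd (\<Phi> a (x, 0)) \<otimes>\<^bsub>integer_group\<^esub> snd (\<Phi> b (x, 0))" by simp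
    qed simp
    show "finite (rcosets\<^bsub>integer_group\<^esub> (generate integer_group {snd (\<Phi> g (x, 0))}))"
      using finite_index_generate_integer_group[OF d] gx by simp
    show "g [^] k = \<one>" if "snd (\<Phi> g (x, 0)) [^]\<^bsub>integer_group\<^esub> k = \<one>\<^bsub>integer_group\<^esub>" for k :: int
      using that gx d by simp
  qed simp
qed

section \<open>Free actions of finite cyclic groups and matchings of their orbits\<close>

definition free_cyclic_on :: "nat \<Rightarrow> ('x \<Rightarrow> 'x) \<Rightarrow> 'x set \<Rightarrow> bool" where
  "free_cyclic_on m f X \<longleftrightarrow> m > 0 \<and> f \<in> X \<rightarrow> X \<and>
     (\<forall>x\<in>X. \<forall>k l. (f ^^ k) x = (f ^^ l) x \<longleftrightarrow> k mod m = l mod m)"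

text \<open>Although only nonnegative powers of f occur, lying in one orbit is symmetric, because
  f^m is the identity on X.\<close>

lemma free_cyclic_on_funpow:
  assumes f: "free_cyclic_on m f X" and x: "x \<in> X"
  shows "(f ^^ k) x \<in> X" "(f ^^ k) x = y \<Longrightarrow> \<exists>j. (f ^^ j) y = x"
proof -
  have m: "m > 0" and fX: "f \<in> X \<rightarrow> X"
    and iff: "\<And>k l. (f ^^ k) x = (f ^^ l) x \<longleftrightarrow> k mod m = l mod m"
    using f x unfolding free_cyclic_on_def by blast+
  show "(f ^^ k) x \<in> X" using x fX by (induction k) auto
  show "\<exists>j. (f ^^ j) y = x" if y: "(f ^^ k) x = y"
  proof -
    have "(f ^^ (m - k mod m)) y = (f ^^ (m - k mod m + k)) x" using y by (simp add: funpow_add)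
    also have "\<dots> = (f ^^ 0) x"
    proof -
      have "(m - k mod m + k) mod m = (m - k mod m + k mod m) mod m" by (metis mod_add_right_eq)
      then have "(m - k mod m + k) mod m = 0" using m by simp
      then show ?thesis using iff[of "m - k mod m + k" 0] by simp
    qed
    finally show ?thesis by auto
  qed
qed

text \<open>S meets every orbit at most once, so a base point in S and an exponent below m
  parametrise the union of the orbits met by S.\<close>

lemma free_cyclic_on_orbits:
  assumes f: "free_cyclic_on m f X" and S: "S \<subseteq> X"
    and dis: "\<And>x y k. \<lbrakk>x \<in> S; y \<in> S; (f ^^ k) x = y\<rbrakk> \<Longrightarrow> x = y"
  shows "inj_on (\<lambda>(x, k). (f ^^ k) x) (S \<times> {..<m})"
    "(\<lambda>(x, k). (f ^^ k) x) ` (S \<times> {..<m}) = {(f ^^ k) x | x k. x \<in> S}"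
proof -
  have m: "m > 0" and iff: "\<And>x k l. x \<in> X \<Longrightarrow> (f ^^ k) x = (f ^^ l) x \<longleftrightarrow> k mod m = l mod m"
    using f unfolding free_cyclic_on_def by blast+
  show "inj_on (\<lambda>(x, k). (f ^^ k) x) (S \<times> {..<m})"
  proof (rule inj_onI, clarsimp)
    fix x k y l assume xy: "x \<in> S" "y \<in> S" and kl: "k < m" "l < m" and eq: "(f ^^ k) x = (f ^^ l) y"
    obtain j where "(f ^^ j) ((f ^^ l) y) = y" using free_cyclic_on_funpow(2)[OF f, of y l] xy S by blast
    then have "(f ^^ (j + k)) x = y" using eq by (simp add: funpow_add)
    then have "x = y" using dis xy by blast
    then show "x = y \<and> k = l" using eq iff[of x k l] kl xy S by auto
  qed
  show "(\<lambda>(x, k). (f ^^ k) x) ` (S \<times> {..<m}) = {(f ^^ k) x | x k. x \<in> S}"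
  proof safe
    fix x k assume x: "x \<in> S"
    then have "(f ^^ k) x = (f ^^ (k mod m)) x" using iff[of x k "k mod m"] S by auto
    then show "(f ^^ k) x \<in> (\<lambda>(x, k). (f ^^ k) x) ` (S \<times> {..<m})"
      using x m by (auto intro!: image_eqI[of _ _ "(x, k mod m)"])
  qed auto
qed

text \<open>Both sides are disjoint unions of free orbits of the same length, so a partial matching of orbits can
  be completed by counting. This is the finiteness argument behind M. Hall's theorem.\<close>

lemma equivariant_extension:
  assumes X: "finite X" and f: "free_cyclic_on m f X" and g: "free_cyclic_on m g X"
    and L0: "L0 \<subseteq> X \<times> X"
    and disf: "\<And>p q k. \<lbrakk>p \<in> L0; q \<in> L0; (f ^^ k) (fst p) = fst q\<rbrakk> \<Longrightarrow> p = q"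
    and disg: "\<And>p q k. \<lbrakk>p \<in> L0; q \<in> L0; (g ^^ k) (snd p) = snd q\<rbrakk> \<Longrightarrow> p = q"
  obtains \<tau> where "bij_betw \<tau> X X" "\<And>x. x \<in> X \<Longrightarrow> \<tau> (f x) = g (\<tau> x)" "\<And>x y. (x, y) \<in> L0 \<Longrightarrow> \<tau> x = y"
proof -
  \<comment> \<open>Partial matchings of f-orbits with g-orbits, each pair of orbits being
    represented by one pair of points and each orbit occurring at most once.\<close>
  define good where "good L \<longleftrightarrow> L0 \<subseteq> L \<and> L \<subseteq> X \<times> X \<and>
    (\<forall>p\<in>L. \<forall>q\<in>L. \<forall>k. ((f ^^ k) (fst p) = fst q \<longrightarrow> p = q) \<and> ((g ^^ k) (snd p) = snd q \<longrightarrow> p = q))" for L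
  have m: "m > 0" using f by (simp add: free_cyclic_on_def)
  have "finite (Collect good)"
    by (rule finite_subset[of _ "Pow (X \<times> X)"]) (use X in \<open>auto simp: good_def\<close>)
  moreover have "good L0" using L0 disf disg by (auto simp: good_def)
  ultimately obtain L where L: "good L" and max: "\<And>L'. \<lbrakk>good L'; L \<subseteq> L'\<rbrakk> \<Longrightarrow> L = L'"
    using finite_has_maximal[of "Collect good"] by blast
  have LX: "L \<subseteq> X \<times> X" and LL: "L0 \<subseteq> L" using L by (auto simp: good_def)
  have finL: "finite L" using LX X by (meson finite_SigmaI finite_subset)
  have Lf: "p = q" if "p \<in> L" "q \<in> L" "(f ^^ k) (fst p) = fst q" for p q k
    using L that unfolding good_def by blast
  have Lg: "p = q" if "p \<in> L" "q \<in> L" "(g ^^ k) (snd p) = snd q" for p q k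
    using L that unfolding good_def by blast
  have injf: "inj_on fst L" using Lf[where k = 0] by (auto intro!: inj_onI)
  have injg: "inj_on snd L" using Lg[where k = 0] by (auto intro!: inj_onI)
  have S: "fst ` L \<subseteq> X" "snd ` L \<subseteq> X" using LX by auto
  have "x = y" if "x \<in> fst ` L" "y \<in> fst ` L" "(f ^^ k) x = y" for x y k
    using that Lf by (elim imageE) (simp, metis)
  note F = free_cyclic_on_orbits[OF f S(1) this]
  have "x = y" if "x \<in> snd ` L" "y \<in> snd ` L" "(g ^^ k) x = y" for x y k
    using that Lg by (elim imageE) (simp, metis)
  note G = free_cyclic_on_orbits[OF g S(2) this]
  let ?D = "{(f ^^ k) x | x k. x \<in> fst ` L}" and ?R = "{(g ^^ k) x | x k. x \<in> snd ` L}"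
  have DX: "?D \<subseteq> X" using free_cyclic_on_funpow(1)[OF f] S(1) by (intro subsetI) (elim CollectE exE conjE, simp add: subset_iff)
  have RX: "?R \<subseteq> X" using free_cyclic_on_funpow(1)[OF g] S(2) by (intro subsetI) (elim CollectE exE conjE, simp add: subset_iff)
  have "card ?D = card L * m" "card ?R = card L * m"
    using card_image[OF F(1)] card_image[OF G(1)] card_image[OF injf] card_image[OF injg]
    by (simp_all add: F(2) G(2) card_cartesian_product)
  then have cDR: "card ?D = card ?R" by simp
  \<comment> \<open>The matched orbits cover equally many points on both sides. If an f-orbit were
    unmatched, then so would be a g-orbit, and pairing a point of each would enlarge L.\<close>
  have D: "?D = X"
  proof (rule ccontr)
    assume "?D \<noteq> X"
    then have "card ?D < card X" using DX X by (simp add: psubset_card_mono psubset_eq)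
    then have "?R \<noteq> X" using cDR by auto
    then obtain x y where x: "x \<in> X" "x \<notin> ?D" and y: "y \<in> X" "y \<notin> ?R"
      using \<open>?D \<noteq> X\<close> DX RX by blast
    have xf: "(f ^^ k) (fst p) \<noteq> x" "(f ^^ k) x \<noteq> fst p" if "p \<in> L" for p k
    proof -
      show "(f ^^ k) (fst p) \<noteq> x" using x(2) that by blast
      then show "(f ^^ k) x \<noteq> fst p" using free_cyclic_on_funpow(2)[OF f x(1)] x(2) that by blast
    qed
    have yg: "(g ^^ k) (snd p) \<noteq> y" "(g ^^ k) y \<noteq> snd p" if "p \<in> L" for p k
    proof -
      show "(g ^^ k) (snd p) \<noteq> y" using y(2) that by blast
      then show "(g ^^ k) y \<noteq> snd p" using free_cyclic_on_funpow(2)[OF g y(1)] y(2) that by blast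
    qed
    have "good (insert (x, y) L)"
      unfolding good_def
    proof (intro conjI ballI allI impI)
      show "L0 \<subseteq> insert (x, y) L" "insert (x, y) L \<subseteq> X \<times> X" using LL LX x y by auto
    next
      fix p q k assume pq: "p \<in> insert (x, y) L" "q \<in> insert (x, y) L"
      show "p = q" if "(f ^^ k) (fst p) = fst q"
        using pq that xf[of p k] xf[of q k] Lf[of p q k] by (elim insertE) simp_all
      show "p = q" if "(g ^^ k) (snd p) = snd q"
        using pq that yg[of p k] yg[of q k] Lg[of p q k] by (elim insertE) simp_all
    qed
    then have "(x, y) \<in> L" using max[OF _ subset_insertI, of "(x, y)"] by (metis insertI1)
    then show False using xf(1)[of "(x, y)" 0] by simp
  qed
  have R: "?R = X" by (rule card_subset_eq[OF X RX]) (use cDR in \<open>simp only: D\<close>)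
  define \<phi> where "\<phi> = (\<lambda>(p :: 'a \<times> 'a, k). (f ^^ k) (fst p))"
  define \<psi> where "\<psi> = (\<lambda>(p :: 'a \<times> 'a, k). (g ^^ k) (snd p))"
  let ?I = "L \<times> {..<m}"
  have \<phi>: "bij_betw \<phi> ?I X"
  proof -
    have "bij_betw (map_prod fst id) ?I (fst ` L \<times> {..<m})"
      using injf map_prod_surj_on[of fst L "fst ` L" id "{..<m}" "{..<m}"]
      by (simp add: bij_betw_def map_prod_inj_on)
    moreover have "bij_betw (\<lambda>(x, k). (f ^^ k) x) (fst ` L \<times> {..<m}) X" using F(1,2) D by (simp add: bij_betw_def)
    ultimately have "bij_betw ((\<lambda>(x, k). (f ^^ k) x) \<circ> map_prod fst id) ?I X" by (rule bij_betw_trans)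
    then show ?thesis by (simp add: \<phi>_def comp_def case_prod_unfold)
  qed
  have \<psi>: "bij_betw \<psi> ?I X"
  proof -
    have "bij_betw (map_prod snd id) ?I (snd ` L \<times> {..<m})"
      using injg map_prod_surj_on[of snd L "snd ` L" id "{..<m}" "{..<m}"]
      by (simp add: bij_betw_def map_prod_inj_on)
    moreover have "bij_betw (\<lambda>(x, k). (g ^^ k) x) (snd ` L \<times> {..<m}) X" using G(1,2) R by (simp add: bij_betw_def)
    ultimately have "bij_betw ((\<lambda>(x, k). (g ^^ k) x) \<circ> map_prod snd id) ?I X" by (rule bij_betw_trans)
    then show ?thesis by (simp add: \<psi>_def comp_def case_prod_unfold)
  qed
  \<comment> \<open>The k-th iterate from the first point of a matched pair goes to the k-th iterate
    from the second.\<close>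
  define \<tau> where "\<tau> = \<psi> \<circ> the_inv_into ?I \<phi>"
  have \<tau>bij: "bij_betw \<tau> X X" unfolding \<tau>_def using bij_betw_the_inv_into[OF \<phi>] \<psi> by (rule bij_betw_trans)
  have \<tau>: "\<tau> ((f ^^ k) (fst p)) = (g ^^ k) (snd p)" if p: "p \<in> L" for p k
  proof -
    have "(f ^^ k) (fst p) = (f ^^ (k mod m)) (fst p)" "(g ^^ k) (snd p) = (g ^^ (k mod m)) (snd p)"
      using f g p S unfolding free_cyclic_on_def by (metis image_subset_iff mod_mod_trivial)+
    moreover have "the_inv_into ?I \<phi> ((f ^^ (k mod m)) (fst p)) = (p, k mod m)"
      using the_inv_into_f_f[of \<phi> ?I "(p, k mod m)"] \<phi> p m by (simp add: bij_betw_def \<phi>_def)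
    ultimately show ?thesis by (simp add: \<tau>_def \<psi>_def)
  qed
  show ?thesis
  proof (rule that[OF \<tau>bij])
    fix x assume "x \<in> X"
    then obtain p k where p: "p \<in> L" "x = (f ^^ k) (fst p)" using D by blast
    then show "\<tau> (f x) = g (\<tau> x)" using \<tau>[OF p(1), of k] \<tau>[OF p(1), of "Suc k"] by simp
  next
    fix x y assume "(x, y) \<in> L0"
    then show "\<tau> x = y" using \<tau>[of "(x, y)" 0] LL by auto
  qed
qed

section \<open>Maximal trees\<close>

text \<open>Trees as sequences of leaf attachments. This supplies the induction behind the count of
  arcs, the relation subgroup and the potential. Both directions of an edge enter E
  together.\<close>

inductive tree_built :: "('v, 'e) pre_digraph \<Rightarrow> ('e \<Rightarrow> 'e) \<Rightarrow> 'v set \<Rightarrow> 'e set \<Rightarrow> bool"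
  for \<Gamma> arev where
  root: "r \<in> verts \<Gamma> \<Longrightarrow> tree_built \<Gamma> arev {r} {}"
| leaf: "tree_built \<Gamma> arev V E \<Longrightarrow> e \<in> arcs \<Gamma> \<Longrightarrow> tail \<Gamma> e \<in> V \<Longrightarrow> head \<Gamma> e \<notin> V \<Longrightarrow>
    tree_built \<Gamma> arev (insert (head \<Gamma> e) V) (insert e (insert (arev e) E))"

text \<open>\<open>connected\<close> refers to the symmetric closure of H, so the arc across the
  boundary of U may point either way.\<close>

lemma connected_escape:
  assumes con: "Digraph_Component.connected H" and U: "U \<subseteq> verts H" "U \<noteq> {}" "U \<noteq> verts H"
  obtains e where "e \<in> arcs H" "tail H e \<in> U \<and> head H e \<notin> U \<or> head H e \<in> U \<and> tail H e \<notin> U"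
proof -
  obtain u v where uv: "u \<in> U" "v \<in> verts H" "v \<notin> U" using U by blast
  have "u \<rightarrow>\<^sup>*\<^bsub>with_proj (mk_symmetric H)\<^esub> v"
    using con uv U(1) unfolding Digraph_Component.connected_def strongly_connected_def by auto
  then have "(u, v) \<in> (parcs (mk_symmetric H))\<^sup>*" using reachable_rtranclI by fastforce
  then have "v \<in> U" if "\<And>e. e \<in> arcs H \<Longrightarrow> \<not> (tail H e \<in> U \<and> head H e \<notin> U \<or> head H e \<in> U \<and> tail H e \<notin> U)"
  proof (induction rule: rtrancl_induct)
    case (step y z)
    then show ?case using that by (auto simp: parcs_mk_symmetric)
  qed (rule uv(1))
  then show ?thesis using that uv(3) by blast
qed

lemma connected_rtranclI:
  assumes wf: "wf_digraph H" and ne: "verts H \<noteq> {}"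
    and con: "\<And>u v. \<lbrakk>u \<in> verts H; v \<in> verts H\<rbrakk> \<Longrightarrow> (u, v) \<in> (parcs (mk_symmetric H))\<^sup>*"
  shows "Digraph_Component.connected H"
proof -
  interpret wf_digraph H by fact
  have sub: "parcs (mk_symmetric H) \<subseteq> verts H \<times> verts H" by (auto simp: parcs_mk_symmetric)
  have "u \<rightarrow>\<^sup>*\<^bsub>with_proj (mk_symmetric H)\<^esub> v" if uv: "u \<in> verts H" "v \<in> verts H" for u v
  proof -
    have "(u, v) \<in> rtrancl_on (verts H) (parcs (mk_symmetric H))"
      using con[OF uv]
    proof (induction rule: rtrancl_induct)
      case base then show ?case using uv by (simp add: rtrancl_on_refl)
    next
      case (step y z) then show ?case using sub by (auto intro: rtrancl_on_into_rtrancl_on)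
    qed
    then show ?thesis by (simp add: reachable_def)
  qed
  then show ?thesis using ne unfolding Digraph_Component.connected_def strongly_connected_def by simp
qed

lemma cas_nth:
  assumes "pre_digraph.cas H u p v" "Suc i < length p"
  shows "head H (p ! i) = tail H (p ! Suc i)"
  using assms
proof (induction p arbitrary: u i)
  case (Cons e p)
  then show ?case by (cases i; cases p) (auto simp: pre_digraph.cas.simps)
qed simp

context bidirected_digraph
begin

lemma tree_built_subset:
  assumes "tree_built G arev V E"
  shows "V \<subseteq> verts G" "E \<subseteq> arcs G" "V \<noteq> {}" "arev ` E \<subseteq> E"
    "\<And>e. e \<in> E \<Longrightarrow> tail G e \<in> V \<and> head G e \<in> V"
proof -
  have "V \<subseteq> verts G \<and> E \<subseteq> arcs G \<and> V \<noteq> {} \<and> arev ` E \<subseteq> E \<and> (\<forall>e\<in>E. tail G e \<in> V \<and> head G e \<in> V)"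
    using assms by induction (auto simp: arev_arev_raw)
  then show "V \<subseteq> verts G" "E \<subseteq> arcs G" "V \<noteq> {}" "arev ` E \<subseteq> E"
    "\<And>e. e \<in> E \<Longrightarrow> tail G e \<in> V \<and> head G e \<in> V" by blast+
qed

text \<open>Each leaf adds one vertex and two arcs.\<close>

lemma tree_built_card:
  assumes "tree_built G arev V E" "finite (verts G)" "finite (arcs G)"
  shows "card E + 2 = 2 * card V"
  using assms(1)
proof induction
  case (leaf V E e)
  have fin: "finite V" "finite E" using tree_built_subset[OF leaf.hyps(1)] assms finite_subset by blast+
  have "e \<notin> E" "arev e \<notin> E" using tree_built_subset(5)[OF leaf.hyps(1)] leaf.hyps by fastforce+
  moreover have "arev e \<noteq> e" using leaf.hyps arev_dom by blast
  ultimately show ?case using fin leaf by simp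
qed simp

lemma tree_built_connected:
  assumes "tree_built G arev V E" "u \<in> V" "v \<in> V"
  shows "(u, v) \<in> {(tail G e, head G e) | e. e \<in> E}\<^sup>*"
  using assms
proof (induction arbitrary: u v)
  case (leaf V E e)
  let ?R = "{(tail G e, head G e) | e. e \<in> E}"
  let ?R' = "{(tail G f, head G f) | f. f \<in> insert e (insert (arev e) E)}"
  have mono: "?R\<^sup>* \<subseteq> ?R'\<^sup>*" by (rule rtrancl_mono) auto
  have te: "(tail G e, head G e) \<in> ?R'\<^sup>*" by (rule r_into_rtrancl) blast
  have et: "(head G e, tail G e) \<in> ?R'\<^sup>*"
    by (rule r_into_rtrancl) (use leaf.hyps in \<open>auto intro!: exI[of _ "arev e"]\<close>)
  have old: "(x, y) \<in> ?R'\<^sup>*" if "x \<in> V" "y \<in> V" for x y using leaf.IH[OF that] mono by blast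
  have "(u, tail G e) \<in> ?R'\<^sup>*" using leaf.prems(1) et old leaf.hyps by blast
  moreover have "(tail G e, v) \<in> ?R'\<^sup>*" using leaf.prems(2) te old leaf.hyps by blast
  ultimately show ?case by (rule rtrancl_trans)
qed simp

text \<open>The largest tree built inside T reaches all vertices, since an arc leaving it could be
  attached. A further arc of T would close a circuit with a simple path in the built part.\<close>

lemma serre_tree_is_built:
  assumes T: "serre_tree arev T" and sub: "subgraph T G" and fin: "finite (verts G)"
  shows "tree_built G arev (verts T) (arcs T)"
proof -
  interpret T: wf_digraph T using sub by (simp add: subgraph_def)
  have th: "tail T = tail G" "head T = head G" using sub by (simp_all add: subgraph_def compatible_def)
  have TG: "verts T \<subseteq> verts G" "arcs T \<subseteq> arcs G" using sub by (simp_all add: subgraph_def)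
  have finT: "finite (verts T)" using TG fin finite_subset by blast
  have con: "Digraph_Component.connected T" and rev: "arev ` arcs T \<subseteq> arcs T" and nc: "\<And>p. \<not> circuit arev T p"
    using T by (auto simp: serre_tree_def)
  define P where "P n \<longleftrightarrow> (\<exists>V E. tree_built G arev V E \<and> V \<subseteq> verts T \<and> E \<subseteq> arcs T \<and> card V = n)" for n
  obtain r where r: "r \<in> verts T"
    using con by (auto simp: Digraph_Component.connected_def strongly_connected_def)
  have "P 1" unfolding P_def by (rule exI[of _ "{r}"], rule exI[of _ "{}"]) (use r TG in \<open>auto intro: tree_built.root\<close>)
  moreover have "\<forall>n. P n \<longrightarrow> n \<le> card (verts T)" unfolding P_def using card_mono[OF finT] by blast
  ultimately obtain n where n: "P n" "\<And>m. P m \<Longrightarrow> m \<le> n" using GreatestI_nat Greatest_le_nat by metis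
  then obtain V E where VE: "tree_built G arev V E" "V \<subseteq> verts T" "E \<subseteq> arcs T" "card V = n"
    unfolding P_def by blast
  note VE' = tree_built_subset[OF VE(1)]
  have finV: "finite V" using VE(2) finT finite_subset by blast
  have ext: False if e: "e \<in> arcs T" "tail G e \<in> V" "head G e \<notin> V" for e
  proof -
    have "tree_built G arev (insert (head G e) V) (insert e (insert (arev e) E))"
      using VE(1) e TG by (intro tree_built.leaf) auto
    moreover have "insert (head G e) V \<subseteq> verts T" "insert e (insert (arev e) E) \<subseteq> arcs T"
      using VE e rev T.head_in_verts[of e] th by auto
    moreover have "card (insert (head G e) V) = Suc n" using finV e VE(4) by simp
    ultimately have "P (Suc n)" unfolding P_def by blast
    then show False using n(2) by fastforce
  qed
  have V: "V = verts T"
  proof (rule ccontr)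
    assume "V \<noteq> verts T"
    then obtain e where e: "e \<in> arcs T" "tail T e \<in> V \<and> head T e \<notin> V \<or> head T e \<in> V \<and> tail T e \<notin> V"
      using connected_escape[OF con VE(2) VE'(3)] by blast
    from e(2) show False
    proof
      assume "tail T e \<in> V \<and> head T e \<notin> V" then show False using ext e(1) th by metis
    next
      assume "head T e \<in> V \<and> tail T e \<notin> V"
      then show False using ext[of "arev e"] e(1) th rev TG by (metis head_arev image_subset_iff subsetD tail_arev)
    qed
  qed
  have "e \<in> E" if e: "e \<in> arcs T" for e
  proof (rule ccontr)
    assume eE: "e \<notin> E"
    have ends: "tail T e \<in> V" "head T e \<in> V" using V e by auto
    have walk: "\<exists>p. T.awalk u p v \<and> set p \<subseteq> E" if "(u, v) \<in> {(tail G e, head G e) | e. e \<in> E}\<^sup>*" "u \<in> V" for u v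
      using that
    proof (induction rule: rtrancl_induct)
      case base
      then show ?case using V by (auto simp: T.awalk_Nil_iff intro!: exI[of _ "[]"])
    next
      case (step y z)
      then obtain p f where p: "T.awalk u p y" "set p \<subseteq> E" and f: "f \<in> E" "y = tail G f" "z = head G f" by blast
      then have "T.awalk u (p @ [f]) z" using VE(3) th T.head_in_verts[of f]
        by (intro T.awalk_appendI[of u p y]) (auto simp: T.awalk_Cons_iff T.awalk_Nil_iff)
      moreover have "set (p @ [f]) \<subseteq> E" using p f by simp
      ultimately show ?case by blast
    qed
    obtain p where p: "T.awalk (head T e) p (tail T e)" "set p \<subseteq> E"
      using walk[OF tree_built_connected[OF VE(1) ends(2,1)] ends(2)] by blast
    define q where "q = T.awalk_to_apath p"
    have q: "T.apath (head T e) q (tail T e)" "set q \<subseteq> E"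
      using T.apath_awalk_to_apath[OF p(1)] T.awalk_to_apath_subset[OF p(1)] p(2) by (auto simp: q_def)
    have "T.awalk (tail T e) (e # q) (tail T e)" using q(1) e by (simp add: T.apath_def T.awalk_Cons_iff)
    moreover have "distinct (tl (T.awalk_verts (tail T e) (e # q)))" using q(1) by (simp add: T.apath_def)
    ultimately have "T.cycle (e # q)" unfolding T.cycle_def by blast
    \<comment> \<open>The path runs in E, which is closed under reversal and misses e, so the cycle
      is not a mere backtracking.\<close>
    moreover have "e # q \<noteq> [f, arev f]" for f
    proof
      assume "e # q = [f, arev f]"
      then have "arev e \<in> E" using q(2) by auto
      then have "arev (arev e) \<in> E" using VE'(4) by blast
      then show False using eE e TG arev_arev_raw by (metis subsetD)
    qed
    ultimately show False using nc unfolding circuit_def by blast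
  qed
  then show ?thesis using VE V by (metis subsetI subset_antisym)
qed

text \<open>A cycle through the new leaf has to enter it by e and leave it by \<open>arev e\<close>
  at once. As no vertex is repeated, it closes up after these two arcs and is a backtracking; any
  other circuit would already lie in T.\<close>

lemma serre_tree_add_leaf:
  assumes T: "serre_tree arev T" and sub: "subgraph T G"
    and e: "e \<in> arcs G" "tail G e \<in> verts T" "head G e \<notin> verts T"
  defines "T' \<equiv> \<lparr>verts = insert (head G e) (verts T), arcs = insert e (insert (arev e) (arcs T)),
    tail = tail G, head = head G\<rparr>"
  shows "serre_tree arev T'" "subgraph T T'" "subgraph T' G"
proof -
  interpret T: wf_digraph T using sub by (simp add: subgraph_def)
  have th: "tail T = tail G" "head T = head G" using sub by (simp_all add: subgraph_def compatible_def)
  have TG: "verts T \<subseteq> verts G" "arcs T \<subseteq> arcs G" using sub by (simp_all add: subgraph_def)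
  have con: "Digraph_Component.connected T" and rev: "arev ` arcs T \<subseteq> arcs T" and nc: "\<And>p. \<not> circuit arev T p"
    using T by (auto simp: serre_tree_def)
  have inT: "tail G f \<in> verts T" "head G f \<in> verts T" if "f \<in> arcs T" for f
    using T.wellformed[OF that] th by simp_all
  have wf': "wf_digraph T'" using e inT by unfold_locales (auto simp: T'_def)
  then interpret T': wf_digraph T' .
  show "subgraph T T'" using T.wf_digraph_axioms wf' th by (auto simp: subgraph_def compatible_def T'_def)
  show "subgraph T' G" using TG e wf' wf_digraph_axioms by (auto simp: subgraph_def compatible_def T'_def)
  have "Digraph_Component.connected T'"
  proof (rule connected_rtranclI[OF wf'])
    show "verts T' \<noteq> {}" by (simp add: T'_def)
    fix u v assume uv: "u \<in> verts T'" "v \<in> verts T'"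
    let ?R' = "parcs (mk_symmetric T')"
    have mono: "(parcs (mk_symmetric T))\<^sup>* \<subseteq> ?R'\<^sup>*"
      by (rule rtrancl_mono) (auto simp: parcs_mk_symmetric T'_def th)
    have old: "(x, y) \<in> ?R'\<^sup>*" if "x \<in> verts T" "y \<in> verts T" for x y
    proof -
      have "x \<rightarrow>\<^sup>*\<^bsub>with_proj (mk_symmetric T)\<^esub> y"
        using con that unfolding Digraph_Component.connected_def strongly_connected_def by auto
      then have "(x, y) \<in> (parcs (mk_symmetric T))\<^sup>*" using reachable_rtranclI by fastforce
      then show ?thesis using mono by blast
    qed
    have te: "(tail G e, head G e) \<in> ?R'\<^sup>*" "(head G e, tail G e) \<in> ?R'\<^sup>*"
      by (rule r_into_rtrancl, force simp: parcs_mk_symmetric T'_def)+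
    have "(u, tail G e) \<in> ?R'\<^sup>*" using uv te old e by (auto simp: T'_def)
    moreover have "(tail G e, v) \<in> ?R'\<^sup>*" using uv te old e by (auto simp: T'_def)
    ultimately show "(u, v) \<in> ?R'\<^sup>*" by (rule rtrancl_trans)
  qed
  moreover have "\<not> circuit arev T' p" for p
  proof
    assume "circuit arev T' p"
    then obtain u where u: "T'.awalk u p u" "distinct (tl (T'.awalk_verts u p))" "p \<noteq> []"
      and p2: "\<And>f. p \<noteq> [f, arev f]" by (auto simp: circuit_def T'.cycle_def)
    have cas: "T'.cas u p u" and pT': "set p \<subseteq> arcs T'" using u(1) by (auto simp: T'.awalk_def)
    define n where "n = length p"
    have n: "n > 0" using u(3) by (simp add: n_def)
    have th': "tail T' = tail G" "head T' = head G" by (simp_all add: T'_def)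
    have dis: "distinct (map (head G) p)"
      using u(2,3) T'.awalk_verts_conv'[OF cas] th' by simp
    \<comment> \<open>From here on positions are read modulo n. Along the cycle heads are pairwise
      distinct, and therefore tails are too.\<close>
    have nxt: "tail G (p ! (Suc i mod n)) = head G (p ! i)" if "i < n" for i
    proof (cases "Suc i < n")
      case True
      then show ?thesis using cas_nth[OF cas, of i] th' by (simp add: n_def)
    next
      case False
      then have "i = n - 1" using that by simp
      moreover have "tail G (hd p) = u" using cas u(3) T'.cas_simp th' by auto
      moreover have "head G (last p) = u"
        using T'.awalk_verts_conv[of u p] T'.awalk_verts_conv'[OF cas] T'.awlast_of_awalk[OF u(1)] u(3) th' by auto
      ultimately show ?thesis using u(3) n by (simp add: n_def hd_conv_nth last_conv_nth)
    qed
    have heads: "i = j" if "i < n" "j < n" "head G (p ! i) = head G (p ! j)" for i j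
      using dis that by (simp add: distinct_conv_nth n_def) blast
    have prev: "\<exists>k<n. i = Suc k mod n" if "i < n" for i
    proof (cases i)
      case 0
      then show ?thesis using n by (intro exI[of _ "n - 1"]) simp
    next
      case (Suc k)
      then show ?thesis using that by (intro exI[of _ k]) simp
    qed
    have tails: "i = j" if ij: "i < n" "j < n" "tail G (p ! i) = tail G (p ! j)" for i j
    proof -
      obtain k l where "k < n" "i = Suc k mod n" "l < n" "j = Suc l mod n" using prev ij by meson
      then show ?thesis using nxt heads ij(3) by metis
    qed
    have wT: "head G e \<noteq> tail G f" "head G e \<noteq> head G f" if "f \<in> arcs T" for f using inT[OF that] e by auto
    have ne: "tail G e \<noteq> head G e" using e by auto
    have outw: "f = arev e" if "f \<in> arcs T'" "tail G f = head G e" for f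
      using that wT(1)[of f] ne by (auto simp: T'_def)
    have inw: "f = e" if "f \<in> arcs T'" "head G f = head G e" for f
      using that wT(2)[of f] ne e by (auto simp: T'_def)
    have arevT: "arcs T' \<subseteq> arcs G" using TG e by (auto simp: T'_def)
    show False
    proof (cases "e \<in> set p \<or> arev e \<in> set p")
      case False
      then have "T.awalk u p u"
      proof -
        have "set p \<subseteq> arcs T" using pT' False by (auto simp: T'_def)
        moreover have "T.cas v q w = T'.cas v q w" for v q w
          by (induction q arbitrary: v) (simp_all add: T.cas.simps T'.cas.simps th th')
        moreover have "u \<in> verts T"
          using u(3) cas calculation(1) inT th' by (cases p) auto
        ultimately show ?thesis using cas by (simp add: T.awalk_def)
      qed
      moreover have "T.awalk_verts v q = T'.awalk_verts v q" for v q
        by (simp add: T.awalk_verts_conv T'.awalk_verts_conv th th')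
      ultimately have "circuit arev T p" using u p2 by (auto simp: circuit_def T.cycle_def)
      then show False using nc by blast
    next
      case True
      have "e \<in> set p"
      proof (rule ccontr)
        assume no: "e \<notin> set p"
        then obtain j where j: "j < n" "p ! j = arev e" using True by (auto simp: in_set_conv_nth n_def)
        obtain k where k: "k < n" "j = Suc k mod n" using prev j(1) by blast
        have "head G (p ! k) = head G e" using nxt[OF k(1)] k(2) j(2) e by simp
        moreover have "p ! k \<in> set p" using k(1) by (simp add: n_def)
        ultimately show False using inw[of "p ! k"] pT' no by auto
      qed
      then obtain i where i: "i < n" "p ! i = e" by (auto simp: in_set_conv_nth n_def)
      define j where "j = Suc i mod n"
      have jn: "j < n" using n by (simp add: j_def)
      have "tail G (p ! j) = head G e" using nxt[OF i(1)] i(2) by (simp add: j_def)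
      moreover have "p ! j \<in> arcs T'" using jn pT' by (auto simp: n_def)
      ultimately have pj: "p ! j = arev e" using outw by blast
      \<comment> \<open>After \<open>arev e\<close> the cycle is back at the tail of e; by
        distinctness of tails the next position is i again, which leaves n = 2.\<close>
      have "tail G (p ! (Suc j mod n)) = tail G (p ! i)" using nxt[OF jn] pj e i by simp
      then have "Suc j mod n = i" using tails i(1) n by simp
      then have "Suc (Suc i) mod n = i" by (simp add: j_def mod_Suc_eq)
      moreover have "i \<noteq> j" using i pj e arev_dom by metis
      ultimately have "n = 2" using i(1) n unfolding j_def
        by (cases "Suc (Suc i) < n"; cases "Suc i < n") (auto simp: mod_if not_less split: if_splits)
      then obtain x y where p: "p = [x, y]" unfolding n_def by (metis length_0_conv length_Suc_conv numeral_2_eq_2)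
      have "(i = 0 \<and> j = 1) \<or> (i = 1 \<and> j = 0)" using i(1) jn \<open>n = 2\<close> \<open>i \<noteq> j\<close> by linarith
      then have "p = [e, arev e] \<or> p = [arev e, arev (arev e)]" using p i pj e arev_arev_raw by auto
      then show False using p2 by blast
    qed
  qed
  moreover have "arev ` arcs T' \<subseteq> arcs T'" using rev e arev_arev_raw by (auto simp: T'_def)
  ultimately show "serre_tree arev T'" unfolding serre_tree_def by blast
qed

text \<open>If T missed a vertex, connectedness would give an arc leaving T, and attaching it as a
  leaf would contradict maximality.\<close>

lemma maximal_tree_spans:
  assumes mt: "maximal_tree arev G T" and con: "Digraph_Component.connected G" and fin: "finite (verts G)"
  shows "tree_built G arev (verts G) (arcs T)"
proof -
  have T: "subgraph T G" "serre_tree arev T"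
    and max: "\<And>H'. \<lbrakk>H' \<noteq> T; subgraph T H'; subgraph H' G\<rbrakk> \<Longrightarrow> \<not> serre_tree arev H'"
    using mt unfolding maximal_tree_def max_subgraph_def by blast+
  note built = serre_tree_is_built[OF T(2,1) fin]
  note sub = tree_built_subset[OF built]
  have no: False if e: "e \<in> arcs G" "tail G e \<in> verts T" "head G e \<notin> verts T" for e
  proof -
    let ?T' = "\<lparr>verts = insert (head G e) (verts T), arcs = insert e (insert (arev e) (arcs T)), tail = tail G, head = head G\<rparr>"
    have "?T' \<noteq> T" using e(3) by (metis insertI1 pre_digraph.select_convs(1))
    then show False using max serre_tree_add_leaf[OF T(2,1) e] by blast
  qed
  have "verts T = verts G"
  proof (rule ccontr)
    assume "verts T \<noteq> verts G"
    then obtain e where e: "e \<in> arcs G" "tail G e \<in> verts T \<and> head G e \<notin> verts T \<or> head G e \<in> verts T \<and> tail G e \<notin> verts T"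
      using connected_escape[OF con sub(1,3)] by blast
    then show False using no[of e] no[of "arev e"] by auto
  qed
  then show ?thesis using built by simp
qed

end

section \<open>Presentations and path words\<close>

fun word_eval :: "('w, 'm) monoid_scheme \<Rightarrow> ('x \<Rightarrow> 'w) \<Rightarrow> 'x word \<Rightarrow> 'w" where
  "word_eval W \<phi> [] = \<one>\<^bsub>W\<^esub>"
| "word_eval W \<phi> ((b, x) # w) = (if b then \<phi> x else inv\<^bsub>W\<^esub> \<phi> x) \<otimes>\<^bsub>W\<^esub> word_eval W \<phi> w"

lemma (in group) word_eval_closed:
  assumes "\<And>x. x \<in> X \<Longrightarrow> \<phi> x \<in> carrier G" "w \<in> words X"
  shows "word_eval G \<phi> w \<in> carrier G"
  using assms(2)
proof (induction w)
  case (Cons l w) then show ?case using assms(1) by (cases l) auto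
qed simp

lemma (in group) word_eval_append:
  assumes "\<And>x. x \<in> X \<Longrightarrow> \<phi> x \<in> carrier G" "u \<in> words X" "v \<in> words X"
  shows "word_eval G \<phi> (u @ v) = word_eval G \<phi> u \<otimes> word_eval G \<phi> v"
  using assms(2)
proof (induction u)
  case Nil then show ?case using word_eval_closed[OF assms(1,3)] by simp
next
  case (Cons l u)
  then show ?case using assms(1) word_eval_closed[OF assms(1,3)] word_eval_closed[OF assms(1) Cons.hyps(2)]
    by (cases l) (auto simp: m_assoc)
qed

text \<open>Von Dyck's theorem. A chosen representative may be evaluated because congruent words
  have equal values.\<close>

lemma (in group) presented_group_universal:
  assumes \<phi>: "\<And>x. x \<in> X \<Longrightarrow> \<phi> x \<in> carrier G"
    and R: "\<And>u v. \<lbrakk>(u, v) \<in> R; u \<in> words X; v \<in> words X\<rbrakk> \<Longrightarrow> word_eval G \<phi> u = word_eval G \<phi> v"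
  obtains \<Phi> where "\<Phi> \<in> hom (presented_group X R) G"
    "\<And>w. w \<in> words X \<Longrightarrow> \<Phi> (pres_cong X R `` {w}) = word_eval G \<phi> w"
proof -
  have eq: "word_eval G \<phi> u = word_eval G \<phi> v" if "(u, v) \<in> pres_cong X R" for u v
    using that
  proof induction
    case (append u u' v v')
    have "u \<in> words X" "v \<in> words X" "u' \<in> words X" "v' \<in> words X"
      using append.hyps pres_cong_words by blast+
    then show ?case using word_eval_append[of X \<phi>, OF \<phi>] append.IH by metis
  next
    case (cancel x b) then show ?case using \<phi> by simp
  next
    case (rel u v) then show ?case by (rule R)
  qed auto
  define \<Phi> where "\<Phi> A = word_eval G \<phi> (SOME w. w \<in> A)" for A
  have \<Phi>: "\<Phi> (pres_cong X R `` {w}) = word_eval G \<phi> w" if "w \<in> words X" for w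
  proof -
    have "w \<in> pres_cong X R `` {w}" using pres_cong.refl[OF that] by simp
    then have "(SOME v. v \<in> pres_cong X R `` {w}) \<in> pres_cong X R `` {w}" by (rule someI)
    then show ?thesis using eq by (simp add: \<Phi>_def)
  qed
  have "\<Phi> \<in> hom (presented_group X R) G"
  proof (rule homI)
    fix A assume "A \<in> carrier (presented_group X R)"
    then obtain w where "w \<in> words X" "A = pres_cong X R `` {w}"
      by (auto simp: presented_group_def elim!: quotientE)
    then show "\<Phi> A \<in> carrier G" using \<Phi>[of w] word_eval_closed[of X \<phi> w, OF \<phi>] by simp
  next
    fix A B assume "A \<in> carrier (presented_group X R)" "B \<in> carrier (presented_group X R)"
    then obtain u v where u: "u \<in> words X" "A = pres_cong X R `` {u}" and v: "v \<in> words X" "B = pres_cong X R `` {v}"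
      by (auto simp: presented_group_def elim!: quotientE)
    have uv: "u @ v \<in> words X" using u(1) v(1) by (simp only: append_in_lists_conv simp_thms)
    show "\<Phi> (A \<otimes>\<^bsub>presented_group X R\<^esub> B) = \<Phi> A \<otimes> \<Phi> B"
      unfolding u(2) v(2) presented_group_mult[OF u(1) v(1)] \<Phi>[OF uv] \<Phi>[OF u(1)] \<Phi>[OF v(1)]
      by (rule word_eval_append[OF \<phi> u(1) v(1)])
  qed
  then show ?thesis using that \<Phi> by blast
qed

section \<open>Vertex elements and stable letters of the fundamental group\<close>

locale graph_of_abelian_groups = finite_graph_of_groups \<Gamma> arev Gv Ge \<alpha>
  for \<Gamma> :: "('v, 'e) pre_digraph" and arev :: "'e \<Rightarrow> 'e"
    and Gv :: "'v \<Rightarrow> 'a monoid" and Ge :: "'e \<Rightarrow> 'b monoid" and \<alpha> :: "'e \<Rightarrow> 'b \<Rightarrow> 'a" +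
  fixes T :: "('v, 'e) pre_digraph" and Ep :: "'e set"
  assumes comm_Gv: "v \<in> verts \<Gamma> \<Longrightarrow> comm_group (Gv v)"
    and fg_Gv: "v \<in> verts \<Gamma> \<Longrightarrow> finitely_generated (Gv v)"
    and cyclic_Ge: "e \<in> arcs \<Gamma> \<Longrightarrow> cyclic_group (Ge e)"
    and maxtree: "maximal_tree arev \<Gamma> T"
    and orient: "orientation arev \<Gamma> Ep"
begin

abbreviation X where "X \<equiv> fg_gens \<Gamma> Gv Ep"
abbreviation R where "R \<equiv> fg_rels \<Gamma> arev Gv Ge \<alpha> T Ep"
abbreviation G where "G \<equiv> fundamental_group \<Gamma> arev Gv Ge \<alpha> T Ep"
abbreviation word_class where "word_class w \<equiv> pres_cong X R `` {w}"

definition vx :: "'v \<Rightarrow> 'a \<Rightarrow> ('v, 'e, 'a) fg_gen word set" where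
  "vx v a = word_class (elt v a)"

text \<open>Defined for both orientations, so that a path word may traverse an edge either
  way.\<close>

definition st :: "'e \<Rightarrow> ('v, 'e, 'a) fg_gen word set" where
  "st e = (if e \<in> Ep then word_class (stable e) else inv\<^bsub>G\<^esub> word_class (stable (arev e)))"

sublocale G: group G
  unfolding fundamental_group_def by (rule group_presented_group)

lemma arcs_Ep: "e \<in> arcs \<Gamma> \<longleftrightarrow> e \<in> Ep \<or> arev e \<in> Ep" "e \<in> Ep \<Longrightarrow> arev e \<notin> Ep"
proof -
  have o: "arcs \<Gamma> = Ep \<union> arev ` Ep" "Ep \<inter> arev ` Ep = {}" using orient by (auto simp: orientation_def)
  show "arev e \<notin> Ep" if "e \<in> Ep"
  proof
    assume "arev e \<in> Ep"
    moreover have "arev e \<in> arev ` Ep" using that by blast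
    ultimately show False using o(2) by blast
  qed
  have 1: "arev (arev e) = e" using arev_arev_raw arev_dom by metis
  show "e \<in> arcs \<Gamma> \<longleftrightarrow> e \<in> Ep \<or> arev e \<in> Ep"
  proof
    assume "e \<in> arcs \<Gamma>" then show "e \<in> Ep \<or> arev e \<in> Ep"
      using o(1) arev_arev_raw by auto
  next
    assume "e \<in> Ep \<or> arev e \<in> Ep"
    then show "e \<in> arcs \<Gamma>" using o(1) 1 by (metis UnI1 UnI2 imageI)
  qed
qed

lemma arev_arev': "arev (arev e) = e"
  using arev_arev_raw arev_dom by metis

lemma tree: "tree_built \<Gamma> arev (verts \<Gamma>) (arcs T)"
  using maximal_tree_spans[OF maxtree connected] by simp

lemma arcs_T: "e \<in> arcs T \<Longrightarrow> e \<in> arcs \<Gamma>" "e \<in> arcs T \<Longrightarrow> arev e \<in> arcs T"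
  using tree_built_subset(2,4)[OF tree] by auto

lemma Gv_group: "v \<in> verts \<Gamma> \<Longrightarrow> group (Gv v)" by (rule group_Gv)

lemma \<alpha>_hom: "e \<in> arcs \<Gamma> \<Longrightarrow> \<alpha> e \<in> hom (Ge e) (Gv (tail \<Gamma> e))"
  and \<alpha>_inj: "e \<in> arcs \<Gamma> \<Longrightarrow> inj_on (\<alpha> e) (carrier (Ge e))"
  using mon_\<alpha> by (auto simp: mon_def)

lemma \<omega>_hom: "e \<in> arcs \<Gamma> \<Longrightarrow> \<alpha> (arev e) \<in> hom (Ge e) (Gv (head \<Gamma> e))"
  and \<omega>_inj: "e \<in> arcs \<Gamma> \<Longrightarrow> inj_on (\<alpha> (arev e)) (carrier (Ge e))"
  using \<alpha>_hom[of "arev e"] \<alpha>_inj[of "arev e"] Ge_arev[of e] by auto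

lemma \<alpha>_closed: "e \<in> arcs \<Gamma> \<Longrightarrow> c \<in> carrier (Ge e) \<Longrightarrow> \<alpha> e c \<in> carrier (Gv (tail \<Gamma> e))"
  and \<omega>_closed: "e \<in> arcs \<Gamma> \<Longrightarrow> c \<in> carrier (Ge e) \<Longrightarrow> \<alpha> (arev e) c \<in> carrier (Gv (head \<Gamma> e))"
  using hom_in_carrier[OF \<alpha>_hom] hom_in_carrier[OF \<omega>_hom] by auto

lemma elt_word: "v \<in> verts \<Gamma> \<Longrightarrow> a \<in> carrier (Gv v) \<Longrightarrow> elt v a \<in> words X"
  and stable_word: "e \<in> Ep \<Longrightarrow> stable e \<in> words X" "e \<in> Ep \<Longrightarrow> stable_inv e \<in> words X"
  by (auto simp: fg_gens_def)

lemma word_class_closed: "w \<in> words X \<Longrightarrow> word_class w \<in> carrier G"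
  using quotientI[of w "words X" "pres_cong X R"] by (simp add: fundamental_group_def presented_group_def)

lemma word_class_mult:
  "u \<in> words X \<Longrightarrow> v \<in> words X \<Longrightarrow> word_class u \<otimes>\<^bsub>G\<^esub> word_class v = word_class (u @ v)"
  unfolding fundamental_group_def by (rule presented_group_mult)

lemma word_class_Nil: "word_class [] = \<one>\<^bsub>G\<^esub>"
  by (simp add: fundamental_group_def presented_group_def)

lemma word_class_rel: "(u, v) \<in> R \<Longrightarrow> u \<in> words X \<Longrightarrow> v \<in> words X \<Longrightarrow> word_class u = word_class v"
  using equiv_class_eq[OF equiv_pres_cong pres_cong.rel] .

lemma word_class_inv:
  assumes "x \<in> X" shows "word_class [(False, x)] = inv\<^bsub>G\<^esub> word_class [(True, x)]"
proof -
  have w: "[(b, x)] \<in> words X" for b using assms by simp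
  have "word_class [(False, x)] \<otimes>\<^bsub>G\<^esub> word_class [(True, x)] = word_class ([(False, x)] @ [(True, x)])"
    by (rule word_class_mult[OF w w])
  also have "\<dots> = word_class []"
    using equiv_class_eq[OF equiv_pres_cong pres_cong.cancel[OF assms, of False]] by simp
  finally show ?thesis using G.inv_equality word_class_closed[OF w] word_class_Nil by metis
qed

lemma vx_closed: "v \<in> verts \<Gamma> \<Longrightarrow> a \<in> carrier (Gv v) \<Longrightarrow> vx v a \<in> carrier G"
  unfolding vx_def by (rule word_class_closed[OF elt_word])

lemma vx_hom: "v \<in> verts \<Gamma> \<Longrightarrow> vx v \<in> hom (Gv v) G"
proof (rule homI)
  fix a b assume v: "v \<in> verts \<Gamma>" and a: "a \<in> carrier (Gv v)" and b: "b \<in> carrier (Gv v)"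
  have ab: "a \<otimes>\<^bsub>Gv v\<^esub> b \<in> carrier (Gv v)" using Gv_group[OF v] a b by (simp add: group.is_monoid monoid.m_closed)
  have "(elt v a @ elt v b, elt v (a \<otimes>\<^bsub>Gv v\<^esub> b)) \<in> R" using v a b unfolding fg_rels_def by blast
  moreover have "elt v a @ elt v b \<in> words X" using elt_word[OF v a] elt_word[OF v b] by simp
  ultimately show "vx v (a \<otimes>\<^bsub>Gv v\<^esub> b) = vx v a \<otimes>\<^bsub>G\<^esub> vx v b"
    using word_class_rel[OF _ _ elt_word[OF v ab]] word_class_mult[OF elt_word[OF v a] elt_word[OF v b]]
    by (simp add: vx_def)
qed (rule vx_closed)

lemma vx_mult: "v \<in> verts \<Gamma> \<Longrightarrow> a \<in> carrier (Gv v) \<Longrightarrow> b \<in> carrier (Gv v) \<Longrightarrow>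
    vx v a \<otimes>\<^bsub>G\<^esub> vx v b = vx v (a \<otimes>\<^bsub>Gv v\<^esub> b)"
  using hom_mult[OF vx_hom] by simp

lemma vx_one: "v \<in> verts \<Gamma> \<Longrightarrow> vx v \<one>\<^bsub>Gv v\<^esub> = \<one>\<^bsub>G\<^esub>"
  using hom_one[OF vx_hom Gv_group] G.is_group by blast

lemma st_closed: "e \<in> arcs \<Gamma> \<Longrightarrow> st e \<in> carrier G"
  using arcs_Ep(1)[of e] word_class_closed[OF stable_word(1)] by (auto simp: st_def)

lemma st_arev: "e \<in> arcs \<Gamma> \<Longrightarrow> st (arev e) = inv\<^bsub>G\<^esub> st e"
  using arcs_Ep[of e] arcs_Ep(2)[of "arev e"] word_class_closed[OF stable_word(1)] arev_arev'[of e]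
  by (auto simp: st_def)

lemma st_rel_pos:
  assumes e: "e \<in> Ep" and c: "c \<in> carrier (Ge e)"
  shows "st e \<otimes>\<^bsub>G\<^esub> vx (head \<Gamma> e) (\<alpha> (arev e) c) \<otimes>\<^bsub>G\<^esub> inv\<^bsub>G\<^esub> st e = vx (tail \<Gamma> e) (\<alpha> e c)"
proof -
  have eG: "e \<in> arcs \<Gamma>" using arcs_Ep e by blast
  have h: "elt (head \<Gamma> e) (\<alpha> (arev e) c) \<in> words X" and t: "elt (tail \<Gamma> e) (\<alpha> e c) \<in> words X"
    using elt_word[OF _ \<omega>_closed[OF eG c]] elt_word[OF _ \<alpha>_closed[OF eG c]] eG by auto
  have s: "stable e @ elt (head \<Gamma> e) (\<alpha> (arev e) c) \<in> words X" using h stable_word[OF e] by simp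
  have "(stable e @ elt (head \<Gamma> e) (\<alpha> (arev e) c) @ stable_inv e, elt (tail \<Gamma> e) (\<alpha> e c)) \<in> R"
    using e c unfolding fg_rels_def by blast
  then have "word_class (stable e @ elt (head \<Gamma> e) (\<alpha> (arev e) c) @ stable_inv e) = vx (tail \<Gamma> e) (\<alpha> e c)"
    unfolding vx_def by (rule word_class_rel) (use h t stable_word[OF e] in simp_all)
  moreover have "st e = word_class (stable e)" using e by (simp add: st_def)
  moreover have "inv\<^bsub>G\<^esub> st e = word_class (stable_inv e)"
    using word_class_inv[of "Stable e"] e by (simp add: st_def fg_gens_def)
  ultimately show ?thesis
    using word_class_mult[OF stable_word(1)[OF e] h] word_class_mult[OF s stable_word(2)[OF e]]
    by (simp add: vx_def)
qed

lemma st_rel: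
  assumes e: "e \<in> arcs \<Gamma>" and c: "c \<in> carrier (Ge e)"
  shows "st e \<otimes>\<^bsub>G\<^esub> vx (head \<Gamma> e) (\<alpha> (arev e) c) \<otimes>\<^bsub>G\<^esub> inv\<^bsub>G\<^esub> st e = vx (tail \<Gamma> e) (\<alpha> e c)"
proof (cases "e \<in> Ep")
  case True then show ?thesis using st_rel_pos c by blast
next
  case False
  then have r: "arev e \<in> Ep" using arcs_Ep e by blast
  have rel: "st (arev e) \<otimes>\<^bsub>G\<^esub> vx (tail \<Gamma> e) (\<alpha> e c) \<otimes>\<^bsub>G\<^esub> inv\<^bsub>G\<^esub> st (arev e) = vx (head \<Gamma> e) (\<alpha> (arev e) c)"
    using st_rel_pos[OF r] c Ge_arev[OF e] e by (simp add: arev_arev')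
  have cl: "st e \<in> carrier G" "vx (tail \<Gamma> e) (\<alpha> e c) \<in> carrier G"
    using st_closed e vx_closed \<alpha>_closed[OF e c] by auto
  show ?thesis unfolding rel[symmetric] st_arev[OF e] using cl
    by (simp add: G.m_assoc) (simp flip: G.m_assoc)
qed

lemma st_tree:
  assumes "e \<in> arcs T" shows "st e = \<one>\<^bsub>G\<^esub>"
proof -
  have pos: "st f = \<one>\<^bsub>G\<^esub>" if "f \<in> arcs T" "f \<in> Ep" for f
  proof -
    have "(stable f, []) \<in> R" using that unfolding fg_rels_def by blast
    then have "word_class (stable f) = word_class []" by (rule word_class_rel) (use stable_word that in simp_all)
    then show ?thesis using that word_class_Nil by (simp add: st_def)
  qed
  show ?thesis
  proof (cases "e \<in> Ep")
    case False
    then have "arev e \<in> Ep" "arev e \<in> arcs T" using assms arcs_T arcs_Ep by blast+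
    then have "inv\<^bsub>G\<^esub> st e = \<one>\<^bsub>G\<^esub>" using pos st_arev arcs_T(1)[OF assms] by metis
    then show ?thesis using st_closed arcs_T(1)[OF assms] by (metis G.inv_inv G.inv_one)
  qed (use pos assms in blast)
qed

text \<open>Inverse letters are covered by the last two cases: the inverse of a vertex element is a
  vertex element, and that of \<open>st e\<close> is \<open>st (arev e)\<close>.\<close>

lemma fundamental_group_induct:
  assumes g: "g \<in> carrier G" and one: "P \<one>\<^bsub>G\<^esub>"
    and mult: "\<And>g h. \<lbrakk>g \<in> carrier G; h \<in> carrier G; P g; P h\<rbrakk> \<Longrightarrow> P (g \<otimes>\<^bsub>G\<^esub> h)"
    and vx: "\<And>v a. \<lbrakk>v \<in> verts \<Gamma>; a \<in> carrier (Gv v)\<rbrakk> \<Longrightarrow> P (vx v a)"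
    and st: "\<And>e. e \<in> arcs \<Gamma> \<Longrightarrow> P (st e)"
  shows "P g"
proof -
  obtain w where w: "w \<in> words X" "g = word_class w"
    using g by (auto simp: fundamental_group_def presented_group_def elim!: quotientE)
  have "P (word_class w)" using w(1)
  proof (induction w)
    case Nil then show ?case using one word_class_Nil by simp
  next
    case (Cons l w)
    obtain b x where l: "l = (b, x)" by force
    have x: "x \<in> X" and lw: "[l] \<in> words X" using Cons.hyps l by auto
    have "P (word_class [l])"
    proof (cases x)
      case (Elt v a)
      then have va: "v \<in> verts \<Gamma>" "a \<in> carrier (Gv v)" using x by (auto simp: fg_gens_def)
      interpret V: group "Gv v" using Gv_group va(1) .
      interpret h: group_hom "Gv v" G "vx v"
        using vx_hom[OF va(1)] by unfold_locales
      have "word_class [(False, x)] = vx v (inv\<^bsub>Gv v\<^esub> a)"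
        using word_class_inv[OF x] h.hom_inv[OF va(2)] by (simp add: Elt vx_def)
      then show ?thesis using vx[OF va] vx[OF va(1) V.inv_closed[OF va(2)]] l by (cases b) (simp_all add: Elt vx_def)
    next
      case (Stable e)
      then have e: "e \<in> Ep" using x by (auto simp: fg_gens_def)
      then have eG: "e \<in> arcs \<Gamma>" "arev e \<in> arcs \<Gamma>" using arcs_Ep(1) by auto
      have "word_class [(False, x)] = st (arev e)"
        using word_class_inv[OF x] st_arev[OF eG(1)] e by (simp add: Stable st_def)
      then show ?thesis using st[OF eG(1)] st[OF eG(2)] l e by (cases b) (simp_all add: Stable st_def)
    qed
    then have "P (word_class [l] \<otimes>\<^bsub>G\<^esub> word_class w)"
      using mult word_class_closed lw Cons.hyps Cons.IH by blast
    then show ?case using word_class_mult[OF lw Cons.hyps(2)] by simp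
  qed
  then show ?thesis using w by simp
qed

lemma fundamental_group_universal:
  assumes W: "group W" and F: "\<And>v. v \<in> verts \<Gamma> \<Longrightarrow> F v \<in> hom (Gv v) W"
    and S: "\<And>e. e \<in> Ep \<Longrightarrow> S e \<in> carrier W"
    and rel: "\<And>e c. \<lbrakk>e \<in> Ep; c \<in> carrier (Ge e)\<rbrakk> \<Longrightarrow>
      S e \<otimes>\<^bsub>W\<^esub> F (head \<Gamma> e) (\<alpha> (arev e) c) \<otimes>\<^bsub>W\<^esub> inv\<^bsub>W\<^esub> S e = F (tail \<Gamma> e) (\<alpha> e c)"
    and tree: "\<And>e. \<lbrakk>e \<in> Ep; e \<in> arcs T\<rbrakk> \<Longrightarrow> S e = \<one>\<^bsub>W\<^esub>"
  obtains \<Phi> where "\<Phi> \<in> hom G W"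
    "\<And>v a. \<lbrakk>v \<in> verts \<Gamma>; a \<in> carrier (Gv v)\<rbrakk> \<Longrightarrow> \<Phi> (vx v a) = F v a"
    "\<And>e. e \<in> Ep \<Longrightarrow> \<Phi> (st e) = S e"
proof -
  interpret W: group W by fact
  define \<phi> where "\<phi> x = (case x of Elt v a \<Rightarrow> F v a | Stable e \<Rightarrow> S e)" for x
  have Fc: "F v a \<in> carrier W" if "v \<in> verts \<Gamma>" "a \<in> carrier (Gv v)" for v a
    using F[OF that(1)] that(2) by (auto simp: hom_def)
  have \<phi>: "\<phi> x \<in> carrier W" if "x \<in> X" for x
    using that Fc S by (auto simp: fg_gens_def \<phi>_def)
  have "word_eval W \<phi> u = word_eval W \<phi> v" if "(u, v) \<in> R" for u v
    using that unfolding fg_rels_def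
  proof (elim UnE CollectE exE conjE)
    fix v' a b assume "v' \<in> verts \<Gamma>" "a \<in> carrier (Gv v')" "b \<in> carrier (Gv v')"
      "(u, v) = (elt v' a @ elt v' b, elt v' (a \<otimes>\<^bsub>Gv v'\<^esub> b))"
    then show ?thesis using F[of v'] Fc Gv_group[of v'] by (simp add: \<phi>_def hom_mult group.is_monoid monoid.m_closed)
  next
    fix e c assume e: "e \<in> Ep" and c: "c \<in> carrier (Ge e)"
      and uv: "(u, v) = (stable e @ elt (head \<Gamma> e) (\<alpha> (arev e) c) @ stable_inv e, elt (tail \<Gamma> e) (\<alpha> e c))"
    have eG: "e \<in> arcs \<Gamma>" using e arcs_Ep by blast
    have "F (head \<Gamma> e) (\<alpha> (arev e) c) \<in> carrier W" "F (tail \<Gamma> e) (\<alpha> e c) \<in> carrier W"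
      using Fc \<alpha>_closed[OF eG c] \<omega>_closed[OF eG c] eG by auto
    then show ?thesis using uv rel[OF e c] S[OF e] by (simp add: \<phi>_def W.m_assoc)
  next
    fix f assume "(u, v) = (stable f, [])" "f \<in> arcs T \<inter> Ep"
    then show ?thesis using tree by (simp add: \<phi>_def)
  qed
  then obtain \<Phi> where \<Phi>: "\<Phi> \<in> hom G W" "\<And>w. w \<in> words X \<Longrightarrow> \<Phi> (word_class w) = word_eval W \<phi> w"
    using W.presented_group_universal[of X \<phi> R, OF \<phi>] unfolding fundamental_group_def by metis
  show ?thesis
  proof (rule that[OF \<Phi>(1)])
    show "\<Phi> (vx v a) = F v a" if "v \<in> verts \<Gamma>" "a \<in> carrier (Gv v)" for v a
      using \<Phi>(2)[OF elt_word[OF that]] Fc[OF that] by (simp add: vx_def \<phi>_def)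
    show "\<Phi> (st e) = S e" if "e \<in> Ep" for e
      using \<Phi>(2)[OF stable_word(1)[OF that]] S[OF that] that by (simp add: st_def \<phi>_def)
  qed
qed

section \<open>Path words and their cyclic reduction\<close>

fun path_word :: "'v \<Rightarrow> ('e \<times> 'a) list \<Rightarrow> 'v \<Rightarrow> bool" where
  "path_word u [] v \<longleftrightarrow> u = v \<and> u \<in> verts \<Gamma>"
| "path_word u ((e, x) # ps) v \<longleftrightarrow>
     e \<in> arcs \<Gamma> \<and> tail \<Gamma> e = u \<and> x \<in> carrier (Gv (head \<Gamma> e)) \<and> path_word (head \<Gamma> e) ps v"

fun path_eval :: "('e \<times> 'a) list \<Rightarrow> ('v, 'e, 'a) fg_gen word set" where
  "path_eval [] = \<one>\<^bsub>G\<^esub>"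
| "path_eval ((e, x) # ps) = st e \<otimes>\<^bsub>G\<^esub> vx (head \<Gamma> e) x \<otimes>\<^bsub>G\<^esub> path_eval ps"

text \<open>For a closed path \<open>e\<^sub>1 x\<^sub>1 \<dots> e\<^sub>n x\<^sub>n\<close>, indices being taken modulo \<open>n\<close>.\<close>

definition cyclically_reduced :: "('e \<times> 'a) list \<Rightarrow> bool" where
  "cyclically_reduced ps \<longleftrightarrow> (\<forall>j<length ps.
     fst (ps ! (Suc j mod length ps)) = arev (fst (ps ! j)) \<longrightarrow>
     snd (ps ! j) \<notin> \<alpha> (arev (fst (ps ! j))) ` carrier (Ge (fst (ps ! j))))"

lemma path_word_verts: "path_word u ps v \<Longrightarrow> u \<in> verts \<Gamma> \<and> v \<in> verts \<Gamma>"
  by (induction u ps v rule: path_word.induct) auto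

lemma path_word_append: "path_word u (ps @ qs) w \<longleftrightarrow> (\<exists>v. path_word u ps v \<and> path_word v qs w)"
proof (induction ps arbitrary: u)
  case Nil then show ?case using path_word_verts by auto
next
  case (Cons p ps) then show ?case by (cases p) auto
qed

lemma path_eval_closed: "path_word u ps v \<Longrightarrow> path_eval ps \<in> carrier G"
  by (induction u ps v rule: path_word.induct) (auto simp: st_closed vx_closed)

lemma path_eval_append:
  "path_word u ps v \<Longrightarrow> path_word v qs w \<Longrightarrow> path_eval (ps @ qs) = path_eval ps \<otimes>\<^bsub>G\<^esub> path_eval qs"
  by (induction u ps v rule: path_word.induct)
    (auto simp: G.m_assoc path_eval_closed st_closed vx_closed)

lemma path_absorb:
  assumes "path_word u ps v" "ps \<noteq> []" "y \<in> carrier (Gv v)"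
  shows "\<exists>qs. path_word u qs v \<and> length qs = length ps \<and> path_eval qs = path_eval ps \<otimes>\<^bsub>G\<^esub> vx v y"
proof -
  obtain rs e x where ps: "ps = rs @ [(e, x)]" using assms(2) by (metis rev_exhaust surj_pair)
  then obtain w where w: "path_word u rs w" "path_word w [(e, x)] v" using assms(1) path_word_append by blast
  then have v: "v = head \<Gamma> e" "e \<in> arcs \<Gamma>" "x \<in> carrier (Gv v)" "v \<in> verts \<Gamma>" "tail \<Gamma> e = w" by auto
  interpret V: group "Gv v" using Gv_group v(4) .
  have xy: "x \<otimes>\<^bsub>Gv v\<^esub> y \<in> carrier (Gv v)" using v(3) assms(3) by simp
  let ?qs = "rs @ [(e, x \<otimes>\<^bsub>Gv v\<^esub> y)]"
  have w': "path_word w [(e, x \<otimes>\<^bsub>Gv v\<^esub> y)] v" using v xy by simp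
  have "path_eval ?qs = path_eval ps \<otimes>\<^bsub>G\<^esub> vx v y"
    unfolding ps path_eval_append[OF w] path_eval_append[OF w(1) w']
    using v assms(3) path_eval_closed[OF w(1)] vx_mult[OF v(4,3) assms(3)] xy st_closed[of e] vx_closed[of v]
    by (simp add: G.m_assoc)
  moreover have "path_word u ?qs v" using w(1) w' path_word_append by blast
  ultimately show ?thesis using ps by (intro exI[of _ ?qs]) simp
qed

text \<open>A path word carries a vertex element after each edge. The one at the starting vertex is
  kept in front, because on a closed path conjugation moves it to the end.\<close>

definition path_set :: "'v \<Rightarrow> 'v \<Rightarrow> ('v, 'e, 'a) fg_gen word set set" where
  "path_set u v = {vx u x \<otimes>\<^bsub>G\<^esub> path_eval ps | x ps. x \<in> carrier (Gv u) \<and> path_word u ps v}"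

lemma path_set_mult:
  assumes "g \<in> path_set u v" "h \<in> path_set v w"
  shows "g \<otimes>\<^bsub>G\<^esub> h \<in> path_set u w"
proof -
  obtain x ps y qs where g: "x \<in> carrier (Gv u)" "path_word u ps v" "g = vx u x \<otimes>\<^bsub>G\<^esub> path_eval ps"
    and h: "y \<in> carrier (Gv v)" "path_word v qs w" "h = vx v y \<otimes>\<^bsub>G\<^esub> path_eval qs"
    using assms unfolding path_set_def by blast
  have uv: "u \<in> verts \<Gamma>" "v \<in> verts \<Gamma>" using path_word_verts[OF g(2)] by auto
  interpret U: group "Gv u" using Gv_group uv(1) .
  have cl: "vx u x \<in> carrier G" "vx v y \<in> carrier G" "path_eval ps \<in> carrier G" "path_eval qs \<in> carrier G"
    using vx_closed uv g h path_eval_closed by auto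
  show ?thesis
  proof (cases "ps = []")
    case True
    then have [simp]: "v = u" using g(2) by simp
    have "g \<otimes>\<^bsub>G\<^esub> h = vx u (x \<otimes>\<^bsub>Gv u\<^esub> y) \<otimes>\<^bsub>G\<^esub> path_eval qs"
      using g h True cl vx_mult[OF uv(1) g(1), of y] by (simp flip: G.m_assoc)
    moreover have "x \<otimes>\<^bsub>Gv u\<^esub> y \<in> carrier (Gv u)" using g h by simp
    ultimately show ?thesis using h(2) unfolding path_set_def by auto
  next
    case False
    obtain ps' where ps': "path_word u ps' v" "path_eval ps' = path_eval ps \<otimes>\<^bsub>G\<^esub> vx v y"
      using path_absorb[OF g(2) False h(1)] by blast
    have "g \<otimes>\<^bsub>G\<^esub> h = vx u x \<otimes>\<^bsub>G\<^esub> path_eval (ps' @ qs)"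
      using path_eval_append[OF ps'(1) h(2)] ps'(2) g h cl by (simp add: G.m_assoc)
    moreover have "path_word u (ps' @ qs) w" using ps'(1) h(2) path_word_append by blast
    ultimately show ?thesis using g(1) unfolding path_set_def by blast
  qed
qed

lemma path_set_vx: "v \<in> verts \<Gamma> \<Longrightarrow> a \<in> carrier (Gv v) \<Longrightarrow> vx v a \<in> path_set v v"
  unfolding path_set_def by (auto intro!: exI[of _ a] exI[of _ "[]"] simp: vx_closed)

lemma path_set_st:
  assumes "e \<in> arcs \<Gamma>" shows "st e \<in> path_set (tail \<Gamma> e) (head \<Gamma> e)"
proof -
  have v: "tail \<Gamma> e \<in> verts \<Gamma>" "head \<Gamma> e \<in> verts \<Gamma>" using assms by auto
  interpret U: group "Gv (tail \<Gamma> e)" using Gv_group v(1) .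
  interpret V: group "Gv (head \<Gamma> e)" using Gv_group v(2) .
  have "st e = vx (tail \<Gamma> e) \<one>\<^bsub>Gv (tail \<Gamma> e)\<^esub> \<otimes>\<^bsub>G\<^esub> path_eval [(e, \<one>\<^bsub>Gv (head \<Gamma> e)\<^esub>)]"
    using v st_closed[OF assms] by (simp add: vx_one)
  moreover have "path_word (tail \<Gamma> e) [(e, \<one>\<^bsub>Gv (head \<Gamma> e)\<^esub>)] (head \<Gamma> e)" using assms v by simp
  ultimately show ?thesis unfolding path_set_def by blast
qed

text \<open>Tree edges have trivial stable letters, so the tree path from u to v represents the
  identity. Multiplying by it moves any element to the chosen base vertex.\<close>

lemma path_set_one:
  assumes "u \<in> verts \<Gamma>" "v \<in> verts \<Gamma>" shows "\<one>\<^bsub>G\<^esub> \<in> path_set u v"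
proof -
  have "(u, v) \<in> {(tail \<Gamma> e, head \<Gamma> e) | e. e \<in> arcs T}\<^sup>*" using tree_built_connected[OF tree assms] .
  then show ?thesis
  proof (induction rule: rtrancl_induct)
    case base
    interpret U: group "Gv u" using Gv_group assms(1) .
    show ?case using path_set_vx[OF assms(1) U.one_closed] vx_one[OF assms(1)] by simp
  next
    case (step y z)
    then obtain e where e: "e \<in> arcs T" "y = tail \<Gamma> e" "z = head \<Gamma> e" by blast
    have "\<one>\<^bsub>G\<^esub> \<in> path_set y z" using path_set_st[OF arcs_T(1)[OF e(1)]] st_tree[OF e(1)] e by simp
    then have "\<one>\<^bsub>G\<^esub> \<otimes>\<^bsub>G\<^esub> \<one>\<^bsub>G\<^esub> \<in> path_set u z" using path_set_mult step.IH by blast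
    then show ?case by simp
  qed
qed

lemma path_set_all:
  assumes "g \<in> carrier G" "r \<in> verts \<Gamma>" shows "g \<in> path_set r r"
  using assms(1)
proof (rule fundamental_group_induct)
  have move: "g \<in> path_set r r" if g: "g \<in> path_set u v" "u \<in> verts \<Gamma>" "v \<in> verts \<Gamma>" "g \<in> carrier G" for g u v
  proof -
    have "\<one>\<^bsub>G\<^esub> \<otimes>\<^bsub>G\<^esub> g \<otimes>\<^bsub>G\<^esub> \<one>\<^bsub>G\<^esub> \<in> path_set r r"
      using path_set_mult[OF path_set_mult[OF path_set_one g(1)] path_set_one] assms(2) g by blast
    then show ?thesis using g(4) by simp
  qed
  show "vx v a \<in> path_set r r" if "v \<in> verts \<Gamma>" "a \<in> carrier (Gv v)" for v a
    using move path_set_vx that vx_closed by blast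
  show "st e \<in> path_set r r" if "e \<in> arcs \<Gamma>" for e
    using move[OF path_set_st[OF that]] that st_closed by auto
qed (use path_set_one path_set_mult assms(2) in blast)+

text \<open>Rotation is conjugation by an initial segment.\<close>

lemma path_rotate:
  assumes "path_word v ps v" "j < length ps"
  shows "\<exists>h\<in>carrier G. \<exists>w. path_word w (rotate j ps) w \<and>
    h \<otimes>\<^bsub>G\<^esub> path_eval ps \<otimes>\<^bsub>G\<^esub> inv\<^bsub>G\<^esub> h = path_eval (rotate j ps)"
proof -
  define as where "as = take j ps"
  define bs where "bs = drop j ps"
  have ps: "ps = as @ bs" by (simp add: as_def bs_def)
  have rot: "rotate j (as @ bs) = bs @ as" using assms(2) by (simp add: rotate_drop_take as_def bs_def)
  obtain w where w: "path_word v as w" "path_word w bs v" using assms(1) path_word_append unfolding ps by blast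
  have "path_word w (rotate j ps) w" unfolding ps rot using w path_word_append by blast
  moreover have "inv\<^bsub>G\<^esub> path_eval as \<otimes>\<^bsub>G\<^esub> path_eval ps \<otimes>\<^bsub>G\<^esub> inv\<^bsub>G\<^esub> (inv\<^bsub>G\<^esub> path_eval as) = path_eval (rotate j ps)"
    unfolding ps rot path_eval_append[OF w] path_eval_append[OF w(2,1)]
    using path_eval_closed[OF w(1)] path_eval_closed[OF w(2)] by (simp flip: G.m_assoc)
  ultimately show ?thesis using path_eval_closed[OF w(1)] by (intro bexI[of _ "inv\<^bsub>G\<^esub> path_eval as"]) auto
qed

definition elliptic_or_reduced :: "('v, 'e, 'a) fg_gen word set \<Rightarrow> bool" where
  "elliptic_or_reduced g \<longleftrightarrow> (\<exists>v\<in>verts \<Gamma>. (\<exists>x\<in>carrier (Gv v). g = vx v x) \<or>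
     (\<exists>ps. ps \<noteq> [] \<and> path_word v ps v \<and> cyclically_reduced ps \<and> g = path_eval ps))"

text \<open>Induction on the length. Conjugation moves x to the end of the path. If the result is
  not cyclically reduced, a rotation brings a segment e y (arev e), with y from the edge group, to
  the front, where it collapses to a vertex element. The leading factor in the statement is there to
  take up what such a collapse leaves.\<close>

lemma closed_path_conj_reduced:
  assumes "path_word v ps v" "x \<in> carrier (Gv v)" "g = vx v x \<otimes>\<^bsub>G\<^esub> path_eval ps"
  shows "\<exists>h\<in>carrier G. elliptic_or_reduced (h \<otimes>\<^bsub>G\<^esub> g \<otimes>\<^bsub>G\<^esub> inv\<^bsub>G\<^esub> h)"
  using assms
proof (induction "length ps" arbitrary: v ps x g rule: less_induct)
  case less
  have v: "v \<in> verts \<Gamma>" using path_word_verts[OF less.prems(1)] by blast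
  have xc: "vx v x \<in> carrier G" using vx_closed[OF v less.prems(2)] .
  have pc: "path_eval ps \<in> carrier G" using path_eval_closed[OF less.prems(1)] .
  show ?case
  proof (cases "ps = []")
    case True
    then have "elliptic_or_reduced g" using less.prems xc v by (auto simp: elliptic_or_reduced_def)
    then show ?thesis using less.prems xc pc by (intro bexI[of _ "\<one>\<^bsub>G\<^esub>"]) simp_all
  next
    case False
    obtain qs where qs: "path_word v qs v" "length qs = length ps" "path_eval qs = path_eval ps \<otimes>\<^bsub>G\<^esub> vx v x"
      using path_absorb[OF less.prems(1) False less.prems(2)] by blast
    have qc: "path_eval qs \<in> carrier G" using path_eval_closed[OF qs(1)] .
    have g: "g = vx v x \<otimes>\<^bsub>G\<^esub> path_eval qs \<otimes>\<^bsub>G\<^esub> inv\<^bsub>G\<^esub> vx v x"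
      using less.prems(3) qs(3) xc pc by (simp add: G.m_assoc)
    have red: "\<exists>h\<in>carrier G. elliptic_or_reduced (h \<otimes>\<^bsub>G\<^esub> path_eval qs \<otimes>\<^bsub>G\<^esub> inv\<^bsub>G\<^esub> h)"
    proof (cases "cyclically_reduced qs")
      case True
      have "qs \<noteq> []" using qs(2) False by auto
      then have "elliptic_or_reduced (path_eval qs)" using True qs(1) v by (auto simp: elliptic_or_reduced_def)
      then show ?thesis using qc by (intro bexI[of _ "\<one>\<^bsub>G\<^esub>"]) simp_all
    next
      case notred: False
      let ?n = "length qs"
      obtain j where j: "j < ?n" "fst (qs ! (Suc j mod ?n)) = arev (fst (qs ! j))"
        "snd (qs ! j) \<in> \<alpha> (arev (fst (qs ! j))) ` carrier (Ge (fst (qs ! j)))"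
        using notred unfolding cyclically_reduced_def by blast
      obtain h w where h: "h \<in> carrier G" "path_word w (rotate j qs) w"
        "h \<otimes>\<^bsub>G\<^esub> path_eval qs \<otimes>\<^bsub>G\<^esub> inv\<^bsub>G\<^esub> h = path_eval (rotate j qs)"
        using path_rotate[OF qs(1) j(1)] by blast
      obtain e y rs where r: "rotate j qs = (e, y) # rs"
        using j(1) by (cases "rotate j qs") auto
      have e0: "qs ! j = (e, y)" using nth_rotate[of 0 qs j] j(1) r by (cases "qs = []") auto
      have eG: "e \<in> arcs \<Gamma>" using h(2) r by simp
      \<comment> \<open>On a path of length one the successor of e is e itself, and e =
        \<open>arev e\<close> is impossible; so the backtracking occupies two positions.\<close>
      have "?n \<noteq> 1"
      proof
        assume "?n = 1"
        then have "e = arev e" using j e0 by simp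
        then show False using eG arev_dom by metis
      qed
      moreover have len: "length rs = ?n - 1" using arg_cong[OF r, of length] by simp
      ultimately obtain f z rs' where rs: "rs = (f, z) # rs'" using j(1) by (cases rs) auto
      have "(f, z) = qs ! (Suc j mod ?n)" using nth_rotate[of 1 qs j] j(1) r rs len by auto
      then have f: "f = arev e" using j(2) e0 by (metis fst_conv)
      obtain c where c: "c \<in> carrier (Ge e)" "y = \<alpha> (arev e) c" using j(3) e0 by auto
      have pw: "path_word w ((e, y) # (f, z) # rs') w" using h(2) r rs by simp
      then have w: "w = tail \<Gamma> e" "z \<in> carrier (Gv w)" "path_word w rs' w" "w \<in> verts \<Gamma>"
        using eG f by (auto simp: head_arev)
      interpret W: group "Gv w" using Gv_group w(4) .
      have ac: "\<alpha> e c \<in> carrier (Gv w)" using \<alpha>_closed[OF eG c(1)] w(1) by simp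
      have yc: "vx (head \<Gamma> e) y \<in> carrier G" using vx_closed[of "head \<Gamma> e" y] \<omega>_closed[OF eG c(1)] c(2) eG by simp
      have ev: "path_eval (rotate j qs) = vx w (\<alpha> e c \<otimes>\<^bsub>Gv w\<^esub> z) \<otimes>\<^bsub>G\<^esub> path_eval rs'"
      proof -
        have zc: "vx w z \<in> carrier G" "path_eval rs' \<in> carrier G"
          using vx_closed w path_eval_closed by auto
        have "path_eval (rotate j qs) = (st e \<otimes>\<^bsub>G\<^esub> vx (head \<Gamma> e) y \<otimes>\<^bsub>G\<^esub> inv\<^bsub>G\<^esub> st e) \<otimes>\<^bsub>G\<^esub> vx w z \<otimes>\<^bsub>G\<^esub> path_eval rs'"
          unfolding r rs f using eG zc yc st_closed[OF eG] st_arev[OF eG] w(1)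
          by (simp add: G.m_assoc head_arev)
        also have "\<dots> = vx w (\<alpha> e c) \<otimes>\<^bsub>G\<^esub> vx w z \<otimes>\<^bsub>G\<^esub> path_eval rs'"
          using st_rel[OF eG c(1)] c(2) w(1) by simp
        finally show ?thesis using vx_mult[OF w(4) ac w(2)] by simp
      qed
      have "length rs' < length ps" using len rs qs(2) j(1) by simp
      then obtain k where k: "k \<in> carrier G"
        "elliptic_or_reduced (k \<otimes>\<^bsub>G\<^esub> path_eval (rotate j qs) \<otimes>\<^bsub>G\<^esub> inv\<^bsub>G\<^esub> k)"
        using less.hyps[OF _ w(3) _ ev] ac w(2) by auto
      have "k \<otimes>\<^bsub>G\<^esub> path_eval (rotate j qs) \<otimes>\<^bsub>G\<^esub> inv\<^bsub>G\<^esub> k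
          = (k \<otimes>\<^bsub>G\<^esub> h) \<otimes>\<^bsub>G\<^esub> path_eval qs \<otimes>\<^bsub>G\<^esub> inv\<^bsub>G\<^esub> (k \<otimes>\<^bsub>G\<^esub> h)"
        unfolding h(3)[symmetric] using k(1) h(1) qc by (simp add: G.m_assoc G.inv_mult_group)
      then show ?thesis using k h(1) by (intro bexI[of _ "k \<otimes>\<^bsub>G\<^esub> h"]) simp_all
    qed
    then obtain h where h: "h \<in> carrier G" "elliptic_or_reduced (h \<otimes>\<^bsub>G\<^esub> path_eval qs \<otimes>\<^bsub>G\<^esub> inv\<^bsub>G\<^esub> h)" by blast
    have "(h \<otimes>\<^bsub>G\<^esub> inv\<^bsub>G\<^esub> vx v x) \<otimes>\<^bsub>G\<^esub> g \<otimes>\<^bsub>G\<^esub> inv\<^bsub>G\<^esub> (h \<otimes>\<^bsub>G\<^esub> inv\<^bsub>G\<^esub> vx v x)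
        = h \<otimes>\<^bsub>G\<^esub> (inv\<^bsub>G\<^esub> vx v x \<otimes>\<^bsub>G\<^esub> vx v x) \<otimes>\<^bsub>G\<^esub> path_eval qs \<otimes>\<^bsub>G\<^esub> (inv\<^bsub>G\<^esub> vx v x \<otimes>\<^bsub>G\<^esub> vx v x) \<otimes>\<^bsub>G\<^esub> inv\<^bsub>G\<^esub> h"
      unfolding g using h(1) xc qc
      by (simp only: G.m_assoc G.inv_mult_group G.inv_closed G.m_closed G.inv_inv)
    then show ?thesis using h xc qc by (intro bexI[of _ "h \<otimes>\<^bsub>G\<^esub> inv\<^bsub>G\<^esub> vx v x"]) simp_all
  qed
qed

lemma conj_reduced:
  assumes "g \<in> carrier G"
  shows "\<exists>h\<in>carrier G. elliptic_or_reduced (h \<otimes>\<^bsub>G\<^esub> g \<otimes>\<^bsub>G\<^esub> inv\<^bsub>G\<^esub> h)"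
proof -
  obtain r where "r \<in> verts \<Gamma>" using tree_built_subset(3)[OF tree] by blast
  then have "g \<in> path_set r r" using path_set_all assms by blast
  then show ?thesis using closed_path_conj_reduced unfolding path_set_def by blast
qed

end

section \<open>The abelian pushout along the maximal tree\<close>

lemma (in comm_group) comm_group_subgroup:
  assumes "subgroup H G" shows "comm_group (G\<lparr>carrier := H\<rparr>)"
  using assms by (intro group.group_comm_groupI) (auto simp: subgroup.subgroup_is_group subgroup.mem_carrier m_comm)

context graph_of_abelian_groups
begin

abbreviation D where "D \<equiv> product_group (verts \<Gamma>) Gv"

definition coord :: "'v \<Rightarrow> 'a \<Rightarrow> 'v \<Rightarrow> 'a" where
  "coord v x = (\<lambda>w\<in>verts \<Gamma>. if w = v then x else \<one>\<^bsub>Gv w\<^esub>)"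

definition edge_relator :: "'e \<Rightarrow> 'b \<Rightarrow> 'v \<Rightarrow> 'a" where
  "edge_relator e c = coord (tail \<Gamma> e) (\<alpha> e c) \<otimes>\<^bsub>D\<^esub> inv\<^bsub>D\<^esub> coord (head \<Gamma> e) (\<alpha> (arev e) c)"

lemma comm_D: "comm_group D"
proof (rule group.group_comm_groupI)
  show "group D" using Gv_group by simp
  fix f g assume "f \<in> carrier D" "g \<in> carrier D"
  then show "f \<otimes>\<^bsub>D\<^esub> g = g \<otimes>\<^bsub>D\<^esub> f"
    using comm_groupE(4)[OF comm_Gv] by (auto simp: PiE_iff intro!: restrict_ext)
qed

sublocale D: comm_group D by (rule comm_D)

lemma D_carrier: "f \<in> carrier D \<Longrightarrow> v \<in> verts \<Gamma> \<Longrightarrow> f v \<in> carrier (Gv v)"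
  by (auto simp: PiE_iff)

lemma D_mult: "v \<in> verts \<Gamma> \<Longrightarrow> (f \<otimes>\<^bsub>D\<^esub> g) v = f v \<otimes>\<^bsub>Gv v\<^esub> g v"
  by simp

lemma D_inv: "f \<in> carrier D \<Longrightarrow> v \<in> verts \<Gamma> \<Longrightarrow> (inv\<^bsub>D\<^esub> f) v = inv\<^bsub>Gv v\<^esub> f v"
  using Gv_group by simp

lemma D_one: "v \<in> verts \<Gamma> \<Longrightarrow> \<one>\<^bsub>D\<^esub> v = \<one>\<^bsub>Gv v\<^esub>"
  by simp

lemma D_eqI: "f \<in> carrier D \<Longrightarrow> g \<in> carrier D \<Longrightarrow> (\<And>v. v \<in> verts \<Gamma> \<Longrightarrow> f v = g v) \<Longrightarrow> f = g"
  by (auto intro: PiE_ext)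

lemma coord_closed: "v \<in> verts \<Gamma> \<Longrightarrow> x \<in> carrier (Gv v) \<Longrightarrow> coord v x \<in> carrier D"
  using Gv_group by (auto simp: coord_def group.is_monoid)

lemma coord_apply: "w \<in> verts \<Gamma> \<Longrightarrow> coord v x w = (if w = v then x else \<one>\<^bsub>Gv w\<^esub>)"
  by (simp add: coord_def)

declare carrier_product_group [simp del] one_product_group [simp del] mult_product_group [simp del]
  inv_product_group [simp del]

lemma coord_hom: "v \<in> verts \<Gamma> \<Longrightarrow> coord v \<in> hom (Gv v) D"
proof (rule homI)
  fix x y assume v: "v \<in> verts \<Gamma>" and x: "x \<in> carrier (Gv v)" and y: "y \<in> carrier (Gv v)"
  have m: "x \<otimes>\<^bsub>Gv v\<^esub> y \<in> carrier (Gv v)" using Gv_group[OF v] x y by (simp add: group.is_monoid monoid.m_closed)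
  show "coord v (x \<otimes>\<^bsub>Gv v\<^esub> y) = coord v x \<otimes>\<^bsub>D\<^esub> coord v y"
  proof (rule D_eqI)
    fix w assume w: "w \<in> verts \<Gamma>"
    interpret Gv: group "Gv w" using Gv_group w .
    show "coord v (x \<otimes>\<^bsub>Gv v\<^esub> y) w = (coord v x \<otimes>\<^bsub>D\<^esub> coord v y) w"
      using w by (simp add: D_mult coord_apply)
  qed (use coord_closed[OF v] x y m in simp_all)
qed (rule coord_closed)

lemma coord_in_carrier_edge:
  assumes "e \<in> arcs \<Gamma>" "c \<in> carrier (Ge e)"
  shows "coord (tail \<Gamma> e) (\<alpha> e c) \<in> carrier D" "coord (head \<Gamma> e) (\<alpha> (arev e) c) \<in> carrier D"
  using coord_closed \<alpha>_closed[OF assms] \<omega>_closed[OF assms] assms(1) by auto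

lemma edge_relator_hom: "e \<in> arcs \<Gamma> \<Longrightarrow> edge_relator e \<in> hom (Ge e) D"
proof (rule homI)
  fix c d assume e: "e \<in> arcs \<Gamma>" and c: "c \<in> carrier (Ge e)" and d: "d \<in> carrier (Ge e)"
  have v: "tail \<Gamma> e \<in> verts \<Gamma>" "head \<Gamma> e \<in> verts \<Gamma>" using e by auto
  show "edge_relator e (c \<otimes>\<^bsub>Ge e\<^esub> d) = edge_relator e c \<otimes>\<^bsub>D\<^esub> edge_relator e d"
    using coord_in_carrier_edge[OF e c] coord_in_carrier_edge[OF e d]
    by (simp add: edge_relator_def hom_mult[OF \<alpha>_hom[OF e] c d] hom_mult[OF \<omega>_hom[OF e] c d]
      hom_mult[OF coord_hom[OF v(1)] \<alpha>_closed[OF e c] \<alpha>_closed[OF e d]]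
      hom_mult[OF coord_hom[OF v(2)] \<omega>_closed[OF e c] \<omega>_closed[OF e d]] D.inv_mult D.m_ac)
qed (simp add: edge_relator_def coord_in_carrier_edge)

lemma edge_relator_apply:
  assumes e: "e \<in> arcs \<Gamma>" and c: "c \<in> carrier (Ge e)" and ne: "tail \<Gamma> e \<noteq> head \<Gamma> e" and v: "v \<in> verts \<Gamma>"
  shows "edge_relator e c v = (if v = tail \<Gamma> e then \<alpha> e c else if v = head \<Gamma> e then inv\<^bsub>Gv v\<^esub> \<alpha> (arev e) c else \<one>\<^bsub>Gv v\<^esub>)"
proof -
  interpret V: group "Gv v" using Gv_group v .
  interpret t: group "Gv (tail \<Gamma> e)" using Gv_group e by simp
  interpret h: group "Gv (head \<Gamma> e)" using Gv_group e by simp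
  show ?thesis
    using coord_in_carrier_edge[OF e c] \<alpha>_closed[OF e c] \<omega>_closed[OF e c] v ne
    by (auto simp: edge_relator_def D_mult D_inv coord_apply)
qed

text \<open>An element of the relation subgroup \<open>N\<close> that is supported on two vertices \<open>u\<close> and \<open>v\<close> only relates elements
  that are already identified in the fundamental group; hence the vertex groups embed in the quotient, and
  their union is not collapsed further.\<close>

definition relation_subgroup :: "'v set \<Rightarrow> 'e set \<Rightarrow> ('v \<Rightarrow> 'a) set \<Rightarrow> bool" where
  "relation_subgroup V E N \<longleftrightarrow> subgroup N D \<and>
     (\<forall>e\<in>E. \<forall>c\<in>carrier (Ge e). edge_relator e c \<in> N) \<and>
     (\<forall>f\<in>N. \<forall>w\<in>verts \<Gamma> - V. f w = \<one>\<^bsub>Gv w\<^esub>) \<and>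
     (\<forall>f\<in>N. \<forall>u\<in>V. (\<forall>w\<in>V. w \<noteq> u \<longrightarrow> f w = \<one>\<^bsub>Gv w\<^esub>) \<longrightarrow> f u = \<one>\<^bsub>Gv u\<^esub>) \<and>
     (\<forall>f\<in>N. \<forall>u\<in>V. \<forall>v\<in>V. u \<noteq> v \<longrightarrow> (\<forall>w\<in>V. w \<noteq> u \<and> w \<noteq> v \<longrightarrow> f w = \<one>\<^bsub>Gv w\<^esub>) \<longrightarrow>
        vx u (f u) = inv\<^bsub>G\<^esub> vx v (f v))"

lemma relation_subgroupD:
  assumes "relation_subgroup V E N"
  shows "subgroup N D" "\<And>f c. \<lbrakk>f \<in> E; c \<in> carrier (Ge f)\<rbrakk> \<Longrightarrow> edge_relator f c \<in> N"
    "\<And>f w. \<lbrakk>f \<in> N; w \<in> verts \<Gamma>; w \<notin> V\<rbrakk> \<Longrightarrow> f w = \<one>\<^bsub>Gv w\<^esub>"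
    "\<And>f u. \<lbrakk>f \<in> N; u \<in> V; \<And>w. \<lbrakk>w \<in> V; w \<noteq> u\<rbrakk> \<Longrightarrow> f w = \<one>\<^bsub>Gv w\<^esub>\<rbrakk> \<Longrightarrow> f u = \<one>\<^bsub>Gv u\<^esub>"
    "\<And>f u v. \<lbrakk>f \<in> N; u \<in> V; v \<in> V; u \<noteq> v; \<And>w. \<lbrakk>w \<in> V; w \<noteq> u; w \<noteq> v\<rbrakk> \<Longrightarrow> f w = \<one>\<^bsub>Gv w\<^esub>\<rbrakk> \<Longrightarrow>
      vx u (f u) = inv\<^bsub>G\<^esub> vx v (f v)"
proof -
  note rs = assms[unfolded relation_subgroup_def]
  show "subgroup N D" using rs by (rule conjunct1)
  show "edge_relator f c \<in> N" if "f \<in> E" "c \<in> carrier (Ge f)" for f c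
    using rs[THEN conjunct2, THEN conjunct1] that by blast
  show "f w = \<one>\<^bsub>Gv w\<^esub>" if "f \<in> N" "w \<in> verts \<Gamma>" "w \<notin> V" for f w
    using rs[THEN conjunct2, THEN conjunct2, THEN conjunct1] that by blast
  show "f u = \<one>\<^bsub>Gv u\<^esub>" if "f \<in> N" "u \<in> V" "\<And>w. \<lbrakk>w \<in> V; w \<noteq> u\<rbrakk> \<Longrightarrow> f w = \<one>\<^bsub>Gv w\<^esub>" for f u
    using rs[THEN conjunct2, THEN conjunct2, THEN conjunct2, THEN conjunct1, THEN bspec, OF that(1), THEN bspec, OF that(2)]
      that(3) by simp
  show "vx u (f u) = inv\<^bsub>G\<^esub> vx v (f v)"
    if "f \<in> N" "u \<in> V" "v \<in> V" "u \<noteq> v" "\<And>w. \<lbrakk>w \<in> V; w \<noteq> u; w \<noteq> v\<rbrakk> \<Longrightarrow> f w = \<one>\<^bsub>Gv w\<^esub>" for f u v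
    using rs[THEN conjunct2, THEN conjunct2, THEN conjunct2, THEN conjunct2, THEN bspec, OF that(1), THEN bspec, OF that(2),
      THEN bspec, OF that(3)] that(4,5) by simp
qed

text \<open>Attach the leaf \<open>?w\<close> along e and multiply N by the relators of e. As both
  edge maps are injective, the coordinate at the leaf determines the edge element c, so an element
  of \<open>N'\<close> that is trivial at the leaf already lies in N.\<close>

lemma relation_subgroup_exists:
  assumes "tree_built \<Gamma> arev V E" "E \<subseteq> arcs T"
  shows "\<exists>N. relation_subgroup V E N"
  using assms
proof induction
  case (root r)
  have "relation_subgroup {r} {} {\<one>\<^bsub>D\<^esub>}"
    unfolding relation_subgroup_def using D.triv_subgroup root by (auto simp: D_one)
  then show ?case by blast
next
  case (leaf V E e)
  let ?w = "head \<Gamma> e" and ?u = "tail \<Gamma> e"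
  note sub = tree_built_subset[OF leaf.hyps(1)]
  have e: "e \<in> arcs \<Gamma>" by (rule leaf.hyps(2))
  have eT: "e \<in> arcs T" "E \<subseteq> arcs T" using leaf.prems by auto
  have ne: "?u \<noteq> ?w" using leaf.hyps by auto
  have vw: "?w \<in> verts \<Gamma>" "?u \<in> verts \<Gamma>" using e by auto
  obtain N where "relation_subgroup V E N" using leaf.IH eT by blast
  note N = relation_subgroupD(1,2)[OF this] and supp = relation_subgroupD(3)[OF this]
    and one = relation_subgroupD(4)[OF this] and two = relation_subgroupD(5)[OF this]
  interpret Ge: group "Ge e" using group_Ge e .
  interpret r: group_hom "Ge e" D "edge_relator e" using edge_relator_hom[OF e] by unfold_locales
  interpret a: group_hom "Ge e" "Gv ?u" "\<alpha> e" using \<alpha>_hom[OF e] Gv_group[OF vw(2)]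
    by (simp add: group_hom_def group_hom_axioms_def Ge.is_group)
  interpret o: group_hom "Ge e" "Gv ?w" "\<alpha> (arev e)" using \<omega>_hom[OF e] Gv_group[OF vw(1)]
    by (simp add: group_hom_def group_hom_axioms_def Ge.is_group)
  define S where "S = edge_relator e ` carrier (Ge e)"
  have S: "subgroup S D" unfolding S_def by (rule r.img_is_subgroup)
  define N' where "N' = N <#>\<^bsub>D\<^esub> S"
  have N': "subgroup N' D" unfolding N'_def by (rule D.mult_subgroups[OF N(1) S])
  have Nc: "f \<in> carrier D" if "f \<in> N" for f using N(1) that by (rule subgroup.mem_carrier)
  have SN: "S \<subseteq> N'" "N \<subseteq> N'"
  proof -
    have "\<one>\<^bsub>D\<^esub> \<otimes>\<^bsub>D\<^esub> s \<in> N'" if "s \<in> S" for s unfolding N'_def set_mult_def using subgroup.one_closed[OF N(1)] that by blast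
    then show "S \<subseteq> N'" using subgroup.mem_carrier[OF S] by fastforce
    have "f \<otimes>\<^bsub>D\<^esub> \<one>\<^bsub>D\<^esub> \<in> N'" if "f \<in> N" for f unfolding N'_def set_mult_def using subgroup.one_closed[OF S] that by blast
    then show "N \<subseteq> N'" using Nc by fastforce
  qed
  \<comment> \<open>In a product of g from N with the relator of c, the leaf sees only c, the vertex
    \<open>?u\<close> sees both factors, and every other vertex sees only g.\<close>
  have split: "\<exists>g\<in>N. \<exists>c\<in>carrier (Ge e). f ?w = inv\<^bsub>Gv ?w\<^esub> \<alpha> (arev e) c \<and> f ?u = g ?u \<otimes>\<^bsub>Gv ?u\<^esub> \<alpha> e c \<and>
      (\<forall>v\<in>verts \<Gamma>. v \<noteq> ?w \<longrightarrow> v \<noteq> ?u \<longrightarrow> f v = g v) \<and> (c = \<one>\<^bsub>Ge e\<^esub> \<longrightarrow> f = g)" if f: "f \<in> N'" for f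
  proof -
    obtain g c where g: "g \<in> N" "c \<in> carrier (Ge e)" "f = g \<otimes>\<^bsub>D\<^esub> edge_relator e c"
      using f unfolding N'_def S_def set_mult_def by blast
    have gv: "g v \<in> carrier (Gv v)" "group (Gv v)" if "v \<in> verts \<Gamma>" for v
      using D_carrier[OF Nc[OF g(1)]] Gv_group that by blast+
    have "f ?w = inv\<^bsub>Gv ?w\<^esub> \<alpha> (arev e) c"
      using supp[OF g(1) vw(1)] leaf.hyps(4) ne o.hom_closed[OF g(2)]
      by (simp add: g(3) D_mult[OF vw(1)] edge_relator_apply[OF e g(2) ne vw(1)])
    moreover have "f ?u = g ?u \<otimes>\<^bsub>Gv ?u\<^esub> \<alpha> e c"
      by (simp add: g(3) D_mult[OF vw(2)] edge_relator_apply[OF e g(2) ne vw(2)])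
    moreover have "f v = g v" if "v \<in> verts \<Gamma>" "v \<noteq> ?w" "v \<noteq> ?u" for v
      using gv[OF that(1)] that by (simp add: g(3) D_mult edge_relator_apply[OF e g(2) ne] group.is_monoid monoid.r_one)
    moreover have "f = g" if "c = \<one>\<^bsub>Ge e\<^esub>" using that Nc[OF g(1)] by (simp add: g(3))
    ultimately show ?thesis using g(1,2) by blast
  qed
  have glue: "vx ?u (\<alpha> e c) = vx ?w (\<alpha> (arev e) c)" if "c \<in> carrier (Ge e)" for c
    using st_rel[OF e that] st_tree[OF eT(1)] vx_closed[OF vw(1) \<omega>_closed[OF e that]] by simp
  have trivial: "c = \<one>\<^bsub>Ge e\<^esub>" if "c \<in> carrier (Ge e)" "\<alpha> (arev e) c = \<one>\<^bsub>Gv ?w\<^esub> \<or> \<alpha> e c = \<one>\<^bsub>Gv ?u\<^esub>" for c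
    using that \<alpha>_inj[OF e] \<omega>_inj[OF e] a.hom_one o.hom_one Ge.one_closed
    by (metis inj_onD)
  \<comment> \<open>Here f is supported on u and the leaf. The gluing along e moves the leaf
    coordinate to \<open>?u\<close>; if u is another vertex, then g is supported on u and
    \<open>?u\<close>, and the property of N moves it on to u.\<close>
  have leafcase: "vx u (f u) = inv\<^bsub>G\<^esub> vx ?w (f ?w)"
    if f: "f \<in> N'" and u: "u \<in> V" and out: "\<And>v. v \<in> V \<Longrightarrow> v \<noteq> u \<Longrightarrow> f v = \<one>\<^bsub>Gv v\<^esub>" for f u
  proof -
    obtain g c where g: "g \<in> N" "c \<in> carrier (Ge e)" "f ?w = inv\<^bsub>Gv ?w\<^esub> \<alpha> (arev e) c"
      "f ?u = g ?u \<otimes>\<^bsub>Gv ?u\<^esub> \<alpha> e c" "\<And>v. v \<in> verts \<Gamma> \<Longrightarrow> v \<noteq> ?w \<Longrightarrow> v \<noteq> ?u \<Longrightarrow> f v = g v"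
      using split[OF f] by blast
    have Vv: "v \<in> verts \<Gamma>" "v \<noteq> ?w" if "v \<in> V" for v using that sub(1) leaf.hyps(4) by auto
    interpret vw: group_hom "Gv ?w" G "vx ?w" using vx_hom[OF vw(1)] by unfold_locales
    interpret vu: group_hom "Gv ?u" G "vx ?u" using vx_hom[OF vw(2)] by unfold_locales
    have fw: "inv\<^bsub>G\<^esub> vx ?w (f ?w) = vx ?u (\<alpha> e c)"
      using glue[OF g(2)] o.hom_closed[OF g(2)] by (simp add: g(3))
    have gu: "g ?u \<in> carrier (Gv ?u)" using D_carrier[OF Nc[OF g(1)] vw(2)] .
    show ?thesis
    proof (cases "u = ?u")
      case True
      have "g ?u = \<one>\<^bsub>Gv ?u\<^esub>" using one[OF g(1) leaf.hyps(3)] out g(5) Vv True by metis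
      then show ?thesis using fw g(4) True a.hom_closed[OF g(2)] by simp
    next
      case False
      have "f ?u = \<one>\<^bsub>Gv ?u\<^esub>" using out leaf.hyps(3) False by blast
      then have gi: "g ?u = inv\<^bsub>Gv ?u\<^esub> \<alpha> e c"
        using g(4) gu a.hom_closed[OF g(2)] by (metis a.H.inv_equality)
      have "vx u (g u) = inv\<^bsub>G\<^esub> vx ?u (g ?u)"
        by (rule two[OF g(1) u leaf.hyps(3) False]) (metis g(5) out Vv)
      also have "\<dots> = vx ?u (\<alpha> e c)" using gi a.hom_closed[OF g(2)] by simp
      finally show ?thesis using fw g(5) Vv u False by metis
    qed
  qed
  have "relation_subgroup (insert ?w V) (insert e (insert (arev e) E)) N'"
    unfolding relation_subgroup_def
  proof (intro conjI ballI impI)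
    show "subgroup N' D" by (rule N')
  next
    fix f c assume f: "f \<in> insert e (insert (arev e) E)" and c: "c \<in> carrier (Ge f)"
    have er: "edge_relator e d \<in> N'" if "d \<in> carrier (Ge e)" for d using that SN(1) by (auto simp: S_def)
    have "edge_relator (arev e) d \<in> N'" if d: "d \<in> carrier (Ge e)" for d
    proof -
      have "edge_relator (arev e) d = inv\<^bsub>D\<^esub> edge_relator e d"
        using coord_in_carrier_edge[OF e d] e
        by (simp add: edge_relator_def arev_arev' D.inv_mult D.m_comm)
      then show ?thesis using er[OF d] subgroup.m_inv_closed[OF N'] by simp
    qed
    then show "edge_relator f c \<in> N'" using f c er N(2) SN(2) Ge_arev[OF e] by auto
  next
    fix f w assume f: "f \<in> N'" and w: "w \<in> verts \<Gamma> - insert ?w V"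
    obtain g where g: "g \<in> N" "\<And>v. v \<in> verts \<Gamma> \<Longrightarrow> v \<noteq> ?w \<Longrightarrow> v \<noteq> ?u \<Longrightarrow> f v = g v" using split[OF f] by blast
    have "w \<noteq> ?u" "w \<noteq> ?w" "w \<notin> V" "w \<in> verts \<Gamma>" using w leaf.hyps(3) by auto
    then show "f w = \<one>\<^bsub>Gv w\<^esub>" using g supp by metis
  next
    fix f u assume f: "f \<in> N'" and u: "u \<in> insert ?w V" and out: "\<forall>w\<in>insert ?w V. w \<noteq> u \<longrightarrow> f w = \<one>\<^bsub>Gv w\<^esub>"
    obtain g c where g: "g \<in> N" "c \<in> carrier (Ge e)" "f ?w = inv\<^bsub>Gv ?w\<^esub> \<alpha> (arev e) c"
      "f ?u = g ?u \<otimes>\<^bsub>Gv ?u\<^esub> \<alpha> e c" "\<And>v. v \<in> verts \<Gamma> \<Longrightarrow> v \<noteq> ?w \<Longrightarrow> v \<noteq> ?u \<Longrightarrow> f v = g v"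
      "c = \<one>\<^bsub>Ge e\<^esub> \<Longrightarrow> f = g"
      using split[OF f] by blast
    have Vv: "v \<in> verts \<Gamma>" "v \<noteq> ?w" if "v \<in> V" for v using that sub(1) leaf.hyps(4) by auto
    show "f u = \<one>\<^bsub>Gv u\<^esub>"
    proof (cases "u = ?w")
      case True
      have fu: "f ?u = \<one>\<^bsub>Gv ?u\<^esub>" using out leaf.hyps(3) True ne by auto
      have "g ?u = \<one>\<^bsub>Gv ?u\<^esub>" using one[OF g(1) leaf.hyps(3)] out g(5) Vv True by (metis insertCI)
      then have "\<alpha> e c = \<one>\<^bsub>Gv ?u\<^esub>" using fu g(4) a.hom_closed[OF g(2)] by simp
      then show ?thesis using trivial[OF g(2)] g(3) True by simp
    next
      case False
      then have "inv\<^bsub>Gv ?w\<^esub> \<alpha> (arev e) c = \<one>\<^bsub>Gv ?w\<^esub>" using out g(3) by auto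
      then have "\<alpha> (arev e) c = \<one>\<^bsub>Gv ?w\<^esub>" using o.hom_closed[OF g(2)] by (metis o.H.inv_inv o.H.inv_one)
      then have "f = g" using g(6) trivial[OF g(2)] by blast
      then show ?thesis using one[OF g(1)] u out False by blast
    qed
  next
    fix f u v assume f: "f \<in> N'" and u: "u \<in> insert ?w V" and v: "v \<in> insert ?w V" and uv: "u \<noteq> v"
      and out: "\<forall>w\<in>insert ?w V. w \<noteq> u \<and> w \<noteq> v \<longrightarrow> f w = \<one>\<^bsub>Gv w\<^esub>"
    obtain g c where g: "g \<in> N" "c \<in> carrier (Ge e)" "f ?w = inv\<^bsub>Gv ?w\<^esub> \<alpha> (arev e) c" "c = \<one>\<^bsub>Ge e\<^esub> \<Longrightarrow> f = g"
      using split[OF f] by blast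
    have fc: "f \<in> carrier D" using subgroup.mem_carrier[OF N' f] .
    consider "v = ?w" | "u = ?w" | "u \<noteq> ?w" "v \<noteq> ?w" by blast
    then show "vx u (f u) = inv\<^bsub>G\<^esub> vx v (f v)"
    proof cases
      case 1
      then show ?thesis using leafcase[OF f, of u] u uv out leaf.hyps(4) by auto
    next
      case 2
      then have vV: "v \<in> V" using v uv by blast
      have "vx v (f v) = inv\<^bsub>G\<^esub> vx ?w (f ?w)" 
      proof (rule leafcase[OF f vV])
        fix z assume "z \<in> V" "z \<noteq> v"
        then show "f z = \<one>\<^bsub>Gv z\<^esub>" using out 2 leaf.hyps(4) by auto
      qed
      then show ?thesis using vx_closed[OF vw(1) D_carrier[OF fc vw(1)]] 2 by simp
    next
      case 3
      then have "inv\<^bsub>Gv ?w\<^esub> \<alpha> (arev e) c = \<one>\<^bsub>Gv ?w\<^esub>" using out g(3) by auto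
      then have "\<alpha> (arev e) c = \<one>\<^bsub>Gv ?w\<^esub>" using o.hom_closed[OF g(2)] by (metis o.H.inv_inv o.H.inv_one)
      then have "f = g" using g(4) trivial[OF g(2)] by blast
      then show ?thesis using two[OF g(1), of u v] u v uv out 3 by blast
    qed
  qed
  then show ?case by blast
qed

text \<open>P is the subgroup of \<open>D Mod N\<close> generated by the images of the vertex
  groups, which makes it finitely generated by construction. Two vertex elements with equal images
  differ by an element of N supported on at most two vertices, where the defining properties of N
  apply.\<close>

lemma abelian_pushout:
  obtains P :: "('v \<Rightarrow> 'a) set monoid" and \<iota> :: "'v \<Rightarrow> 'a \<Rightarrow> ('v \<Rightarrow> 'a) set"
  where "comm_group P" "finitely_generated P"
    "\<And>v. v \<in> verts \<Gamma> \<Longrightarrow> \<iota> v \<in> hom (Gv v) P"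
    "\<And>v. v \<in> verts \<Gamma> \<Longrightarrow> inj_on (\<iota> v) (carrier (Gv v))"
    "\<And>e c. e \<in> arcs T \<Longrightarrow> c \<in> carrier (Ge e) \<Longrightarrow> \<iota> (tail \<Gamma> e) (\<alpha> e c) = \<iota> (head \<Gamma> e) (\<alpha> (arev e) c)"
    "\<And>u v x y. \<lbrakk>u \<in> verts \<Gamma>; v \<in> verts \<Gamma>; x \<in> carrier (Gv u); y \<in> carrier (Gv v); \<iota> u x = \<iota> v y\<rbrakk> \<Longrightarrow> vx u x = vx v y"
proof -
  obtain N where "relation_subgroup (verts \<Gamma>) (arcs T) N"
    using relation_subgroup_exists[OF tree] by blast
  note N = relation_subgroupD(1,2)[OF this] and one = relation_subgroupD(4)[OF this]
    and two = relation_subgroupD(5)[OF this]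
  interpret N: normal N D using D.subgroup_imp_normal[OF N(1)] .
  let ?Q = "D Mod N"
  interpret Q: comm_group ?Q using D.abelian_FactGroup[OF N(1)] .
  define \<iota> where "\<iota> v x = N #>\<^bsub>D\<^esub> coord v x" for v x
  have "\<iota> v = (\<lambda>f. N #>\<^bsub>D\<^esub> f) \<circ> coord v" for v by (simp add: \<iota>_def fun_eq_iff)
  then have \<iota>_hom: "\<iota> v \<in> hom (Gv v) ?Q" if "v \<in> verts \<Gamma>" for v
    using hom_compose[OF coord_hom[OF that] N.r_coset_hom_Mod] by simp
  have eqN: "coord u x \<otimes>\<^bsub>D\<^esub> inv\<^bsub>D\<^esub> coord v y \<in> N \<longleftrightarrow> \<iota> u x = \<iota> v y"
    if "u \<in> verts \<Gamma>" "v \<in> verts \<Gamma>" "x \<in> carrier (Gv u)" "y \<in> carrier (Gv v)" for u v x y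
    using D.rcos_eq_iff[OF N(1) coord_closed[OF that(1,3)] coord_closed[OF that(2,4)]] by (simp add: \<iota>_def)
  have diff_apply: "(coord u x \<otimes>\<^bsub>D\<^esub> inv\<^bsub>D\<^esub> coord v y) w =
      (if w = u then x else \<one>\<^bsub>Gv w\<^esub>) \<otimes>\<^bsub>Gv w\<^esub> inv\<^bsub>Gv w\<^esub> (if w = v then y else \<one>\<^bsub>Gv w\<^esub>)"
    if "u \<in> verts \<Gamma>" "v \<in> verts \<Gamma>" "x \<in> carrier (Gv u)" "y \<in> carrier (Gv v)" "w \<in> verts \<Gamma>" for u v x y w
    using that coord_closed by (simp add: D_mult D_inv coord_apply)
  define S where "S v = (SOME S. finite S \<and> S \<subseteq> carrier (Gv v) \<and> generate (Gv v) S = carrier (Gv v))" for v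
  have S: "finite (S v) \<and> S v \<subseteq> carrier (Gv v) \<and> generate (Gv v) (S v) = carrier (Gv v)" if "v \<in> verts \<Gamma>" for v
    unfolding S_def using fg_Gv[OF that] unfolding finitely_generated_def by (rule someI_ex)
  let ?S = "\<Union>v\<in>verts \<Gamma>. \<iota> v ` S v"
  define H where "H = generate ?Q ?S"
  have Sc: "?S \<subseteq> carrier ?Q" using S \<iota>_hom by (fastforce simp: hom_def)
  have H: "subgroup H ?Q" unfolding H_def by (rule Q.generate_is_subgroup[OF Sc])
  let ?P = "?Q\<lparr>carrier := H\<rparr>"
  have \<iota>H: "\<iota> v x \<in> H" if v: "v \<in> verts \<Gamma>" and x: "x \<in> carrier (Gv v)" for v x
  proof -
    interpret h: group_hom "Gv v" ?Q "\<iota> v" using \<iota>_hom[OF v] Gv_group[OF v]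
      by (simp add: group_hom_def group_hom_axioms_def Q.is_group)
    have "\<iota> v x \<in> \<iota> v ` generate (Gv v) (S v)" using S[OF v] x by simp
    also have "\<dots> = generate ?Q (\<iota> v ` S v)" using h.generate_img S[OF v] by blast
    also have "\<dots> \<subseteq> H" unfolding H_def by (rule Q.mono_generate) (use v in blast)
    finally show ?thesis .
  qed
  show ?thesis
  proof (rule that[of ?P \<iota>])
    show "comm_group ?P" by (rule Q.comm_group_subgroup[OF H])
    have "?S \<subseteq> H" using generate.incl[of _ ?S ?Q] unfolding H_def by blast
    then have "generate ?P ?S = H" using Q.generate_consistent[OF _ H] by (simp add: H_def)
    moreover have "finite ?S" using S by simp
    ultimately show "finitely_generated ?P"
      unfolding finitely_generated_def using \<open>?S \<subseteq> H\<close> by (intro exI[of _ ?S]) simp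
  next
    fix v assume v: "v \<in> verts \<Gamma>"
    show "\<iota> v \<in> hom (Gv v) ?P" using \<iota>_hom[OF v] \<iota>H[OF v] by (auto simp: hom_def)
    show "inj_on (\<iota> v) (carrier (Gv v))"
    proof (rule inj_onI)
      fix x y assume x: "x \<in> carrier (Gv v)" and y: "y \<in> carrier (Gv v)" and eq: "\<iota> v x = \<iota> v y"
      interpret V: group "Gv v" using Gv_group v .
      let ?f = "coord v x \<otimes>\<^bsub>D\<^esub> inv\<^bsub>D\<^esub> coord v y"
      have fN: "?f \<in> N" using eqN[OF v v x y] eq by simp
      have "?f v = \<one>\<^bsub>Gv v\<^esub>"
      proof (rule one[OF fN v])
        fix w assume w: "w \<in> verts \<Gamma>" "w \<noteq> v"
        then show "?f w = \<one>\<^bsub>Gv w\<^esub>" using diff_apply[OF v v x y w(1)] Gv_group[OF w(1)] by (simp add: group.is_monoid monoid.inv_one)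
      qed
      then have "x \<otimes>\<^bsub>Gv v\<^esub> inv\<^bsub>Gv v\<^esub> y = \<one>\<^bsub>Gv v\<^esub>" using diff_apply[OF v v x y v] by simp
      then show "x = y" using x y by (metis V.inv_closed V.inv_equality V.inv_inv)
    qed
  next
    fix e c assume e: "e \<in> arcs T" and c: "c \<in> carrier (Ge e)"
    have eG: "e \<in> arcs \<Gamma>" using arcs_T e by blast
    show "\<iota> (tail \<Gamma> e) (\<alpha> e c) = \<iota> (head \<Gamma> e) (\<alpha> (arev e) c)"
      using N(2)[OF e c] eqN[of "tail \<Gamma> e" "head \<Gamma> e" "\<alpha> e c" "\<alpha> (arev e) c"] \<alpha>_closed[OF eG c] \<omega>_closed[OF eG c] eG
      by (simp add: edge_relator_def)
  next
    fix u v x y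
    assume u: "u \<in> verts \<Gamma>" and v: "v \<in> verts \<Gamma>" and x: "x \<in> carrier (Gv u)" and y: "y \<in> carrier (Gv v)"
      and eq: "\<iota> u x = \<iota> v y"
    let ?f = "coord u x \<otimes>\<^bsub>D\<^esub> inv\<^bsub>D\<^esub> coord v y"
    have fN: "?f \<in> N" using eqN[OF u v x y] eq by simp
    interpret U: group "Gv u" using Gv_group u .
    interpret V: group "Gv v" using Gv_group v .
    interpret hv: group_hom "Gv v" G "vx v" using vx_hom[OF v] by unfold_locales
    show "vx u x = vx v y"
    proof (cases "u = v")
      case True
      have "?f v = \<one>\<^bsub>Gv v\<^esub>"
      proof (rule one[OF fN v])
        fix w assume w: "w \<in> verts \<Gamma>" "w \<noteq> v"
        then show "?f w = \<one>\<^bsub>Gv w\<^esub>" using diff_apply[OF u v x y w(1)] Gv_group[OF w(1)] True by (simp add: group.is_monoid monoid.inv_one)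
      qed
      then have "x \<otimes>\<^bsub>Gv v\<^esub> inv\<^bsub>Gv v\<^esub> y = \<one>\<^bsub>Gv v\<^esub>" using diff_apply[OF u v x y v] True by simp
      then have "x = y" using x y True by (metis V.inv_closed V.inv_equality V.inv_inv)
      then show ?thesis using True by simp
    next
      case False
      have "vx u (?f u) = inv\<^bsub>G\<^esub> vx v (?f v)"
      proof (rule two[OF fN u v False])
        fix w assume w: "w \<in> verts \<Gamma>" "w \<noteq> u" "w \<noteq> v"
        then show "?f w = \<one>\<^bsub>Gv w\<^esub>" using diff_apply[OF u v x y w(1)] Gv_group[OF w(1)] by (simp add: group.is_monoid monoid.inv_one)
      qed
      then show ?thesis using diff_apply[OF u v x y u] diff_apply[OF u v x y v] False x y by simp
    qed
  qed
qed

end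

section \<open>Representations of the fundamental group\<close>

text \<open>The element of the wreath product with underlying permutation \<tau> and translation
  lengths w. It fixes everything outside X, as \<open>permutes\<close> demands.\<close>

definition wperm :: "'x set \<Rightarrow> ('x \<Rightarrow> 'x) \<Rightarrow> ('x \<Rightarrow> int) \<Rightarrow> 'x \<times> int \<Rightarrow> 'x \<times> int" where
  "wperm X \<tau> w = (\<lambda>(x, z). if x \<in> X then (\<tau> x, z + w x) else (x, z))"

lemma wperm_closed:
  assumes "bij_betw \<tau> X X"
  shows "wperm X \<tau> w \<in> carrier (shift_group X)"
proof -
  have \<tau>X: "\<tau> x \<in> X" if "x \<in> X" for x using assms that by (auto simp: bij_betw_def)
  have "bij_betw (wperm X \<tau> w) (X \<times> UNIV) (X \<times> UNIV)"
  proof (rule bij_betwI[where g = "\<lambda>(y, z). (the_inv_into X \<tau> y, z - w (the_inv_into X \<tau> y))"])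
    show "wperm X \<tau> w \<in> X \<times> UNIV \<rightarrow> X \<times> UNIV" using \<tau>X by (auto simp: wperm_def)
    have inj: "inj_on \<tau> X" and im: "\<tau> ` X = X" using assms by (auto simp: bij_betw_def)
    show "(\<lambda>(y, z). (the_inv_into X \<tau> y, z - w (the_inv_into X \<tau> y))) \<in> X \<times> UNIV \<rightarrow> X \<times> UNIV"
      using the_inv_into_into[OF inj _ subset_refl] im by auto
    show "(case wperm X \<tau> w p of (y, z) \<Rightarrow> (the_inv_into X \<tau> y, z - w (the_inv_into X \<tau> y))) = p"
      if "p \<in> X \<times> UNIV" for p using that the_inv_into_f_f[OF inj] by (auto simp: wperm_def)
    show "wperm X \<tau> w (case p of (y, z) \<Rightarrow> (the_inv_into X \<tau> y, z - w (the_inv_into X \<tau> y))) = p"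
      if "p \<in> X \<times> UNIV" for p
      using that f_the_inv_into_f[OF inj] the_inv_into_into[OF inj _ subset_refl] im by (auto simp: wperm_def)
  qed
  then have "wperm X \<tau> w permutes X \<times> UNIV"
    by (rule bij_imp_permutes) (auto simp: wperm_def split: if_splits)
  moreover have "wperm X \<tau> w \<circ> shift k = shift k \<circ> wperm X \<tau> w" for k
    by (auto simp: wperm_def shift_def fun_eq_iff)
  ultimately show ?thesis by (simp add: shift_group_def)
qed

lemma wperm_mult:
  assumes "\<And>x. x \<in> X \<Longrightarrow> \<sigma> x \<in> X"
  shows "wperm X \<tau> w \<otimes>\<^bsub>shift_group X\<^esub> wperm X \<sigma> u = wperm X (\<tau> \<circ> \<sigma>) (\<lambda>x. u x + w (\<sigma> x))"
  using assms by (auto simp: shift_group_def wperm_def fun_eq_iff)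

lemma wperm_cong:
  assumes "\<And>x. x \<in> X \<Longrightarrow> \<tau> x = \<sigma> x" "\<And>x. x \<in> X \<Longrightarrow> w x = u x"
  shows "wperm X \<tau> w = wperm X \<sigma> u"
  using assms by (auto simp: wperm_def fun_eq_iff)

lemma (in group) inj_hom_int_pow_eq_one:
  assumes "h \<in> hom G H" "group H" "inj_on h (carrier G)" "x \<in> carrier G"
  shows "h x [^]\<^bsub>H\<^esub> (k::int) = \<one>\<^bsub>H\<^esub> \<longleftrightarrow> x [^] k = \<one>"
proof -
  interpret h: group_hom G H h using assms(1,2) by (simp add: group_hom_def group_hom_axioms_def is_group)
  have "h x [^]\<^bsub>H\<^esub> k = h (x [^] k)" using h.hom_int_pow[OF assms(4)] by simp
  then show ?thesis using assms(3,4) h.hom_one by (metis inj_onD int_pow_closed one_closed)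
qed

lemma ord_eqI:
  assumes "group G" "group H" "a \<in> carrier G" "b \<in> carrier H"
    and "\<And>k::int. a [^]\<^bsub>G\<^esub> k = \<one>\<^bsub>G\<^esub> \<longleftrightarrow> b [^]\<^bsub>H\<^esub> k = \<one>\<^bsub>H\<^esub>"
  shows "group.ord G a = group.ord H b"
proof -
  have "int (group.ord G a) dvd k \<longleftrightarrow> int (group.ord H b) dvd k" for k
    using assms group.int_pow_eq_id by metis
  from this[of "int (group.ord G a)"] this[of "int (group.ord H b)"] show ?thesis by (simp add: dvd_antisym)
qed

section \<open>Edge generators in the pushout and representations built from them\<close>

locale graph_with_pushout = graph_of_abelian_groups \<Gamma> arev Gv Ge \<alpha> T Ep
  for \<Gamma> :: "('v, 'e) pre_digraph" and arev :: "'e \<Rightarrow> 'e"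
    and Gv :: "'v \<Rightarrow> 'a monoid" and Ge :: "'e \<Rightarrow> 'b monoid" and \<alpha> :: "'e \<Rightarrow> 'b \<Rightarrow> 'a"
    and T :: "('v, 'e) pre_digraph" and Ep :: "'e set" +
  fixes P :: "('p, 'q) monoid_scheme" and \<iota> :: "'v \<Rightarrow> 'a \<Rightarrow> 'p"
  assumes comm_P: "comm_group P" and fg_P: "finitely_generated P"
    and \<iota>_hom: "v \<in> verts \<Gamma> \<Longrightarrow> \<iota> v \<in> hom (Gv v) P"
    and \<iota>_inj: "v \<in> verts \<Gamma> \<Longrightarrow> inj_on (\<iota> v) (carrier (Gv v))"
    and \<iota>_tree: "e \<in> arcs T \<Longrightarrow> c \<in> carrier (Ge e) \<Longrightarrow> \<iota> (tail \<Gamma> e) (\<alpha> e c) = \<iota> (head \<Gamma> e) (\<alpha> (arev e) c)"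
    and \<iota>_glue: "\<lbrakk>u \<in> verts \<Gamma>; v \<in> verts \<Gamma>; x \<in> carrier (Gv u); y \<in> carrier (Gv v); \<iota> u x = \<iota> v y\<rbrakk> \<Longrightarrow> vx u x = vx v y"
    and euler: "euler_characteristic \<Gamma> \<ge> 0"
begin

sublocale P: comm_group P by (rule comm_P)

lemma \<iota>_closed: "v \<in> verts \<Gamma> \<Longrightarrow> x \<in> carrier (Gv v) \<Longrightarrow> \<iota> v x \<in> carrier P"
  using hom_in_carrier[OF \<iota>_hom] .

text \<open>The tree has 2 * |V| - 2 arcs. Two more edges bring four further arcs and push the Euler
  characteristic to -1 or below.\<close>

lemma nontree_unique:
  assumes "e \<in> Ep - arcs T" "f \<in> Ep - arcs T" shows "e = f"
proof (rule ccontr)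
  assume ne: "e \<noteq> f"
  have c: "card (arcs T) + 2 = 2 * card (verts \<Gamma>)"
    by (rule tree_built_card[OF tree]) auto
  have rev: "arev e \<noteq> arev f" using ne arev_arev' by metis
  have "e \<in> arcs \<Gamma>" "f \<in> arcs \<Gamma>" using assms arcs_Ep(1) by auto
  moreover have "arev e \<notin> arcs T" "arev f \<notin> arcs T" using assms arcs_T(2) arev_arev' by (metis DiffD2)+
  ultimately have sub: "arcs T \<union> {e, arev e, f, arev f} \<subseteq> arcs \<Gamma>" "arcs T \<inter> {e, arev e, f, arev f} = {}"
    using assms arcs_T(1) by auto
  have "arev e \<notin> Ep" "arev f \<notin> Ep" using assms arcs_Ep(2) by auto
  then have "e \<noteq> arev e" "e \<noteq> arev f" "arev e \<noteq> f" "f \<noteq> arev f" using assms by auto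
  then have "card {e, arev e, f, arev f} = 4" using ne rev by simp
  moreover have "finite (arcs T)" using finite_subset[OF _ finite_arcs] arcs_T by blast
  ultimately have "card (arcs T) + 4 = card (arcs T \<union> {e, arev e, f, arev f})"
    using sub(2) by (subst card_Un_disjoint) auto
  also have "\<dots> \<le> card (arcs \<Gamma>)" using sub(1) by (rule card_mono[OF finite_arcs])
  finally have "2 * card (verts \<Gamma>) + 2 \<le> card (arcs \<Gamma>)" using c by simp
  then show False using euler unfolding euler_characteristic_def by simp
qed

text \<open>The choice depends on e only through \<open>Ge e\<close>, so an edge and its reverse
  share their generator.\<close>

definition gen :: "'e \<Rightarrow> 'b" where
  "gen e = (SOME c. c \<in> carrier (Ge e) \<and> carrier (Ge e) = range (\<lambda>n::int. c [^]\<^bsub>Ge e\<^esub> n))"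

lemma gen:
  assumes "e \<in> arcs \<Gamma>"
  shows "gen e \<in> carrier (Ge e)" "carrier (Ge e) = range (\<lambda>n::int. gen e [^]\<^bsub>Ge e\<^esub> n)"
proof -
  have "\<exists>c. c \<in> carrier (Ge e) \<and> carrier (Ge e) = range (\<lambda>n::int. c [^]\<^bsub>Ge e\<^esub> n)"
    using cyclic_Ge[OF assms] group.cyclic_group[OF group_Ge[OF assms]] by blast
  from someI_ex[OF this] show "gen e \<in> carrier (Ge e)" "carrier (Ge e) = range (\<lambda>n::int. gen e [^]\<^bsub>Ge e\<^esub> n)"
    unfolding gen_def by blast+
qed

text \<open>In the fundamental group \<open>st e\<close> conjugates the vertex element behind
  \<open>\<omega>g e\<close> to the one behind \<open>\<alpha>g e\<close>.\<close>

definition \<omega>g :: "'e \<Rightarrow> 'p" where "\<omega>g e = \<iota> (head \<Gamma> e) (\<alpha> (arev e) (gen e))"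
definition \<alpha>g :: "'e \<Rightarrow> 'p" where "\<alpha>g e = \<iota> (tail \<Gamma> e) (\<alpha> e (gen e))"

lemma \<omega>g_arev: "e \<in> arcs \<Gamma> \<Longrightarrow> \<omega>g (arev e) = \<alpha>g e"
  by (simp add: \<omega>g_def \<alpha>g_def arev_arev' gen_def Ge_arev)

lemma g_closed: "e \<in> arcs \<Gamma> \<Longrightarrow> \<omega>g e \<in> carrier P" "e \<in> arcs \<Gamma> \<Longrightarrow> \<alpha>g e \<in> carrier P"
  using \<iota>_closed \<omega>_closed[OF _ gen(1)] \<alpha>_closed[OF _ gen(1)] by (auto simp: \<omega>g_def \<alpha>g_def)

lemma g_tree: "e \<in> arcs T \<Longrightarrow> \<alpha>g e = \<omega>g e"
  using \<iota>_tree gen(1)[OF arcs_T(1)] by (simp add: \<omega>g_def \<alpha>g_def)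

lemma comp_hom:
  assumes "e \<in> arcs \<Gamma>"
  shows "\<iota> (head \<Gamma> e) \<circ> \<alpha> (arev e) \<in> hom (Ge e) P" "\<iota> (tail \<Gamma> e) \<circ> \<alpha> e \<in> hom (Ge e) P"
    "inj_on (\<iota> (head \<Gamma> e) \<circ> \<alpha> (arev e)) (carrier (Ge e))" "inj_on (\<iota> (tail \<Gamma> e) \<circ> \<alpha> e) (carrier (Ge e))"
  using assms hom_compose[OF \<omega>_hom \<iota>_hom] hom_compose[OF \<alpha>_hom \<iota>_hom]
    comp_inj_on[OF \<omega>_inj inj_on_subset[OF \<iota>_inj]] comp_inj_on[OF \<alpha>_inj inj_on_subset[OF \<iota>_inj]]
    \<omega>_closed \<alpha>_closed by (auto simp: image_subset_iff)

lemma g_pow: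
  assumes e: "e \<in> arcs \<Gamma>" and c: "c = gen e [^]\<^bsub>Ge e\<^esub> (k::int)"
  shows "\<iota> (head \<Gamma> e) (\<alpha> (arev e) c) = \<omega>g e [^]\<^bsub>P\<^esub> k" "\<iota> (tail \<Gamma> e) (\<alpha> e c) = \<alpha>g e [^]\<^bsub>P\<^esub> k"
  using hom_int_pow[OF comp_hom(1)[OF e] gen(1)[OF e] group_Ge[OF e] P.is_group, of k]
    hom_int_pow[OF comp_hom(2)[OF e] gen(1)[OF e] group_Ge[OF e] P.is_group, of k]
  by (simp_all add: c \<omega>g_def \<alpha>g_def)

lemma g_ord:
  assumes e: "e \<in> arcs \<Gamma>"
  shows "P.ord (\<omega>g e) = group.ord (Ge e) (gen e)" "P.ord (\<alpha>g e) = group.ord (Ge e) (gen e)"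
  using ord_eqI[OF P.is_group group_Ge[OF e] g_closed(1)[OF e] gen(1)[OF e]]
    ord_eqI[OF P.is_group group_Ge[OF e] g_closed(2)[OF e] gen(1)[OF e]]
    group.inj_hom_int_pow_eq_one[OF group_Ge[OF e] comp_hom(1)[OF e] P.is_group comp_hom(3)[OF e] gen(1)[OF e]]
    group.inj_hom_int_pow_eq_one[OF group_Ge[OF e] comp_hom(2)[OF e] P.is_group comp_hom(4)[OF e] gen(1)[OF e]]
  by (simp_all add: \<omega>g_def \<alpha>g_def)

text \<open>Injectivity of \<iota> brings membership in the edge subgroup from P back to the vertex
  group, where reducedness of paths is stated.\<close>

lemma edge_image_mem:
  assumes e: "e \<in> arcs \<Gamma>" and x: "x \<in> carrier (Gv (head \<Gamma> e))"
    and mem: "\<iota> (head \<Gamma> e) x \<in> generate P {\<omega>g e}"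
  shows "x \<in> \<alpha> (arev e) ` carrier (Ge e)"
proof -
  obtain k :: int where k: "\<iota> (head \<Gamma> e) x = \<omega>g e [^]\<^bsub>P\<^esub> k"
    using mem P.generate_pow[OF g_closed(1)[OF e]] by auto
  let ?c = "gen e [^]\<^bsub>Ge e\<^esub> k"
  have c: "?c \<in> carrier (Ge e)" using gen(2)[OF e] by blast
  have "\<iota> (head \<Gamma> e) x = \<iota> (head \<Gamma> e) (\<alpha> (arev e) ?c)" using k g_pow(1)[OF e HOL.refl] by simp
  then have "x = \<alpha> (arev e) ?c" 
    using inj_onD[OF \<iota>_inj, of "head \<Gamma> e" x] e x \<omega>_closed[OF e c] by simp
  then show ?thesis using c by blast
qed

text \<open>P is mapped by \<open>lam\<close>, and the vertex group at v by its conjugate under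
  \<open>\<gamma> v\<close>. The hypothesis on tree edges sends their stable letters to 1. Edge
  groups being cyclic, the relation of an edge follows from the one for its generator.\<close>

lemma representation:
  assumes W: "group W" and lam: "lam \<in> hom P W"
    and \<tau>: "\<And>e. e \<in> Ep \<Longrightarrow> \<tau> e \<in> carrier W"
    and rel: "\<And>e. e \<in> Ep \<Longrightarrow> \<tau> e \<otimes>\<^bsub>W\<^esub> lam (\<omega>g e) = lam (\<alpha>g e) \<otimes>\<^bsub>W\<^esub> \<tau> e"
    and \<gamma>: "\<And>v. v \<in> verts \<Gamma> \<Longrightarrow> \<gamma> v \<in> carrier W"
    and tree: "\<And>e. \<lbrakk>e \<in> Ep; e \<in> arcs T\<rbrakk> \<Longrightarrow> \<gamma> (head \<Gamma> e) = \<gamma> (tail \<Gamma> e) \<otimes>\<^bsub>W\<^esub> \<tau> e"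
  obtains \<Phi> where "\<Phi> \<in> hom G W"
    "\<And>v x. \<lbrakk>v \<in> verts \<Gamma>; x \<in> carrier (Gv v)\<rbrakk> \<Longrightarrow> \<Phi> (vx v x) = \<gamma> v \<otimes>\<^bsub>W\<^esub> lam (\<iota> v x) \<otimes>\<^bsub>W\<^esub> inv\<^bsub>W\<^esub> \<gamma> v"
    "\<And>e. e \<in> Ep \<Longrightarrow> \<Phi> (st e) = \<gamma> (tail \<Gamma> e) \<otimes>\<^bsub>W\<^esub> \<tau> e \<otimes>\<^bsub>W\<^esub> inv\<^bsub>W\<^esub> \<gamma> (head \<Gamma> e)"
proof -
  interpret W: group W by fact
  interpret lam: group_hom P W lam using lam by unfold_locales
  define F where "F v x = \<gamma> v \<otimes>\<^bsub>W\<^esub> lam (\<iota> v x) \<otimes>\<^bsub>W\<^esub> inv\<^bsub>W\<^esub> \<gamma> v" for v x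
  define S where "S e = \<gamma> (tail \<Gamma> e) \<otimes>\<^bsub>W\<^esub> \<tau> e \<otimes>\<^bsub>W\<^esub> inv\<^bsub>W\<^esub> \<gamma> (head \<Gamma> e)" for e
  have cancel: "inv\<^bsub>W\<^esub> a \<otimes>\<^bsub>W\<^esub> (a \<otimes>\<^bsub>W\<^esub> b) = b" if "a \<in> carrier W" "b \<in> carrier W" for a b
    using that by (simp flip: W.m_assoc)
  have EpG: "e \<in> arcs \<Gamma>" if "e \<in> Ep" for e using that arcs_Ep(1) by blast
  show ?thesis
  proof (rule fundamental_group_universal[OF W, of F S])
    fix v assume v: "v \<in> verts \<Gamma>"
    show "F v \<in> hom (Gv v) W"
    proof (rule homI)
      fix x y assume x: "x \<in> carrier (Gv v)" and y: "y \<in> carrier (Gv v)"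
      show "F v (x \<otimes>\<^bsub>Gv v\<^esub> y) = F v x \<otimes>\<^bsub>W\<^esub> F v y"
        using \<gamma>[OF v] \<iota>_closed[OF v x] \<iota>_closed[OF v y]
        by (simp add: F_def hom_mult[OF \<iota>_hom[OF v] x y] W.m_assoc cancel)
    qed (use \<gamma>[OF v] \<iota>_closed[OF v] in \<open>simp add: F_def\<close>)
  next
    fix e assume e: "e \<in> Ep"
    show "S e \<in> carrier W" using \<gamma> \<tau>[OF e] EpG[OF e] by (simp add: S_def)
  next
    fix e c assume e: "e \<in> Ep" and c: "c \<in> carrier (Ge e)"
    note eG = EpG[OF e]
    obtain k :: int where k: "c = gen e [^]\<^bsub>Ge e\<^esub> k" using gen(2)[OF eG] c by auto
    have cl: "\<gamma> (tail \<Gamma> e) \<in> carrier W" "\<gamma> (head \<Gamma> e) \<in> carrier W" "\<tau> e \<in> carrier W"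
      "lam (\<omega>g e) \<in> carrier W" "lam (\<alpha>g e) \<in> carrier W"
      using \<gamma> eG \<tau>[OF e] g_closed[OF eG] by auto
    have "\<tau> e \<otimes>\<^bsub>W\<^esub> lam (\<omega>g e) \<otimes>\<^bsub>W\<^esub> inv\<^bsub>W\<^esub> \<tau> e = lam (\<alpha>g e)"
      using rel[OF e] cl by (simp add: W.inv_solve_right')
    then have "\<tau> e \<otimes>\<^bsub>W\<^esub> (lam (\<omega>g e) [^]\<^bsub>W\<^esub> k \<otimes>\<^bsub>W\<^esub> inv\<^bsub>W\<^esub> \<tau> e) = lam (\<alpha>g e) [^]\<^bsub>W\<^esub> k"
      using W.conj_int_pow[of "\<tau> e" "lam (\<omega>g e)" k] cl by (simp add: W.m_assoc)
    then have "\<tau> e \<otimes>\<^bsub>W\<^esub> (lam (\<omega>g e [^]\<^bsub>P\<^esub> k) \<otimes>\<^bsub>W\<^esub> inv\<^bsub>W\<^esub> \<tau> e) = lam (\<alpha>g e [^]\<^bsub>P\<^esub> k)"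
      using lam.hom_int_pow g_closed[OF eG] by simp
    moreover have "lam (\<omega>g e [^]\<^bsub>P\<^esub> k) \<in> carrier W" "lam (\<alpha>g e [^]\<^bsub>P\<^esub> k) \<in> carrier W"
      using g_closed[OF eG] by simp_all
    ultimately show "S e \<otimes>\<^bsub>W\<^esub> F (head \<Gamma> e) (\<alpha> (arev e) c) \<otimes>\<^bsub>W\<^esub> inv\<^bsub>W\<^esub> S e = F (tail \<Gamma> e) (\<alpha> e c)"
      unfolding S_def F_def g_pow[OF eG k] using cl
      by (simp add: W.inv_mult_group W.m_assoc cancel) (simp flip: W.m_assoc)
  next
    fix e assume e: "e \<in> Ep" "e \<in> arcs T"
    have cl: "\<gamma> (tail \<Gamma> e) \<in> carrier W" "\<tau> e \<in> carrier W" using \<gamma> EpG[OF e(1)] \<tau>[OF e(1)] by auto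
    show "S e = \<one>\<^bsub>W\<^esub>" unfolding S_def tree[OF e] by (rule W.r_inv) (use cl in simp)
  next
    fix \<Phi> assume "\<Phi> \<in> hom G W"
      "\<And>v a. v \<in> verts \<Gamma> \<Longrightarrow> a \<in> carrier (Gv v) \<Longrightarrow> \<Phi> (vx v a) = F v a" "\<And>e. e \<in> Ep \<Longrightarrow> \<Phi> (st e) = S e"
    then show ?thesis using that by (simp add: F_def S_def)
  qed
qed

text \<open>The case of a constant potential, enough for elliptic elements: only an edge outside the
  tree has to be given an image.\<close>

lemma representation_trivial_tree:
  assumes W: "group W" and lam: "lam \<in> hom P W"
    and \<tau>: "\<And>e. e \<in> Ep - arcs T \<Longrightarrow> \<tau> e \<in> carrier W"
    and rel: "\<And>e. e \<in> Ep - arcs T \<Longrightarrow> \<tau> e \<otimes>\<^bsub>W\<^esub> lam (\<omega>g e) = lam (\<alpha>g e) \<otimes>\<^bsub>W\<^esub> \<tau> e"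
  obtains \<Phi> where "\<Phi> \<in> hom G W"
    "\<And>v x. \<lbrakk>v \<in> verts \<Gamma>; x \<in> carrier (Gv v)\<rbrakk> \<Longrightarrow> \<Phi> (vx v x) = lam (\<iota> v x)"
proof -
  interpret W: group W by fact
  have lamc: "lam p \<in> carrier W" if "p \<in> carrier P" for p using hom_in_carrier[OF lam that] .
  have EpG: "e \<in> arcs \<Gamma>" if "e \<in> Ep" for e using that arcs_Ep(1) by blast
  let ?\<tau> = "\<lambda>e. if e \<in> arcs T then \<one>\<^bsub>W\<^esub> else \<tau> e"
  have rel': "?\<tau> e \<otimes>\<^bsub>W\<^esub> lam (\<omega>g e) = lam (\<alpha>g e) \<otimes>\<^bsub>W\<^esub> ?\<tau> e" if "e \<in> Ep" for e
    using rel[of e] that g_tree[of e] lamc[OF g_closed(1)[OF EpG[OF that]]] by simp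
  obtain \<Phi> where \<Phi>: "\<Phi> \<in> hom G W"
    "\<And>v x. \<lbrakk>v \<in> verts \<Gamma>; x \<in> carrier (Gv v)\<rbrakk> \<Longrightarrow> \<Phi> (vx v x) = \<one>\<^bsub>W\<^esub> \<otimes>\<^bsub>W\<^esub> lam (\<iota> v x) \<otimes>\<^bsub>W\<^esub> inv\<^bsub>W\<^esub> \<one>\<^bsub>W\<^esub>"
    by (rule representation[OF W lam, of ?\<tau> "\<lambda>_. \<one>\<^bsub>W\<^esub>"]) (use \<tau> rel' in auto)
  then show ?thesis using that[OF \<Phi>(1)] lamc \<iota>_closed by simp
qed

text \<open>At a non-tree edge with \<open>a\<^sup>k = b\<^sup>l\<close> the real affine group, with \<open>t\<close> acting as the homothety of ratio \<open>k/l\<close>, shows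
  that the edge generator has infinite order in the fundamental group.\<close>

lemma balanced_order_compatible:
  assumes bal: "balanced G" and e: "e \<in> Ep"
  shows "order_compatible P (\<omega>g e) (\<alpha>g e)"
proof (cases "e \<in> arcs T")
  case True
  have eG: "e \<in> arcs \<Gamma>" using e arcs_Ep(1) by blast
  show ?thesis unfolding order_compatible_def g_tree[OF True]
    using P.int_pow_eq[OF g_closed(1)[OF eG]] by auto
next
  case nontree: False
  have eG: "e \<in> arcs \<Gamma>" using e arcs_Ep(1) by blast
  let ?a = "\<omega>g e" and ?b = "\<alpha>g e"
  have ab: "?a \<in> carrier P" "?b \<in> carrier P" using g_closed[OF eG] by auto
  have "\<bar>k\<bar> = \<bar>l\<bar>" if ord: "P.ord ?a = 0" and eq: "?a [^]\<^bsub>P\<^esub> k = ?b [^]\<^bsub>P\<^esub> l" for k l :: int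
  proof -
    have inf: "?a [^]\<^bsub>P\<^esub> i = \<one>\<^bsub>P\<^esub> \<longleftrightarrow> i = 0" "?b [^]\<^bsub>P\<^esub> i = \<one>\<^bsub>P\<^esub> \<longleftrightarrow> i = 0" for i :: int
      using P.int_pow_eq_id ab ord g_ord[OF eG] by auto
    show ?thesis
    proof (cases "k = 0 \<or> l = 0")
      case True
      then show ?thesis using eq inf by (metis int_pow_0)
    next
      case kl: False
      have hc: "\<alpha> (arev e) (gen e) \<in> carrier (Gv (head \<Gamma> e))" and tc: "\<alpha> e (gen e) \<in> carrier (Gv (tail \<Gamma> e))"
        using \<omega>_closed[OF eG gen(1)[OF eG]] \<alpha>_closed[OF eG gen(1)[OF eG]] by auto
      have hv: "head \<Gamma> e \<in> verts \<Gamma>" and tv: "tail \<Gamma> e \<in> verts \<Gamma>" using eG by auto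
      define x where "x = vx (head \<Gamma> e) (\<alpha> (arev e) (gen e))"
      define g where "g = vx (tail \<Gamma> e) (\<alpha> e (gen e))"
      have xg: "x \<in> carrier G" "g \<in> carrier G" using vx_closed hv tv hc tc by (auto simp: x_def g_def)
      have sx: "st e \<otimes>\<^bsub>G\<^esub> x \<otimes>\<^bsub>G\<^esub> inv\<^bsub>G\<^esub> st e = g"
        unfolding x_def g_def by (rule st_rel[OF eG gen(1)[OF eG]])
      interpret Hg: group "Gv (head \<Gamma> e)" using Gv_group hv .
      interpret Tg: group "Gv (tail \<Gamma> e)" using Gv_group tv .
      have "\<iota> (head \<Gamma> e) (\<alpha> (arev e) (gen e) [^]\<^bsub>Gv (head \<Gamma> e)\<^esub> k) = \<iota> (tail \<Gamma> e) (\<alpha> e (gen e) [^]\<^bsub>Gv (tail \<Gamma> e)\<^esub> l)"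
        using eq hom_int_pow[OF \<iota>_hom[OF hv] hc Hg.is_group P.is_group, of k]
          hom_int_pow[OF \<iota>_hom[OF tv] tc Tg.is_group P.is_group, of l] by (simp add: \<omega>g_def \<alpha>g_def)
      \<comment> \<open>By \<open>\<iota>_glue\<close> the coincidence in P already holds in the
        fundamental group, where \<open>st e\<close> turns x^k = g^l into a conjugacy between g^l
        and g^k.\<close>
      then have "x [^]\<^bsub>G\<^esub> k = g [^]\<^bsub>G\<^esub> l"
        using \<iota>_glue[OF hv tv Hg.int_pow_closed[OF hc] Tg.int_pow_closed[OF tc]] hom_int_pow[OF vx_hom[OF hv] hc Hg.is_group G.is_group, of k]
          hom_int_pow[OF vx_hom[OF tv] tc Tg.is_group G.is_group, of l] by (simp add: x_def g_def)
      then have "st e \<otimes>\<^bsub>G\<^esub> g [^]\<^bsub>G\<^esub> l \<otimes>\<^bsub>G\<^esub> inv\<^bsub>G\<^esub> st e = g [^]\<^bsub>G\<^esub> k"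
        using G.conj_int_pow[OF st_closed[OF eG] xg(1), of k] sx by simp
      moreover have "G.ord g = 0"
      proof -
        obtain f where f: "f \<in> hom P integer_group" "f ?b \<noteq> 0"
          using P.integer_character[OF fg_P P.triv_subgroup ab(2)] inf by (metis singletonD)
        interpret f: group_hom P integer_group f using f(1) by (simp add: group_hom_def group_hom_axioms_def P.is_group)
        have "k * f ?a = l * f ?b" using eq f.hom_int_pow ab by (metis group_int_pow_integer_group)
        then have fa: "f ?a \<noteq> 0" using f(2) kl by auto
        \<comment> \<open>Equal to k / l, because k * f ?a = l * f ?b.\<close>
        define q where "q = real_of_int (f ?b) / real_of_int (f ?a)"
        have q: "q \<noteq> 0" "q * real_of_int (f ?a) = real_of_int (f ?b)" using fa f(2) by (simp_all add: q_def)
        define lam where "lam p = (\<lambda>x. x + real_of_int (f p))" for p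
        let ?W = "perm_group (UNIV :: real set)"
        have bij: "h permutes UNIV" if "bij h" for h :: "real \<Rightarrow> real" using that by (intro bij_imp_permutes) auto
        have "bij (\<lambda>x. x + y)" for y :: real by (rule bij_betwI[where g = "\<lambda>x. x - y"]) auto
        then have lam: "lam \<in> hom P ?W"
          by (auto intro!: homI bij simp: lam_def perm_group_def fun_eq_iff f.hom_mult)
        have "bij (\<lambda>x. q * x)" by (rule bij_betwI[where g = "\<lambda>x. x / q"]) (use q in auto)
        then have \<tau>: "(\<lambda>x. q * x) \<in> carrier ?W" using bij by (simp add: perm_group_def)
        obtain \<Phi> where \<Phi>: "\<Phi> \<in> hom G ?W"
          "\<And>v x. \<lbrakk>v \<in> verts \<Gamma>; x \<in> carrier (Gv v)\<rbrakk> \<Longrightarrow> \<Phi> (vx v x) = lam (\<iota> v x)"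
        proof (rule representation_trivial_tree[OF group_perm_group lam, of "\<lambda>_. (\<lambda>x. q * x)"])
          fix e' assume "e' \<in> Ep - arcs T"
          then have [simp]: "e' = e" using nontree_unique e nontree by blast
          show "(\<lambda>x. q * x) \<otimes>\<^bsub>?W\<^esub> lam (\<omega>g e') = lam (\<alpha>g e') \<otimes>\<^bsub>?W\<^esub> (\<lambda>x. q * x)"
            using q by (simp add: perm_group_def lam_def fun_eq_iff distrib_left)
        qed (use \<tau> in auto)
        have "i = 0" if "g [^]\<^bsub>G\<^esub> i = \<one>\<^bsub>G\<^esub>" for i :: int
        proof -
          interpret \<Phi>: group_hom G ?W \<Phi> using \<Phi>(1) group_perm_group
            by (simp add: group_hom_def group_hom_axioms_def G.is_group)
          have "lam ?b [^]\<^bsub>?W\<^esub> i = \<one>\<^bsub>?W\<^esub>"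
            using \<Phi>.hom_int_pow[OF xg(2), of i] that \<Phi>(2)[OF tv tc] by (simp add: g_def \<alpha>g_def)
          then have "lam (?b [^]\<^bsub>P\<^esub> i) = \<one>\<^bsub>?W\<^esub>"
            using hom_int_pow[OF lam ab(2) P.is_group group_perm_group, of i] by simp
          then have "f (?b [^]\<^bsub>P\<^esub> i) = 0" by (simp add: lam_def perm_group_def fun_eq_iff)
          then show ?thesis using f.hom_int_pow[OF ab(2), of i] f(2) by simp
        qed
        then show ?thesis using G.infinite_ord_iff[OF xg(2)] by blast
      qed
      ultimately have "k = l \<or> k = - l"
        using bal kl xg(2) st_closed[OF eG] unfolding balanced_def by blast
      then show ?thesis by auto
    qed
  qed
  then show ?thesis using g_ord[OF eG] by (auto simp: order_compatible_def)
qed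

end

section \<open>Elliptic elements\<close>

definition act :: "('q, 'm) monoid_scheme \<Rightarrow> 'q \<Rightarrow> 'q \<times> 'j \<Rightarrow> 'q \<times> 'j" where
  "act Q q = (\<lambda>(x, j). (q \<otimes>\<^bsub>Q\<^esub> x, j))"

lemma (in group) act_funpow:
  "q \<in> carrier G \<Longrightarrow> x \<in> carrier G \<Longrightarrow> (act G q ^^ k) (x, j) = (q [^] k \<otimes> x, j)"
proof (induction k)
  case (Suc k)
  then have "(act G q ^^ Suc k) (x, j) = ((q \<otimes> q [^] k) \<otimes> x, j)" by (simp add: act_def m_assoc)
  then show ?case by (simp only: nat_pow_Suc2[OF Suc.prems(1)])
qed simp

lemma (in group) act_bij: "q \<in> carrier G \<Longrightarrow> bij_betw (act G q) (carrier G \<times> J) (carrier G \<times> J)"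
  by (rule bij_betwI[where g = "act G (inv q)"]) (auto simp: act_def simp flip: m_assoc)

lemma (in group) act_closed: "q \<in> carrier G \<Longrightarrow> x \<in> carrier G \<times> J \<Longrightarrow> act G q x \<in> carrier G \<times> J"
  by (auto simp: act_def)

lemma (in group) act_act:
  "q \<in> carrier G \<Longrightarrow> r \<in> carrier G \<Longrightarrow> x \<in> carrier G \<times> J \<Longrightarrow> act G q (act G r x) = act G (q \<otimes> r) x"
  by (auto simp: act_def m_assoc)

lemma (in group) free_cyclic_on_act:
  assumes "finite (carrier G)" "q \<in> carrier G"
  shows "free_cyclic_on (ord q) (act G q) (carrier G \<times> J)"
  unfolding free_cyclic_on_def
proof (intro conjI ballI allI)
  show "ord q > 0" using ord_ge_1[OF assms] by simp
  show "act G q \<in> carrier G \<times> J \<rightarrow> carrier G \<times> J" using act_closed[OF assms(2), of _ J] by auto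
  fix p k l assume "p \<in> carrier G \<times> J"
  then obtain x j where p: "p = (x, j)" "x \<in> carrier G" by auto
  have "(act G q ^^ k) p = (act G q ^^ l) p \<longleftrightarrow> q [^] k = q [^] l"
    using act_funpow[OF assms(2) p(2), of k j] act_funpow[OF assms(2) p(2), of l j] assms p by simp
  also have "\<dots> \<longleftrightarrow> q [^] int k = q [^] int l" by (simp add: int_pow_int)
  also have "\<dots> \<longleftrightarrow> int (ord q) dvd int l - int k" by (rule int_pow_eq[OF assms(2)])
  also have "\<dots> \<longleftrightarrow> k mod ord q = l mod ord q"
    by (metis mod_eq_dvd_iff of_nat_eq_iff zmod_int)
  finally show "(act G q ^^ k) p = (act G q ^^ l) p \<longleftrightarrow> k mod ord q = l mod ord q" .
qed

definition ext_on :: "'x set \<Rightarrow> ('x \<Rightarrow> 'x) \<Rightarrow> 'x \<Rightarrow> 'x" where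
  "ext_on X f = (\<lambda>x. if x \<in> X then f x else x)"

lemma ext_on_closed: "bij_betw f X X \<Longrightarrow> ext_on X f \<in> carrier (perm_group X)"
proof -
  assume "bij_betw f X X"
  then have "bij_betw (ext_on X f) X X" by (rule bij_betw_cong[THEN iffD2, rotated]) (simp add: ext_on_def)
  then show ?thesis by (auto simp: perm_group_def ext_on_def intro: bij_imp_permutes)
qed

context graph_with_pushout
begin

text \<open>On tree edges the two generators coincide in P, and at most one edge lies outside the
  tree, so it suffices to match the orders of a single pair a, b.\<close>

lemma finite_quotient:
  assumes compat: "\<And>e. e \<in> Ep \<Longrightarrow> order_compatible P (\<omega>g e) (\<alpha>g e)"
    and F: "finite F" "\<And>s H. (s, H) \<in> F \<Longrightarrow> s \<in> carrier P \<and> subgroup H P \<and> s \<notin> H"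
  obtains Q :: "'p set monoid" and p where "group Q" "finite (carrier Q)" "p \<in> hom P Q"
    "\<And>s H h. \<lbrakk>(s, H) \<in> F; h \<in> H\<rbrakk> \<Longrightarrow> p s \<noteq> p h"
    "\<And>e. e \<in> Ep \<Longrightarrow> group.ord Q (p (\<omega>g e)) = group.ord Q (p (\<alpha>g e))"
proof -
  have EpG: "e \<in> arcs \<Gamma>" if "e \<in> Ep" for e using that arcs_Ep(1) by blast
  obtain a b where ab: "a \<in> carrier P" "b \<in> carrier P" "order_compatible P a b"
    "\<And>e. e \<in> Ep - arcs T \<Longrightarrow> \<omega>g e = a \<and> \<alpha>g e = b"
  proof (cases "Ep - arcs T = {}")
    case True
    \<comment> \<open>Without an edge outside the tree the trivial pair serves.\<close>
    have "order_compatible P \<one>\<^bsub>P\<^esub> \<one>\<^bsub>P\<^esub>" by (simp add: order_compatible_def)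
    then show ?thesis using that[of "\<one>\<^bsub>P\<^esub>" "\<one>\<^bsub>P\<^esub>"] True by blast
  next
    case False
    then obtain e where e: "e \<in> Ep - arcs T" by blast
    then show ?thesis using that[of "\<omega>g e" "\<alpha>g e"] g_closed[OF EpG] compat nontree_unique[OF e] by blast
  qed
  obtain M where M: "subgroup M P" "finite (rcosets\<^bsub>P\<^esub> M)"
    "\<And>s H h. \<lbrakk>(s, H) \<in> F; h \<in> H\<rbrakk> \<Longrightarrow> s \<otimes>\<^bsub>P\<^esub> inv\<^bsub>P\<^esub> h \<notin> M"
    "\<And>k::int. a [^]\<^bsub>P\<^esub> k \<in> M \<longleftrightarrow> b [^]\<^bsub>P\<^esub> k \<in> M"
    by (rule P.finite_quotient_order_compatible[OF fg_P ab(1,2,3) F]) auto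
  interpret M: normal M P by (rule P.subgroup_imp_normal[OF M(1)])
  let ?Q = "P Mod M" and ?p = "\<lambda>x. M #>\<^bsub>P\<^esub> x"
  have Q: "group ?Q" by (rule M.factorgroup_is_group)
  have p: "?p \<in> hom P ?Q" by (rule M.r_coset_hom_Mod)
  have one: "?p x = \<one>\<^bsub>?Q\<^esub> \<longleftrightarrow> x \<in> M" if "x \<in> carrier P" for x
    using P.rcos_eq_iff[OF M(1) that P.one_closed] that M.subset by (simp add: FactGroup_def)
  have ord: "group.ord ?Q (?p (\<omega>g e)) = group.ord ?Q (?p (\<alpha>g e))" if e: "e \<in> Ep" for e
  proof (cases "e \<in> arcs T")
    case True
    then show ?thesis using g_tree by simp
  next
    case False
    then have w: "\<omega>g e = a" "\<alpha>g e = b" using ab(4) e by auto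
    have "(?p a) [^]\<^bsub>?Q\<^esub> k = \<one>\<^bsub>?Q\<^esub> \<longleftrightarrow> (?p b) [^]\<^bsub>?Q\<^esub> k = \<one>\<^bsub>?Q\<^esub>" for k :: int
      using hom_int_pow[OF p ab(1) P.is_group Q, of k] hom_int_pow[OF p ab(2) P.is_group Q, of k]
        one[OF P.int_pow_closed[OF ab(1)], of k] one[OF P.int_pow_closed[OF ab(2)], of k] M(4)[of k] by simp
    then show ?thesis unfolding w by (rule ord_eqI[OF Q Q hom_in_carrier[OF p ab(1)] hom_in_carrier[OF p ab(2)]])
  qed
  have "?p s \<noteq> ?p h" if "(s, H) \<in> F" "h \<in> H" for s H h
    using P.rcos_eq_iff[OF M(1), of s h] M(3)[OF that] F(2)[OF that(1)] that(2) subgroup.mem_carrier by metis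
  then show ?thesis using that[OF Q _ p _ ord] M(2) by (simp add: FactGroup_def)
qed

text \<open>Q only has to keep the nontrivial powers of the element alive. P acts on Q by left
  translations, and an edge outside the tree by any bijection that intertwines its two
  generators.\<close>

lemma elliptic_finite_order:
  assumes compat: "\<And>e. e \<in> Ep \<Longrightarrow> order_compatible P (\<omega>g e) (\<alpha>g e)"
    and v: "v \<in> verts \<Gamma>" and x: "x \<in> carrier (Gv v)" and fin: "P.ord (\<iota> v x) \<noteq> 0"
  shows "virtual_retract (generate G {vx v x}) G"
proof -
  let ?x = "\<iota> v x"
  have xP: "?x \<in> carrier P" using \<iota>_closed[OF v x] .
  let ?F = "(\<lambda>i. (?x [^]\<^bsub>P\<^esub> i, {\<one>\<^bsub>P\<^esub>})) ` {0<..<int (P.ord ?x)}"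
  have F: "s \<in> carrier P \<and> subgroup H P \<and> s \<notin> H" if "(s, H) \<in> ?F" for s H
    using that xP P.triv_subgroup by (auto simp: P.int_pow_eq_id dest: zdvd_not_zless)
  obtain Q :: "'p set monoid" and p where Q: "group Q" "finite (carrier Q)" and p: "p \<in> hom P Q"
    and sep: "\<And>s H h. \<lbrakk>(s, H) \<in> ?F; h \<in> H\<rbrakk> \<Longrightarrow> p s \<noteq> p h"
    and ord: "\<And>e. e \<in> Ep \<Longrightarrow> group.ord Q (p (\<omega>g e)) = group.ord Q (p (\<alpha>g e))"
    by (rule finite_quotient[OF compat _ F]) auto
  interpret Q: group Q by fact
  \<comment> \<open>A single copy of Q; \<open>act\<close> is shared with the loxodromic case, which
    takes n copies.\<close>
  let ?X = "carrier Q \<times> {0::nat}"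
  let ?W = "perm_group ?X"
  have EpG: "e \<in> arcs \<Gamma>" if "e \<in> Ep" for e using that arcs_Ep(1) by blast
  have pc: "p y \<in> carrier Q" if "y \<in> carrier P" for y using hom_in_carrier[OF p that] .
  have finX: "finite ?X" using Q by simp
  have "\<exists>\<tau>. bij_betw \<tau> ?X ?X \<and> (\<forall>y\<in>?X. \<tau> (act Q (p (\<omega>g e)) y) = act Q (p (\<alpha>g e)) (\<tau> y))" if e: "e \<in> Ep" for e
  proof -
    have c: "p (\<omega>g e) \<in> carrier Q" "p (\<alpha>g e) \<in> carrier Q" using pc g_closed[OF EpG[OF e]] by auto
    have "free_cyclic_on (Q.ord (p (\<omega>g e))) (act Q (p (\<omega>g e))) ?X"
      "free_cyclic_on (Q.ord (p (\<omega>g e))) (act Q (p (\<alpha>g e))) ?X"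
      using Q.free_cyclic_on_act[OF Q(2) c(1)] Q.free_cyclic_on_act[OF Q(2) c(2)] ord[OF e] by auto
    then obtain \<tau> where "bij_betw \<tau> ?X ?X" "\<And>y. y \<in> ?X \<Longrightarrow> \<tau> (act Q (p (\<omega>g e)) y) = act Q (p (\<alpha>g e)) (\<tau> y)"
      \<comment> \<open>The empty matching: no values are prescribed.\<close>
      by (rule equivariant_extension[OF finX, of _ _ _ "{}"]) auto
    then show ?thesis by blast
  qed
  then obtain \<tau> where \<tau>: "\<And>e. e \<in> Ep \<Longrightarrow> bij_betw (\<tau> e) ?X ?X"
    "\<And>e y. e \<in> Ep \<Longrightarrow> y \<in> ?X \<Longrightarrow> \<tau> e (act Q (p (\<omega>g e)) y) = act Q (p (\<alpha>g e)) (\<tau> e y)" by metis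
  define lam where "lam y = ext_on ?X (act Q (p y))" for y
  have lamc: "lam y \<in> carrier ?W" if "y \<in> carrier P" for y
    unfolding lam_def by (rule ext_on_closed[OF Q.act_bij[OF pc[OF that]]])
  have lam: "lam \<in> hom P ?W"
  proof (rule homI)
    fix y z assume yz: "y \<in> carrier P" "z \<in> carrier P"
    show "lam (y \<otimes>\<^bsub>P\<^esub> z) = lam y \<otimes>\<^bsub>?W\<^esub> lam z"
      using Q.act_closed[OF pc[OF yz(2)], of _ "{0::nat}"] Q.act_act[OF pc[OF yz(1)] pc[OF yz(2)], of _ "{0::nat}"]
      by (simp add: lam_def ext_on_def perm_group_def fun_eq_iff hom_mult[OF p yz])
  qed (rule lamc)
  obtain \<Phi> where \<Phi>: "\<Phi> \<in> hom G ?W"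
    "\<And>v x. \<lbrakk>v \<in> verts \<Gamma>; x \<in> carrier (Gv v)\<rbrakk> \<Longrightarrow> \<Phi> (vx v x) = lam (\<iota> v x)"
  proof (rule representation_trivial_tree[OF group_perm_group lam, of "\<lambda>e. ext_on ?X (\<tau> e)"])
    fix e assume e: "e \<in> Ep - arcs T"
    then show "ext_on ?X (\<tau> e) \<in> carrier ?W" using ext_on_closed[OF \<tau>(1)] by blast
    have c: "p (\<omega>g e) \<in> carrier Q" using pc g_closed[OF EpG] e by auto
    have "\<tau> e y \<in> ?X" if "y \<in> ?X" for y using \<tau>(1)[of e] e that by (metis DiffD1 bij_betwE)
    then show "ext_on ?X (\<tau> e) \<otimes>\<^bsub>?W\<^esub> lam (\<omega>g e) = lam (\<alpha>g e) \<otimes>\<^bsub>?W\<^esub> ext_on ?X (\<tau> e)"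
      using Q.act_closed[OF c, of _ "{0::nat}"] \<tau>(2)[of e] e
      by (simp add: lam_def ext_on_def perm_group_def fun_eq_iff)
  qed auto
  show ?thesis
  proof (rule G.virtual_retract_finite_image[OF group_perm_group _ \<Phi>(1) vx_closed[OF v x]])
    show "finite (carrier ?W)" using finite_permutations[OF finX] by (simp add: perm_group_def)
    fix k :: int assume "\<Phi> (vx v x) [^]\<^bsub>?W\<^esub> k = \<one>\<^bsub>?W\<^esub>"
    then have "lam (?x [^]\<^bsub>P\<^esub> k) = \<one>\<^bsub>?W\<^esub>"
      using \<Phi>(2)[OF v x] hom_int_pow[OF lam xP P.is_group group_perm_group, of k] by simp
    then have "lam (?x [^]\<^bsub>P\<^esub> k) (\<one>\<^bsub>Q\<^esub>, 0) = (\<one>\<^bsub>Q\<^esub>, 0)" by (simp add: perm_group_def)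
    then have pk: "p (?x [^]\<^bsub>P\<^esub> k) = \<one>\<^bsub>Q\<^esub>" using pc[of "?x [^]\<^bsub>P\<^esub> k"] xP by (simp add: lam_def ext_on_def act_def)
    have "?x [^]\<^bsub>P\<^esub> (k mod int (P.ord ?x)) = ?x [^]\<^bsub>P\<^esub> k"
      using P.int_pow_eq[OF xP] by (metis dvd_minus_mod mod_eq_dvd_iff mod_mod_trivial)
    then have "p (?x [^]\<^bsub>P\<^esub> (k mod int (P.ord ?x))) = p \<one>\<^bsub>P\<^esub>" using pk hom_one[OF p P.is_group Q(1)] by simp
    then have "k mod int (P.ord ?x) \<notin> {0<..<int (P.ord ?x)}" using sep[of _ "{\<one>\<^bsub>P\<^esub>}" "\<one>\<^bsub>P\<^esub>"] by blast
    then have "int (P.ord ?x) dvd k" using fin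
      by (metis dvd_eq_mod_eq_0 greaterThanLessThan_iff of_nat_0_less_iff order_le_less pos_mod_bound pos_mod_sign zero_less_iff_neq_zero)
    then have "?x [^]\<^bsub>P\<^esub> k = \<one>\<^bsub>P\<^esub>" using P.int_pow_eq_id[OF xP] by simp
    then have "x [^]\<^bsub>Gv v\<^esub> k = \<one>\<^bsub>Gv v\<^esub>"
      using group.inj_hom_int_pow_eq_one[OF Gv_group[OF v] \<iota>_hom[OF v] P.is_group \<iota>_inj[OF v] x] by simp
    then show "vx v x [^]\<^bsub>G\<^esub> k = \<one>\<^bsub>G\<^esub>"
      using hom_int_pow[OF vx_hom[OF v] x Gv_group[OF v] G.is_group, of k] vx_one[OF v] by simp
  qed
qed

text \<open>The isometry \<open>y \<mapsto> \<plusminus>y + c\<close> of \<open>\<int>\<close> is encoded as an element of the wreath product of \<open>\<int>\<close> with the sign group.\<close>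

lemma elliptic_infinite_order:
  assumes compat: "\<And>e. e \<in> Ep \<Longrightarrow> order_compatible P (\<omega>g e) (\<alpha>g e)"
    and v: "v \<in> verts \<Gamma>" and x: "x \<in> carrier (Gv v)" and inf: "P.ord (\<iota> v x) = 0"
  shows "virtual_retract (generate G {vx v x}) G"
proof -
  let ?x = "\<iota> v x"
  have xP: "?x \<in> carrier P" using \<iota>_closed[OF v x] .
  have EpG: "e \<in> arcs \<Gamma>" if "e \<in> Ep" for e using that arcs_Ep(1) by blast
  obtain f where f: "f \<in> hom P integer_group" "f ?x \<noteq> 0"
    "\<And>e. e \<in> Ep - arcs T \<Longrightarrow> f (\<omega>g e) = f (\<alpha>g e) \<or> f (\<omega>g e) = - f (\<alpha>g e)"
  proof (cases "Ep - arcs T = {}")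
    case True
    have "order_compatible P \<one>\<^bsub>P\<^esub> \<one>\<^bsub>P\<^esub>" by (simp add: order_compatible_def)
    then show ?thesis
      using P.integer_character_order_compatible[OF fg_P P.one_closed P.one_closed _ xP inf] that True by blast
  next
    case False
    then obtain e where e: "e \<in> Ep - arcs T" by blast
    then obtain f where "f \<in> hom P integer_group" "f ?x \<noteq> 0" "f (\<omega>g e) = f (\<alpha>g e) \<or> f (\<omega>g e) = - f (\<alpha>g e)"
      using P.integer_character_order_compatible[OF fg_P g_closed[OF EpG] compat xP inf] by blast
    then show ?thesis using that nontree_unique[OF e] by metis
  qed
  interpret f: group_hom P integer_group f using f(1) by (simp add: group_hom_def group_hom_axioms_def P.is_group)
  let ?X = "{1, - 1 :: int}"
  let ?W = "shift_group ?X"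
  define lam where "lam y = wperm ?X id (\<lambda>s. s * f y)" for y
  \<comment> \<open>Exchanging the two signs conjugates \<open>lam y\<close> to its inverse, which
    is what the case of opposite values of f at the two ends calls for.\<close>
  define \<tau> where "\<tau> e = (if f (\<omega>g e) = f (\<alpha>g e) then wperm ?X id (\<lambda>_. 0) else wperm ?X uminus (\<lambda>_. 0))" for e
  have bij: "bij_betw id ?X ?X" "bij_betw uminus ?X ?X" by (auto simp: bij_betw_def inj_on_def)
  have lam: "lam \<in> hom P ?W"
  proof (rule homI)
    fix y z assume yz: "y \<in> carrier P" "z \<in> carrier P"
    show "lam (y \<otimes>\<^bsub>P\<^esub> z) = lam y \<otimes>\<^bsub>?W\<^esub> lam z"
      unfolding lam_def
      by (subst wperm_mult) (auto intro!: wperm_cong simp: f.hom_mult[OF yz])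
  qed (auto simp: lam_def intro: wperm_closed[OF bij(1)])
  obtain \<Phi> where \<Phi>: "\<Phi> \<in> hom G ?W"
    "\<And>v x. \<lbrakk>v \<in> verts \<Gamma>; x \<in> carrier (Gv v)\<rbrakk> \<Longrightarrow> \<Phi> (vx v x) = lam (\<iota> v x)"
  proof (rule representation_trivial_tree[OF group_shift_group lam, of \<tau>])
    fix e assume e: "e \<in> Ep - arcs T"
    show "\<tau> e \<in> carrier ?W" using wperm_closed[OF bij(1)] wperm_closed[OF bij(2)] by (simp add: \<tau>_def)
    show "\<tau> e \<otimes>\<^bsub>?W\<^esub> lam (\<omega>g e) = lam (\<alpha>g e) \<otimes>\<^bsub>?W\<^esub> \<tau> e"
      using f(3)[OF e] unfolding \<tau>_def lam_def
      by (auto simp: shift_group_def wperm_def fun_eq_iff)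
  qed auto
  have "\<Phi> (vx v x) (1, 0) = (1, f ?x)" by (simp add: \<Phi>(2)[OF v x] lam_def wperm_def)
  then show ?thesis
    using G.virtual_retract_translation[OF _ \<Phi>(1) vx_closed[OF v x], of 1 "f ?x"] f(2) by simp
qed

section \<open>Loxodromic elements\<close>

text \<open>The value at a new leaf is dictated by the edge that attaches it, and \<open>inv\<close>
  takes care of the reversed arc. With this potential tree letters are trivial in the representation
  even where \<sigma> is not.\<close>

lemma tree_potential:
  assumes W: "group W" and \<sigma>: "\<And>e. e \<in> arcs \<Gamma> \<Longrightarrow> \<sigma> e \<in> carrier W"
    and inv: "\<And>e. e \<in> arcs \<Gamma> \<Longrightarrow> \<sigma> (arev e) = inv\<^bsub>W\<^esub> \<sigma> e"
    and built: "tree_built \<Gamma> arev V E"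
  shows "\<exists>\<gamma>. (\<forall>v\<in>V. \<gamma> v \<in> carrier W) \<and> (\<forall>e\<in>E. \<gamma> (head \<Gamma> e) = \<gamma> (tail \<Gamma> e) \<otimes>\<^bsub>W\<^esub> \<sigma> e)"
  using built
proof induction
  case (root r)
  interpret W: group W by fact
  show ?case by (intro exI[of _ "\<lambda>_. \<one>\<^bsub>W\<^esub>"]) simp
next
  case (leaf V E e)
  interpret W: group W by fact
  obtain \<gamma> where \<gamma>: "\<And>v. v \<in> V \<Longrightarrow> \<gamma> v \<in> carrier W" "\<And>e. e \<in> E \<Longrightarrow> \<gamma> (head \<Gamma> e) = \<gamma> (tail \<Gamma> e) \<otimes>\<^bsub>W\<^esub> \<sigma> e"
    using leaf.IH by blast
  let ?\<gamma> = "\<gamma>(head \<Gamma> e := \<gamma> (tail \<Gamma> e) \<otimes>\<^bsub>W\<^esub> \<sigma> e)"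
  have ne: "tail \<Gamma> e \<noteq> head \<Gamma> e" using leaf.hyps by auto
  have old: "tail \<Gamma> f \<noteq> head \<Gamma> e" "head \<Gamma> f \<noteq> head \<Gamma> e" if "f \<in> E" for f
    using tree_built_subset(5)[OF leaf.hyps(1) that] leaf.hyps(4) by auto
  have c: "\<gamma> (tail \<Gamma> e) \<in> carrier W" "\<sigma> e \<in> carrier W" using \<gamma>(1) \<sigma> leaf.hyps by auto
  show ?case
    using \<gamma> old ne c leaf.hyps(2) inv[OF leaf.hyps(2)]
    by (intro exI[of _ ?\<gamma>]) (auto simp: W.m_assoc)
qed

text \<open>The image of a path word with the potential left out.\<close>

primrec path_prod :: "('w, 'm) monoid_scheme \<Rightarrow> ('e \<Rightarrow> 'w) \<Rightarrow> ('p \<Rightarrow> 'w) \<Rightarrow> ('e \<times> 'a) list \<Rightarrow> 'w" where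
  "path_prod W \<sigma> lam [] = \<one>\<^bsub>W\<^esub>"
| "path_prod W \<sigma> lam (q # ps) = \<sigma> (fst q) \<otimes>\<^bsub>W\<^esub> lam (\<iota> (head \<Gamma> (fst q)) (snd q)) \<otimes>\<^bsub>W\<^esub> path_prod W \<sigma> lam ps"

text \<open>The potentials of consecutive letters cancel along a path, so a closed path at v acts as
  the conjugate by \<open>\<gamma> v\<close> of the product without potentials.\<close>

lemma path_representation:
  assumes W: "group W" and lam: "lam \<in> hom P W"
    and \<sigma>: "\<And>e. e \<in> arcs \<Gamma> \<Longrightarrow> \<sigma> e \<in> carrier W"
    and inv: "\<And>e. e \<in> arcs \<Gamma> \<Longrightarrow> \<sigma> (arev e) = inv\<^bsub>W\<^esub> \<sigma> e"
    and rel: "\<And>e. e \<in> Ep \<Longrightarrow> \<sigma> e \<otimes>\<^bsub>W\<^esub> lam (\<omega>g e) = lam (\<alpha>g e) \<otimes>\<^bsub>W\<^esub> \<sigma> e"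
  obtains \<Phi> \<gamma> where "\<Phi> \<in> hom G W" "\<And>v. v \<in> verts \<Gamma> \<Longrightarrow> \<gamma> v \<in> carrier W"
    "\<And>u ps v. path_word u ps v \<Longrightarrow> path_prod W \<sigma> lam ps \<in> carrier W \<and>
       \<Phi> (path_eval ps) = \<gamma> u \<otimes>\<^bsub>W\<^esub> path_prod W \<sigma> lam ps \<otimes>\<^bsub>W\<^esub> inv\<^bsub>W\<^esub> \<gamma> v"
proof -
  interpret W: group W by fact
  obtain \<gamma> where \<gamma>: "\<And>v. v \<in> verts \<Gamma> \<Longrightarrow> \<gamma> v \<in> carrier W"
    "\<And>e. e \<in> arcs T \<Longrightarrow> \<gamma> (head \<Gamma> e) = \<gamma> (tail \<Gamma> e) \<otimes>\<^bsub>W\<^esub> \<sigma> e"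
    using tree_potential[OF W _ _ tree, of \<sigma>] \<sigma> inv by blast
  have EpG: "e \<in> arcs \<Gamma>" if "e \<in> Ep" for e using that arcs_Ep(1) by blast
  obtain \<Phi> where \<Phi>: "\<Phi> \<in> hom G W"
    "\<And>v x. \<lbrakk>v \<in> verts \<Gamma>; x \<in> carrier (Gv v)\<rbrakk> \<Longrightarrow> \<Phi> (vx v x) = \<gamma> v \<otimes>\<^bsub>W\<^esub> lam (\<iota> v x) \<otimes>\<^bsub>W\<^esub> inv\<^bsub>W\<^esub> \<gamma> v"
    "\<And>e. e \<in> Ep \<Longrightarrow> \<Phi> (st e) = \<gamma> (tail \<Gamma> e) \<otimes>\<^bsub>W\<^esub> \<sigma> e \<otimes>\<^bsub>W\<^esub> inv\<^bsub>W\<^esub> \<gamma> (head \<Gamma> e)"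
    by (rule representation[OF W lam, of \<sigma> \<gamma>]) (use \<sigma> rel \<gamma> EpG in auto)
  interpret \<Phi>: group_hom G W \<Phi> using \<Phi>(1) by unfold_locales
  have cancel: "inv\<^bsub>W\<^esub> a \<otimes>\<^bsub>W\<^esub> (a \<otimes>\<^bsub>W\<^esub> b) = b" if "a \<in> carrier W" "b \<in> carrier W" for a b
    using that by (simp flip: W.m_assoc)
  have st: "\<Phi> (st e) = \<gamma> (tail \<Gamma> e) \<otimes>\<^bsub>W\<^esub> \<sigma> e \<otimes>\<^bsub>W\<^esub> inv\<^bsub>W\<^esub> \<gamma> (head \<Gamma> e)" if e: "e \<in> arcs \<Gamma>" for e
  proof (cases "e \<in> Ep")
    case False
    then have r: "arev e \<in> Ep" using arcs_Ep(1) e by blast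
    have "st e = inv\<^bsub>G\<^esub> st (arev e)" using st_arev[OF EpG[OF r]] arev_arev' by simp
    then have "\<Phi> (st e) = inv\<^bsub>W\<^esub> (\<gamma> (head \<Gamma> e) \<otimes>\<^bsub>W\<^esub> inv\<^bsub>W\<^esub> \<sigma> e \<otimes>\<^bsub>W\<^esub> inv\<^bsub>W\<^esub> \<gamma> (tail \<Gamma> e))"
      using \<Phi>(3)[OF r] \<Phi>.hom_inv[OF st_closed[OF EpG[OF r]]] e inv[OF e] by simp
    then show ?thesis using \<gamma>(1) \<sigma>[OF e] e by (simp add: W.inv_mult_group W.m_assoc)
  qed (rule \<Phi>(3))
  have "path_prod W \<sigma> lam ps \<in> carrier W \<and>
      \<Phi> (path_eval ps) = \<gamma> u \<otimes>\<^bsub>W\<^esub> path_prod W \<sigma> lam ps \<otimes>\<^bsub>W\<^esub> inv\<^bsub>W\<^esub> \<gamma> v" if "path_word u ps v" for u ps v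
    using that
  proof (induction u ps v rule: path_word.induct)
    case (1 u v)
    then show ?case using \<gamma>(1)[of v] by auto
  next
    case (2 u e x ps v)
    then have e: "e \<in> arcs \<Gamma>" "tail \<Gamma> e = u" and x: "x \<in> carrier (Gv (head \<Gamma> e))"
      and pw: "path_word (head \<Gamma> e) ps v" by auto
    have hv: "head \<Gamma> e \<in> verts \<Gamma>" using e by simp
    have vv: "v \<in> verts \<Gamma>" "u \<in> verts \<Gamma>" using path_word_verts[OF pw] e by auto
    have c: "path_prod W \<sigma> lam ps \<in> carrier W" "lam (\<iota> (head \<Gamma> e) x) \<in> carrier W" "\<gamma> u \<in> carrier W"
      "\<gamma> v \<in> carrier W" "\<gamma> (head \<Gamma> e) \<in> carrier W" "\<sigma> e \<in> carrier W"
      using 2(1)[OF pw] hom_in_carrier[OF lam \<iota>_closed[OF hv x]] \<gamma>(1) hv vv \<sigma>[OF e(1)] by auto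
    have "\<Phi> (path_eval ((e, x) # ps)) = \<Phi> (st e) \<otimes>\<^bsub>W\<^esub> \<Phi> (vx (head \<Gamma> e) x) \<otimes>\<^bsub>W\<^esub> \<Phi> (path_eval ps)"
      using st_closed[OF e(1)] vx_closed[OF hv x] path_eval_closed[OF pw] by simp
    then show ?case using st[OF e(1)] \<Phi>(2)[OF hv x] 2(1)[OF pw] c e(2)
      by (simp add: W.m_assoc cancel)
  qed
  then show ?thesis using that[of \<Phi> \<gamma>] \<Phi>(1) \<gamma>(1) by blast
qed

text \<open>Step \<open>j\<close> of the path prescribes one value of the permutation belonging to its edge: it has to move
  \<open>(q\<^sub>j, j + 1)\<close> to \<open>(1, j)\<close>. The path being cyclically reduced, these prescriptions live on different
  orbits of the edge group. Giving the orbit of step \<open>0\<close> weight one makes the path act as a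
  nontrivial translation.\<close>

lemma loxodromic:
  assumes compat: "\<And>e. e \<in> Ep \<Longrightarrow> order_compatible P (\<omega>g e) (\<alpha>g e)"
    and pw: "path_word v ps v" and ne: "ps \<noteq> []" and red: "cyclically_reduced ps"
  shows "virtual_retract (generate G {path_eval ps}) G"
proof -
  define n where "n = length ps"
  have n: "n > 0" using ne by (simp add: n_def)
  define E where "E j = fst (ps ! j)" for j
  define s where "s j = \<iota> (head \<Gamma> (E j)) (snd (ps ! j))" for j
  define nx where "nx j = Suc j mod n" for j
  have EpG: "e \<in> arcs \<Gamma>" if "e \<in> Ep" for e using that arcs_Ep(1) by blast
  have steps: "e \<in> arcs \<Gamma> \<and> x \<in> carrier (Gv (head \<Gamma> e))" if "(e, x) \<in> set ps" for e x
  proof -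
    have "path_word u qs w \<Longrightarrow> (e, x) \<in> set qs \<Longrightarrow> e \<in> arcs \<Gamma> \<and> x \<in> carrier (Gv (head \<Gamma> e))" for u qs w
      by (induction u qs w rule: path_word.induct) auto
    then show ?thesis using pw that by blast
  qed
  have step: "E j \<in> arcs \<Gamma>" "snd (ps ! j) \<in> carrier (Gv (head \<Gamma> (E j)))" "s j \<in> carrier P" if "j < n" for j
  proof -
    have "(E j, snd (ps ! j)) \<in> set ps" using that by (simp add: E_def n_def)
    then show "E j \<in> arcs \<Gamma>" "snd (ps ! j) \<in> carrier (Gv (head \<Gamma> (E j)))" using steps by blast+
    then show "s j \<in> carrier P" using \<iota>_closed by (simp add: s_def)
  qed
  \<comment> \<open>Where the path turns back, reducedness keeps \<open>s j\<close> out of the edge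
    subgroup. These are the pairs that Q is made to separate.\<close>
  have turn: "s j \<notin> generate P {\<omega>g (E j)}" if "j < n" "E (nx j) = arev (E j)" for j
    using red that edge_image_mem[OF step(1,2)[OF that(1)]]
    unfolding cyclically_reduced_def E_def s_def nx_def n_def by blast
  let ?F = "(\<lambda>j. (s j, generate P {\<omega>g (E j)})) ` {j. j < n \<and> E (nx j) = arev (E j)}"
  have F: "t \<in> carrier P \<and> subgroup H P \<and> t \<notin> H" if tH: "(t, H) \<in> ?F" for t H
  proof -
    obtain j where j: "j < n" "E (nx j) = arev (E j)" "t = s j" "H = generate P {\<omega>g (E j)}" using tH by blast
    have "subgroup H P" unfolding j(4) by (rule P.generate_is_subgroup) (use g_closed(1)[OF step(1)[OF j(1)]] in simp)
    then show ?thesis using step(3)[OF j(1)] turn[OF j(1,2)] j(3,4) by simp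
  qed
  obtain Q :: "'p set monoid" and p where Q: "group Q" "finite (carrier Q)" and p: "p \<in> hom P Q"
    and sep: "\<And>t H h. \<lbrakk>(t, H) \<in> ?F; h \<in> H\<rbrakk> \<Longrightarrow> p t \<noteq> p h"
    and ord: "\<And>e. e \<in> Ep \<Longrightarrow> group.ord Q (p (\<omega>g e)) = group.ord Q (p (\<alpha>g e))"
    by (rule finite_quotient[OF compat _ F]) auto
  interpret Q: group Q by fact
  have pc: "p y \<in> carrier Q" if "y \<in> carrier P" for y using hom_in_carrier[OF p that] .
  define q where "q j = p (s j)" for j
  have qc: "q j \<in> carrier Q" if "j < n" for j unfolding q_def by (rule pc[OF step(3)[OF that]])
  have sepq: "q j \<noteq> p (\<omega>g (E j)) [^]\<^bsub>Q\<^esub> k" if j: "j < n" "E (nx j) = arev (E j)" for j and k :: nat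
  proof -
    note oc = g_closed(1)[OF step(1)[OF j(1)]]
    have "\<omega>g (E j) [^]\<^bsub>P\<^esub> int k \<in> generate P {\<omega>g (E j)}" using P.generate_pow[OF oc] by blast
    then have "q j \<noteq> p (\<omega>g (E j) [^]\<^bsub>P\<^esub> int k)" unfolding q_def using sep j by blast
    then show ?thesis using hom_int_pow[OF p oc P.is_group Q(1), of "int k"] by (simp add: int_pow_int)
  qed
  let ?X = "carrier Q \<times> {..<n}"
  let ?W = "shift_group ?X"
  have finX: "finite ?X" using Q by simp
  \<comment> \<open>The vertex element \<open>s j\<close> takes \<open>lo (nx j)\<close> to
    \<open>hi j\<close>, and the edge of step j then has to take \<open>hi j\<close> to
    \<open>lo j\<close>.\<close>
  define hi where "hi j = (q j, nx j)" for j
  define lo where "lo j = (\<one>\<^bsub>Q\<^esub>, j)" for j :: nat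
  have nxn: "nx j < n" for j using n by (simp add: nx_def)
  have nx_inj: "i = j" if "nx i = nx j" "i < n" "j < n" for i j
    using that unfolding nx_def by (auto simp: mod_Suc split: if_splits)
  have hiX: "hi j \<in> ?X" and loX: "lo j \<in> ?X" if "j < n" for j using qc[OF that] nxn that by (auto simp: hi_def lo_def)
  have opow: "(act Q (p (\<omega>g e)) ^^ k) (x, j) = (p (\<omega>g e) [^]\<^bsub>Q\<^esub> k \<otimes>\<^bsub>Q\<^esub> x, j)"
    if "e \<in> arcs \<Gamma>" "x \<in> carrier Q" for e k x and j :: nat
    using Q.act_funpow[OF pc[OF g_closed(1)[OF that(1)]] that(2)] .
  have oo: "(act Q (p (\<omega>g e)) ^^ k) (hi i) = hi j \<Longrightarrow> i = j" if "e \<in> arcs \<Gamma>" "i < n" "j < n" for e i j k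
    using opow[OF that(1) qc[OF that(2)]] nx_inj that by (auto simp: hi_def)
  have ll: "(act Q (p (\<omega>g e)) ^^ k) (lo i) = lo j \<Longrightarrow> i = j" if "e \<in> arcs \<Gamma>" for e i j k
    using opow[OF that Q.one_closed] by (auto simp: lo_def)
  \<comment> \<open>The second coordinates force i = nx j, so step i follows step j and the path
    turns back there; then q j would be a power of the edge generator, which Q excludes.\<close>
  have lo_hi: "(act Q (p (\<omega>g (E j))) ^^ k) (lo i) \<noteq> hi j" if "i < n" "j < n" "E i = arev (E j)" for i j k
  proof
    assume "(act Q (p (\<omega>g (E j))) ^^ k) (lo i) = hi j"
    then have "p (\<omega>g (E j)) [^]\<^bsub>Q\<^esub> k = q j" "i = nx j"
      using opow[OF step(1)[OF that(2)] Q.one_closed, of k i] pc[OF g_closed(1)[OF step(1)[OF that(2)]]]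
      by (auto simp: hi_def lo_def)
    then show False using sepq[OF that(2), of k] that(3) by simp
  qed
  have free: "free_cyclic_on (Q.ord (p (\<omega>g e))) (act Q (p (\<omega>g e))) ?X" if "e \<in> arcs \<Gamma>" for e
    by (rule Q.free_cyclic_on_act[OF Q(2) pc[OF g_closed(1)[OF that]]])
  have hi_lo: "(act Q (p (\<omega>g (E j))) ^^ k) (hi j) \<noteq> lo i" if "i < n" "j < n" "E i = arev (E j)" for i j k
    using lo_hi[OF that] free_cyclic_on_funpow(2)[OF free[OF step(1)[OF that(2)]] hiX[OF that(2)]] by blast
  \<comment> \<open>A step that runs against the orientation of e prescribes a value of the inverse
    permutation.\<close>
  define L where "L e = {(hi j, lo j) | j. j < n \<and> E j = e} \<union> {(lo j, hi j) | j. j < n \<and> E j = arev e}" for e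
  have LE: "\<exists>j<n. (a = (hi j, lo j) \<and> E j = e) \<or> (a = (lo j, hi j) \<and> E j = arev e)" if "a \<in> L e" for a e
    using that by (auto simp: L_def)
  have Ldom: "a = b" if e: "e \<in> Ep" and a: "a \<in> L e" and b: "b \<in> L e"
    and eq: "(act Q (p (\<omega>g e)) ^^ k) (fst a) = fst b" for e a b k
  proof -
    obtain i where i: "i < n" "(a = (hi i, lo i) \<and> E i = e) \<or> (a = (lo i, hi i) \<and> E i = arev e)"
      using LE[OF a] by blast
    obtain j where j: "j < n" "(b = (hi j, lo j) \<and> E j = e) \<or> (b = (lo j, hi j) \<and> E j = arev e)"
      using LE[OF b] by blast
    note ij = i(1) j(1) i(2) j(2)
    from ij(3,4) show ?thesis
    proof (elim disjE conjE)
      assume "a = (hi i, lo i)" "b = (hi j, lo j)"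
      then show ?thesis using eq oo[OF EpG[OF e] ij(1,2), of k] by simp
    next
      assume "a = (hi i, lo i)" "E i = e" "b = (lo j, hi j)" "E j = arev e"
      then show ?thesis using eq hi_lo[OF ij(2,1), of k] by simp
    next
      assume "a = (lo i, hi i)" "E i = arev e" "b = (hi j, lo j)" "E j = e"
      then show ?thesis using eq lo_hi[OF ij(1,2), of k] by simp
    next
      assume "a = (lo i, hi i)" "b = (lo j, hi j)"
      then show ?thesis using eq ll[OF EpG[OF e], of k i j] by simp
    qed
  qed
  have rev_og: "\<alpha>g e = \<omega>g (arev e)" if "e \<in> Ep" for e using \<omega>g_arev[OF EpG[OF that]] by simp
  \<comment> \<open>The target side is the source side of \<open>arev e\<close>, with the roles of
    \<open>hi\<close> and \<open>lo\<close> exchanged.\<close>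
  have Lran: "a = b" if e: "e \<in> Ep" and a: "a \<in> L e" and b: "b \<in> L e"
    and eq: "(act Q (p (\<alpha>g e)) ^^ k) (snd a) = snd b" for e a b k
  proof -
    have r: "arev e \<in> arcs \<Gamma>" "e = arev (arev e)" using EpG[OF e] arev_arev' by auto
    obtain i where i: "i < n" "(a = (hi i, lo i) \<and> E i = e) \<or> (a = (lo i, hi i) \<and> E i = arev e)"
      using LE[OF a] by blast
    obtain j where j: "j < n" "(b = (hi j, lo j) \<and> E j = e) \<or> (b = (lo j, hi j) \<and> E j = arev e)"
      using LE[OF b] by blast
    note ij = i(1) j(1) i(2) j(2)
    note eq' = eq[unfolded rev_og[OF e]]
    from ij(3,4) show ?thesis
    proof (elim disjE conjE)
      assume "a = (hi i, lo i)" "b = (hi j, lo j)"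
      then show ?thesis using eq' ll[OF r(1), of k i j] by simp
    next
      assume "a = (hi i, lo i)" "E i = e" "b = (lo j, hi j)" "E j = arev e"
      then show ?thesis using eq' lo_hi[OF ij(1,2), of k] r(2) by simp
    next
      assume "a = (lo i, hi i)" "E i = arev e" "b = (hi j, lo j)" "E j = e"
      then show ?thesis using eq' hi_lo[OF ij(2,1), of k] r(2) by simp
    next
      assume "a = (lo i, hi i)" "b = (lo j, hi j)"
      then show ?thesis using eq' oo[OF r(1) ij(1,2), of k] by simp
    qed
  qed
  have "\<exists>\<tau>. bij_betw \<tau> ?X ?X \<and> (\<forall>y\<in>?X. \<tau> (act Q (p (\<omega>g e)) y) = act Q (p (\<alpha>g e)) (\<tau> y)) \<and>
      (\<forall>a\<in>L e. \<tau> (fst a) = snd a)" if e: "e \<in> Ep" for e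
  proof -
    have c: "p (\<alpha>g e) \<in> carrier Q" using pc g_closed[OF EpG[OF e]] by auto
    have fa: "free_cyclic_on (Q.ord (p (\<omega>g e))) (act Q (p (\<alpha>g e))) ?X"
      using Q.free_cyclic_on_act[OF Q(2) c] ord[OF e] by auto
    have LX: "L e \<subseteq> ?X \<times> ?X"
    proof
      fix a assume "a \<in> L e"
      then obtain j where "j < n" "a = (hi j, lo j) \<or> a = (lo j, hi j)" using LE by blast
      then show "a \<in> ?X \<times> ?X" using SigmaI[OF hiX loX, of j j] SigmaI[OF loX hiX, of j j] by blast
    qed
    show ?thesis
    proof (rule equivariant_extension[OF finX free[OF EpG[OF e]] fa LX Ldom[OF e] Lran[OF e]])
      fix \<tau> assume "bij_betw \<tau> ?X ?X" "\<And>y. y \<in> ?X \<Longrightarrow> \<tau> (act Q (p (\<omega>g e)) y) = act Q (p (\<alpha>g e)) (\<tau> y)"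
        "\<And>x y. (x, y) \<in> L e \<Longrightarrow> \<tau> x = y"
      then show ?thesis by (intro exI[of _ \<tau>]) auto
    qed
  qed
  then obtain \<tau> where \<tau>: "\<And>e. e \<in> Ep \<Longrightarrow> bij_betw (\<tau> e) ?X ?X"
    "\<And>e y. e \<in> Ep \<Longrightarrow> y \<in> ?X \<Longrightarrow> \<tau> e (act Q (p (\<omega>g e)) y) = act Q (p (\<alpha>g e)) (\<tau> e y)"
    "\<And>e a. e \<in> Ep \<Longrightarrow> a \<in> L e \<Longrightarrow> \<tau> e (fst a) = snd a" by metis
  \<comment> \<open>\<open>e0\<close> is the edge of step 0 taken with positive orientation, and
    \<open>x0\<close> is the source of the pair that this step prescribes for it.\<close>
  define e0 where "e0 = (if E 0 \<in> Ep then E 0 else arev (E 0))"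
  define x0 where "x0 = (if E 0 \<in> Ep then hi 0 else lo 0)"
  define w :: "'e \<Rightarrow> 'p set \<times> nat \<Rightarrow> int" where
    "w e x = (if e = e0 \<and> (\<exists>k. (act Q (p (\<omega>g e)) ^^ k) x0 = x) then 1 else 0)" for e x
  have x0X: "x0 \<in> ?X" using hiX[OF n] loX[OF n] by (simp add: x0_def)
  \<comment> \<open>The weight is constant on orbits of the edge generator, so the weighted
    permutation still intertwines the two actions of P, which carry no weight.\<close>
  have winv: "w e (act Q (p (\<omega>g e)) x) = w e x" if e: "e \<in> Ep" and xX: "x \<in> ?X" for e x
  proof -
    let ?c = "act Q (p (\<omega>g e)) :: 'p set \<times> nat \<Rightarrow> 'p set \<times> nat"
    have "(\<exists>k. (?c ^^ k) x0 = ?c x) \<longleftrightarrow> (\<exists>k. (?c ^^ k) x0 = x)"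
    proof
      assume "\<exists>k. (?c ^^ k) x0 = x"
      then obtain k where "(?c ^^ k) x0 = x" by blast
      then have "(?c ^^ Suc k) x0 = ?c x" by simp
      then show "\<exists>k. (?c ^^ k) x0 = ?c x" by blast
    next
      assume "\<exists>k. (?c ^^ k) x0 = ?c x"
      then obtain k where k: "(?c ^^ k) x0 = (?c ^^ 1) x" by auto
      obtain j where "(?c ^^ j) ((?c ^^ 1) x) = x"
        using free_cyclic_on_funpow(2)[OF free[OF EpG[OF e]] xX] by blast
      then have "(?c ^^ (j + k)) x0 = x" by (simp only: funpow_add comp_apply k)
      then show "\<exists>k. (?c ^^ k) x0 = x" by blast
    qed
    then show ?thesis by (simp add: w_def)
  qed
  define \<tau>w where "\<tau>w e = wperm ?X (\<tau> e) (w e)" for e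
  define \<sigma> where "\<sigma> e = (if e \<in> Ep then \<tau>w e else inv\<^bsub>?W\<^esub> \<tau>w (arev e))" for e
  define lam where "lam y = wperm ?X (act Q (p y)) (\<lambda>_. 0)" for y
  interpret W: group ?W by (rule group_shift_group)
  have \<tau>X: "\<tau> e y \<in> ?X" if "e \<in> Ep" "y \<in> ?X" for e y using \<tau>(1)[OF that(1)] that(2) by (rule bij_betwE[THEN bspec])
  have actX: "act Q (p y) x \<in> ?X" if "y \<in> carrier P" "x \<in> ?X" for y x by (rule Q.act_closed[OF pc[OF that(1)] that(2)])
  have \<tau>w: "\<tau>w e \<in> carrier ?W" if "e \<in> Ep" for e unfolding \<tau>w_def by (rule wperm_closed[OF \<tau>(1)[OF that]])
  have \<sigma>: "\<sigma> e \<in> carrier ?W" if "e \<in> arcs \<Gamma>" for e using that \<tau>w arcs_Ep(1)[of e] by (auto simp: \<sigma>_def)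
  have \<sigma>inv: "\<sigma> (arev e) = inv\<^bsub>?W\<^esub> \<sigma> e" if "e \<in> arcs \<Gamma>" for e
    using that \<tau>w arcs_Ep(1)[of e] arcs_Ep(2)[of e] arev_arev'[of e] by (auto simp: \<sigma>_def)
  have lam: "lam \<in> hom P ?W"
  proof (rule homI)
    fix y z assume yz: "y \<in> carrier P" "z \<in> carrier P"
    show "lam (y \<otimes>\<^bsub>P\<^esub> z) = lam y \<otimes>\<^bsub>?W\<^esub> lam z"
      unfolding lam_def
      by (subst wperm_mult, rule actX[OF yz(2)], assumption, rule wperm_cong)
        (simp_all only: comp_apply hom_mult[OF p yz] Q.act_act[OF pc[OF yz(1)] pc[OF yz(2)]] add_0)
  qed (unfold lam_def, rule wperm_closed[OF Q.act_bij[OF pc]])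
  have rel: "\<sigma> e \<otimes>\<^bsub>?W\<^esub> lam (\<omega>g e) = lam (\<alpha>g e) \<otimes>\<^bsub>?W\<^esub> \<sigma> e" if e: "e \<in> Ep" for e
  proof -
    have se: "\<sigma> e = wperm ?X (\<tau> e) (w e)" using e by (simp add: \<sigma>_def \<tau>w_def)
    show ?thesis
      unfolding se lam_def
      by (subst wperm_mult, rule actX[OF g_closed(1)[OF EpG[OF e]]], assumption,
          subst wperm_mult, rule \<tau>X[OF e], assumption, rule wperm_cong)
        (simp_all only: comp_apply \<tau>(2)[OF e] winv[OF e] add_0 add_0_right)
  qed
  obtain \<Phi> \<gamma> where \<Phi>: "\<Phi> \<in> hom G ?W" "\<And>v. v \<in> verts \<Gamma> \<Longrightarrow> \<gamma> v \<in> carrier ?W"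
    "\<And>u ps v. path_word u ps v \<Longrightarrow> path_prod ?W \<sigma> lam ps \<in> carrier ?W \<and>
       \<Phi> (path_eval ps) = \<gamma> u \<otimes>\<^bsub>?W\<^esub> path_prod ?W \<sigma> lam ps \<otimes>\<^bsub>?W\<^esub> inv\<^bsub>?W\<^esub> \<gamma> v"
    using path_representation[OF group_shift_group lam \<sigma> \<sigma>inv rel] by blast
  \<comment> \<open>The sign tells whether step 0 traverses \<open>e0\<close> forwards or
    backwards.\<close>
  define \<delta> :: int where "\<delta> = (if E 0 \<in> Ep then 1 else - 1)"
  have Wmult: "(f \<otimes>\<^bsub>?W\<^esub> g) y = f (g y)" for f g y by (simp add: shift_group_def)
  have \<tau>w_app: "\<tau>w e (y, z) = (\<tau> e y, z + w e y)" if "y \<in> ?X" for e y z using that by (simp add: \<tau>w_def wperm_def)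
  \<comment> \<open>Any other step along the same edge is prescribed on a different orbit, so step 0
    alone picks up the weight.\<close>
  have w_hi: "w (E j) (hi j) = (if j = 0 then 1 else 0)" if j: "j < n" "E j \<in> Ep" for j
  proof (cases "j = 0")
    case True
    then have "E j = e0" "(act Q (p (\<omega>g (E j))) ^^ 0) x0 = hi j" using j by (simp_all add: e0_def x0_def)
    then have "w (E j) (hi j) = 1" unfolding w_def by metis
    then show ?thesis using True by simp
  next
    case False
    have "\<not> (E j = e0 \<and> (\<exists>k. (act Q (p (\<omega>g (E j))) ^^ k) x0 = hi j))"
    proof (cases "E 0 \<in> Ep")
      case True
      then show ?thesis using oo[OF step(1)[OF j(1)] n j(1)] False by (auto simp: x0_def)
    next
      case no: False
      then have "x0 = lo 0" "E j = e0 \<Longrightarrow> E 0 = arev (E j)" by (simp_all add: x0_def e0_def arev_arev')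
      then show ?thesis using lo_hi[OF n j(1)] by metis
    qed
    then have "w (E j) (hi j) = 0" by (simp add: w_def)
    then show ?thesis using False by simp
  qed
  have w_lo: "w (arev (E j)) (lo j) = (if j = 0 then 1 else 0)" if j: "j < n" "E j \<notin> Ep" for j
  proof (cases "j = 0")
    case True
    then have "arev (E j) = e0" "(act Q (p (\<omega>g (arev (E j)))) ^^ 0) x0 = lo j" using j by (simp_all add: e0_def x0_def)
    then have "w (arev (E j)) (lo j) = 1" unfolding w_def by metis
    then show ?thesis using True by simp
  next
    case False
    have r: "arev (E j) \<in> arcs \<Gamma>" using step(1)[OF j(1)] by simp
    have "\<not> (arev (E j) = e0 \<and> (\<exists>k. (act Q (p (\<omega>g (arev (E j)))) ^^ k) x0 = lo j))"
    proof (cases "E 0 \<in> Ep")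
      case True
      then have "x0 = hi 0" "e0 = E 0" by (simp_all add: x0_def e0_def)
      moreover have "arev (E j) = E 0 \<Longrightarrow> E j = arev (E 0)" using arev_arev' by metis
      ultimately show ?thesis using hi_lo[OF j(1) n] by metis
    next
      case no: False
      then show ?thesis using ll[OF r] False by (auto simp: x0_def)
    qed
    then have "w (arev (E j)) (lo j) = 0" by (simp add: w_def)
    then show ?thesis using False by simp
  qed
  have move: "(\<sigma> (E j) \<otimes>\<^bsub>?W\<^esub> lam (s j)) (lo (nx j), z) = (lo j, z + (if j = 0 then \<delta> else 0))"
    if j: "j < n" for j z
  proof -
    have l: "lam (s j) (lo (nx j), z) = (hi j, z)"
      using loX[OF nxn[of j]] qc[OF j] by (simp add: lam_def wperm_def act_def lo_def hi_def q_def)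
    have m: "(\<sigma> (E j) \<otimes>\<^bsub>?W\<^esub> lam (s j)) (lo (nx j), z) = \<sigma> (E j) (hi j, z)" by (simp add: Wmult l)
    show ?thesis
    proof (cases "E j \<in> Ep")
      case True
      have "(hi j, lo j) \<in> L (E j)" using j by (auto simp: L_def)
      then have "\<tau> (E j) (hi j) = lo j" using \<tau>(3)[OF True] by fastforce
      then have "\<sigma> (E j) (hi j, z) = (lo j, z + (if j = 0 then 1 else 0))"
        using True \<tau>w_app[OF hiX[OF j]] w_hi[OF j True] by (simp add: \<sigma>_def)
      then show ?thesis unfolding m using True by (cases "j = 0") (auto simp: \<delta>_def)
    next
      case False
      let ?f = "arev (E j)"
      have f: "?f \<in> Ep" using False step(1)[OF j] arcs_Ep(1) by blast
      have "(lo j, hi j) \<in> L ?f" using j by (auto simp: L_def arev_arev')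
      then have "\<tau> ?f (lo j) = hi j" using \<tau>(3)[OF f] by fastforce
      then have "\<tau>w ?f (lo j, z - w ?f (lo j)) = (hi j, z)" using \<tau>w_app[OF loX[OF j]] by simp
      moreover have "(inv\<^bsub>?W\<^esub> \<tau>w ?f) (\<tau>w ?f y) = y" for y
        using W.l_inv[OF \<tau>w[OF f]] Wmult[of "inv\<^bsub>?W\<^esub> \<tau>w ?f" "\<tau>w ?f" y] by (simp add: shift_group_def)
      ultimately have "(inv\<^bsub>?W\<^esub> \<tau>w ?f) (hi j, z) = (lo j, z - w ?f (lo j))" by metis
      then show ?thesis unfolding m using False w_lo[OF j False] by (cases "j = 0") (auto simp: \<delta>_def \<sigma>_def)
    qed
  qed
  \<comment> \<open>The last letter acts first, so the induction descends from j = n; there j mod n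
    = 0 names the starting copy.\<close>
  have run: "path_prod ?W \<sigma> lam (drop j ps) (lo 0, 0) = (lo (j mod n), if j = 0 then \<delta> else 0)" if "j \<le> n" for j
    using that
  proof (induction j rule: inc_induct)
    case base
    then show ?case using n by (simp add: n_def shift_group_def)
  next
    case (step j)
    have "drop j ps = ps ! j # drop (Suc j) ps" using step.hyps by (simp add: Cons_nth_drop_Suc n_def)
    then have "path_prod ?W \<sigma> lam (drop j ps) (lo 0, 0)
        = (\<sigma> (E j) \<otimes>\<^bsub>?W\<^esub> lam (s j)) (path_prod ?W \<sigma> lam (drop (Suc j) ps) (lo 0, 0))"
      by (simp add: Wmult E_def s_def)
    then show ?case using step.IH move[OF step.hyps(2), of 0] step.hyps(2) by (simp add: nx_def)
  qed
  have vv: "v \<in> verts \<Gamma>" using path_word_verts[OF pw] by blast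
  have gc: "\<gamma> v \<in> carrier ?W" by (rule \<Phi>(2)[OF vv])
  obtain y z where yz: "\<gamma> v (lo 0, 0) = (y, z)" by (rule prod.exhaust)
  have shift: "f (a, b + k) = shift k (f (a, b))" if "f \<in> carrier ?W" for f a b k
  proof -
    have "f \<circ> shift k = shift k \<circ> f" using that by (simp add: shift_group_def)
    then have "(f \<circ> shift k) (a, b) = (shift k \<circ> f) (a, b)" by simp
    then show ?thesis by (simp add: shift_def)
  qed
  have perm: "\<gamma> v permutes ?X \<times> UNIV" using gc by (simp add: shift_group_def)
  have yX: "y \<in> ?X"
    using permutes_in_image[OF perm, of "(lo 0, 0)"] loX[OF n] unfolding yz by blast
  have gP: "\<Phi> (path_eval ps) \<in> carrier ?W"
    using \<Phi>(1) path_eval_closed[OF pw] by (rule hom_in_carrier)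
  have "(inv\<^bsub>?W\<^esub> \<gamma> v) (y, z) = (lo 0, 0)"
    using W.l_inv[OF gc] Wmult[of "inv\<^bsub>?W\<^esub> \<gamma> v" "\<gamma> v" "(lo 0, 0)"] yz by (simp add: shift_group_def)
  then have "\<Phi> (path_eval ps) (y, z) = \<gamma> v (lo 0, \<delta>)"
    using \<Phi>(3)[OF pw] run[of 0] n by (simp add: Wmult)
  also have "\<dots> = (y, z + \<delta>)" using shift[OF gc, of "lo 0" 0 \<delta>] yz by (simp add: shift_def)
  \<comment> \<open>Commuting with translations allows the height z to be moved to 0.\<close>
  finally have "\<Phi> (path_eval ps) (y, 0) = (y, \<delta>)"
    using shift[OF gP, of y z "- z"] by (simp add: shift_def)
  moreover have "\<delta> \<noteq> 0" by (simp add: \<delta>_def)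
  ultimately show ?thesis
    using G.virtual_retract_translation[OF finX \<Phi>(1) path_eval_closed[OF pw] yX] by blast
qed

proposition balanced_imp_VRC:
  assumes bal: "balanced G" shows "VRC G"
  unfolding VRC_def
proof (intro allI impI)
  fix H assume H: "subgroup H G \<and> cyclic_group (G\<lparr>carrier := H\<rparr>)"
  then obtain g where g: "g \<in> H" "H = generate G {g}"
    by (elim conjE) (rule G.cyclic_subgroup_eq_generate)
  have gc: "g \<in> carrier G" using subgroup.mem_carrier[OF conjunct1[OF H] g(1)] .
  note compat = balanced_order_compatible[OF bal]
  obtain h where h: "h \<in> carrier G" "elliptic_or_reduced (h \<otimes>\<^bsub>G\<^esub> g \<otimes>\<^bsub>G\<^esub> inv\<^bsub>G\<^esub> h)"
    using conj_reduced[OF gc] by blast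
  let ?g = "h \<otimes>\<^bsub>G\<^esub> g \<otimes>\<^bsub>G\<^esub> inv\<^bsub>G\<^esub> h"
  have "virtual_retract (generate G {?g}) G"
  proof -
    obtain v where v: "v \<in> verts \<Gamma>" "(\<exists>x\<in>carrier (Gv v). ?g = vx v x) \<or>
        (\<exists>ps. ps \<noteq> [] \<and> path_word v ps v \<and> cyclically_reduced ps \<and> ?g = path_eval ps)"
      using h(2) unfolding elliptic_or_reduced_def by blast
    from v(2) show ?thesis
    proof
      assume "\<exists>x\<in>carrier (Gv v). ?g = vx v x"
      then obtain x where x: "x \<in> carrier (Gv v)" "?g = vx v x" by blast
      show ?thesis unfolding x(2)
        using elliptic_finite_order[OF compat v(1) x(1)] elliptic_infinite_order[OF compat v(1) x(1)] by blast
    next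
      assume "\<exists>ps. ps \<noteq> [] \<and> path_word v ps v \<and> cyclically_reduced ps \<and> ?g = path_eval ps"
      then obtain ps where ps: "ps \<noteq> []" "path_word v ps v" "cyclically_reduced ps" "?g = path_eval ps" by blast
      show ?thesis unfolding ps(4) by (rule loxodromic[OF compat ps(2,1,3)])
    qed
  qed
  from G.virtual_retract_conj[OF this _ G.inv_closed[OF h(1)]]
  have "virtual_retract (generate G {inv\<^bsub>G\<^esub> h \<otimes>\<^bsub>G\<^esub> ?g \<otimes>\<^bsub>G\<^esub> inv\<^bsub>G\<^esub> (inv\<^bsub>G\<^esub> h)}) G"
    using gc h(1) by simp
  moreover have "inv\<^bsub>G\<^esub> h \<otimes>\<^bsub>G\<^esub> ?g \<otimes>\<^bsub>G\<^esub> inv\<^bsub>G\<^esub> (inv\<^bsub>G\<^esub> h) = g"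
    using gc h(1) by (simp add: G.m_assoc) (simp flip: G.m_assoc)
  ultimately show "virtual_retract H G" using g(2) by simp
qed

end

theorem corollary1p8:
  fixes \<Gamma> :: "('v, 'e) pre_digraph"
    and arev :: "'e \<Rightarrow> 'e"
    and Gv :: "'v \<Rightarrow> 'a monoid"
    and Ge :: "'e \<Rightarrow> 'b monoid"
    and \<alpha> :: "'e \<Rightarrow> 'b \<Rightarrow> 'a"
    and T :: "('v, 'e) pre_digraph"
    and Ep :: "'e set"
  assumes "finite_graph_of_groups \<Gamma> arev Gv Ge \<alpha>"
    and "euler_characteristic \<Gamma> \<ge> 0"
    and "\<And>v. v \<in> verts \<Gamma> \<Longrightarrow> comm_group (Gv v) \<and> finitely_generated (Gv v)"
    and "\<And>e. e \<in> arcs \<Gamma> \<Longrightarrow> cyclic_group (Ge e)"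
    and "maximal_tree arev \<Gamma> T"
    and "orientation arev \<Gamma> Ep"
  shows "VRC (fundamental_group \<Gamma> arev Gv Ge \<alpha> T Ep) \<longleftrightarrow>
         balanced (fundamental_group \<Gamma> arev Gv Ge \<alpha> T Ep)"
proof -
  interpret graph_of_abelian_groups \<Gamma> arev Gv Ge \<alpha> T Ep
    using assms unfolding graph_of_abelian_groups_def graph_of_abelian_groups_axioms_def by blast
  obtain P :: "('v \<Rightarrow> 'a) set monoid" and \<iota> :: "'v \<Rightarrow> 'a \<Rightarrow> ('v \<Rightarrow> 'a) set"
    where "graph_with_pushout \<Gamma> arev Gv Ge \<alpha> T Ep P \<iota>"
  proof (rule abelian_pushout)
    fix P :: "('v \<Rightarrow> 'a) set monoid" and \<iota> :: "'v \<Rightarrow> 'a \<Rightarrow> ('v \<Rightarrow> 'a) set"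
    assume "comm_group P" "finitely_generated P"
      "\<And>v. v \<in> verts \<Gamma> \<Longrightarrow> \<iota> v \<in> hom (Gv v) P"
      "\<And>v. v \<in> verts \<Gamma> \<Longrightarrow> inj_on (\<iota> v) (carrier (Gv v))"
      "\<And>e c. e \<in> arcs T \<Longrightarrow> c \<in> carrier (Ge e) \<Longrightarrow> \<iota> (tail \<Gamma> e) (\<alpha> e c) = \<iota> (head \<Gamma> e) (\<alpha> (arev e) c)"
      "\<And>u v x y. \<lbrakk>u \<in> verts \<Gamma>; v \<in> verts \<Gamma>; x \<in> carrier (Gv u); y \<in> carrier (Gv v); \<iota> u x = \<iota> v y\<rbrakk> \<Longrightarrow> vx u x = vx v y"
    then have "graph_with_pushout \<Gamma> arev Gv Ge \<alpha> T Ep P \<iota>"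
      using assms(2) graph_of_abelian_groups_axioms
      unfolding graph_with_pushout_def graph_with_pushout_axioms_def by blast
    then show thesis using that by blast
  qed
  then interpret graph_with_pushout \<Gamma> arev Gv Ge \<alpha> T Ep P \<iota> .
  show ?thesis using G.VRC_imp_balanced balanced_imp_VRC by blast
qed

end
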